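(* Let $\vec p=(p_1,\dots,p_n)$ with $1<\vec p<\infty$, and let either $1<\frac{n}{\sum_{i=1}^n 1/p_i}<t<r<\infty$ or $1<\frac{n}{\sum_{i=1}^n 1/p_i}\le t<r=\infty$. Then the dual space of $\mathcal H_{\vec p\,'}^{t',r'}$ is $M_{\vec p}^{t,r}$, that is, $\big(\mathcal H_{\vec p\,'}^{t',r'}\big)^*=M_{\vec p}^{t,r}$, in the following sense: (i) if $f\in M_{\vec p}^{t,r}$, then the linear functional $$L_f: g\mapsto L_f(g):=\int_{\mathbb R^n} g(x)f(x)\,dx$$ is bounded on $\mathcal H_{\vec p\,'}^{t',r'}$; (ii) conversely, any continuous linear functional on $\mathcal H_{\vec p\,'}^{t',r'}$ equals $L_f$ for a unique $f\in M_{\vec p}^{t,r}$. Moreover, $\|f\|_{M_{\vec p}^{t,r}}=\|L_f\|_{(\mathcal H_{\vec p\,'}^{t',r'})^*}$ for every $f\in M_{\vec p}^{t,r}$, and for every $g\in\mathcal H_{\vec p\,'}^{t',r'}$ $$\|g\|_{\mathcal H_{\vec p\,'}^{t',r'}}=\max\left\{\left|\int_{\mathbb R^n} g(x)f(x)\,dx\right| : f\in M_{\vec p}^{t,r},\ \|f\|_{M_{\vec p}^{t,r}}\le 1\right\}.$$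
   Context: Functions are complex-valued and measurable on $\mathbb R^n$, identified when equal almost everywhere. Inequalities for vectors $\vec p=(p_1,\dots,p_n)$ are componentwise. For $1\le s\le\infty$, $s'$ is the conjugate exponent, $1/s+1/s'=1$, and $\vec p\,'=(p_1',\dots,p_n')$. Mixed Lebesgue space: for $\vec p\in(0,\infty]^n$, $L^{\vec p}$ is the set of measurable $f$ with $$\|f\|_{L^{\vec p}}=\Big(\int_{\mathbb R}\cdots\Big(\int_{\mathbb R}|f(x_1,\dots,x_n)|^{p_1}dx_1\Big)^{p_2/p_1}\cdots dx_n\Big)^{1/p_n}<\infty$$ (essential supremum in $x_j$ if $p_j=\infty$). Dyadic cubes: $Q_{j,m}=\prod_{i=1}^n[2^{-j}m_i,2^{-j}(m_i+1))$, $j\in\mathbb Z$, $m\in\mathbb Z^n$; $\mathcal D=\{Q_{j,m}\}$ is the family of all of them. Mixed Bourgain-Morrey space: $M_{\vec p}^{t,r}$ is the set of measurable $f$ with $$\|f\|_{M_{\vec p}^{t,r}}=\Big(\sum_{Q\in\mathcal D}|Q|^{\frac rt-\frac rn\sum_{i=1}^n\frac1{p_i}}\|f\chi_Q\|_{L^{\vec p}}^r\Big)^{1/r}<\infty$$ (for $r=\infty$, the supremum over $Q\in\mathcal D$ of $|Q|^{\frac1t-\frac1n\sum_i\frac1{p_i}}\|f\chi_Q\|_{L^{\vec p}}$). Blocks: a measurable function $b$ is a $(\vec p\,',t')$-block supported on a cube $Q$ if $b$ is supported in $Q$ and $\|b\|_{L^{\vec p\,'}}\le|Q|^{\frac1t-\frac1n\sum_{i=1}^n\frac1{p_i}}$.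 Block space: $\mathcal H_{\vec p\,'}^{t',r'}$ is the set of measurable $f$ that can be written as $f=\sum_{(j,k)\in\mathbb Z\times\mathbb Z^n}\lambda_{j,k}b_{j,k}$, converging almost everywhere on $\mathbb R^n$, with $\lambda=\{\lambda_{j,k}\}\in\ell^{r'}(\mathbb Z^{n+1})$ and each $b_{j,k}$ a $(\vec p\,',t')$-block supported on $Q_{j,k}$. Its norm is $\|f\|_{\mathcal H_{\vec p\,'}^{t',r'}}=\inf_\lambda\|\lambda\|_{\ell^{r'}}$, the infimum being over all $\lambda$ admitting such a representation of $f$. *)

theory Defs
  imports "HOL-Analysis.Analysis" "HOL-Probability.Essential_Supremum"
begin

text \<open>
  Functions on \<open>\<real>\<^sup>n\<close> have type \<open>real ^ 'n \<Rightarrow> complex\<close>, where \<open>'n\<close> is a finite linearly ordered index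
  type: the order fixes which coordinate is \<open>x\<^sub>1\<close>, which is \<open>x\<^sub>2\<close>, and so on. ``Measurable'' is Lebesgue
  measurable; functions are not quotiented, and identification almost everywhere is made explicit.
  All exponents have type \<^typ>\<open>ennreal\<close>, so that \<open>\<infinity>\<close> is allowed, and all norms are extended values.
\<close>

text \<open>The notation \<open>real ^ 'n\<close> pins \<open>'n\<close> to the sort \<open>finite\<close>, which would clash with
  \<open>'n::{finite,linorder}\<close>; the synonyms leave the sort open.\<close>

type_synonym 'n rvec = "(real, 'n) vec"
type_synonym 'n ivec = "(int, 'n) vec"

subsection \<open>Exponents\<close>

text \<open>The power \<open>x\<^sup>a\<close> of an extended nonnegative number, for real exponents \<open>a > 0\<close>.\<close>

definition epow :: "ennreal \<Rightarrow> real \<Rightarrow> ennreal" where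
  "epow x a = (if x = \<infinity> then \<infinity> else ennreal (enn2real x powr a))"

text \<open>In \<^typ>\<open>ennreal\<close>, \<open>inverse 0 = \<infinity>\<close> and \<open>inverse \<infinity> = 0\<close>, so this covers \<open>1' = \<infinity>\<close> and \<open>\<infinity>' = 1\<close>.\<close>

definition conj_exp :: "ennreal \<Rightarrow> ennreal" where
  "conj_exp s = inverse (1 - inverse s)"

lemma conj_exp:
  assumes "1 \<le> s"
  shows "inverse s + inverse (conj_exp s) = 1"
proof -
  have inv: "inverse (inverse y) = y" for y :: ennreal
  proof (cases y rule: ennreal_cases)
    case (real x)
    then show ?thesis
      by (cases "x = 0") (simp_all add: inverse_ennreal)
  qed simp
  have "inverse s \<le> 1"
  proof (cases s rule: ennreal_cases)
    case (real x)
    then have "1 \<le> x"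
      using assms by (simp add: ennreal_1[symmetric] del: ennreal_1)
    then show ?thesis
      using real by (simp add: inverse_ennreal field_simps flip: ennreal_1)
  qed simp
  then have "inverse s + (1 - inverse s) = 1"
    by (rule add_diff_inverse_ennreal)
  then show ?thesis
    by (simp only: conj_exp_def inv)
qed

text \<open>The exponent \<open>1/t - (1/n) \<Sum>\<^sub>i 1/p\<^sub>i\<close> of \<open>|Q|\<close>.\<close>

definition scale_exp :: "('n::finite \<Rightarrow> ennreal) \<Rightarrow> ennreal \<Rightarrow> real" where
  "scale_exp p t =
     enn2real (inverse t) - (\<Sum>i\<in>UNIV. enn2real (inverse (p i))) / real CARD('n)"

subsection \<open>Mixed Lebesgue spaces\<close>

definition lp_norm :: "'a measure \<Rightarrow> ennreal \<Rightarrow> ('a \<Rightarrow> ennreal) \<Rightarrow> ennreal" where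
  "lp_norm M s g =
     (if s = \<infinity> then esssup M g
      else epow (\<integral>\<^sup>+ x. epow (g x) (enn2real s) \<partial>M) (1 / enn2real s))"

definition upd :: "real ^ 'n \<Rightarrow> 'n \<Rightarrow> real \<Rightarrow> real ^ 'n" where
  "upd x i s = (\<chi> j. if j = i then s else x $ j)"

text \<open>Take the norms in the coordinates listed, the head of the list innermost.\<close>

primrec iter_norm ::
    "('n \<Rightarrow> ennreal) \<Rightarrow> 'n list \<Rightarrow> (real ^ 'n \<Rightarrow> ennreal) \<Rightarrow> real ^ 'n \<Rightarrow> ennreal" where
  "iter_norm p [] g = g"
| "iter_norm p (i # is) g = iter_norm p is (\<lambda>x. lp_norm lebesgue (p i) (\<lambda>s. g (upd x i s)))"

lemma iter_norm_cong:
  assumes "\<And>j. j \<notin> set is \<Longrightarrow> j \<notin> A \<Longrightarrow> x $ j = y $ j"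
    and "\<And>x y. (\<And>j. j \<notin> A \<Longrightarrow> x $ j = y $ j) \<Longrightarrow> g x = g y"
  shows "iter_norm p is g x = iter_norm p is g y"
  using assms
proof (induction "is" arbitrary: A g)
  case Nil
  have "g x = g y"
    by (rule Nil(2)) (use Nil(1) in auto)
  then show ?case
    by (simp only: iter_norm.simps)
next
  case (Cons i "is")
  show ?case
    unfolding iter_norm.simps
  proof (rule Cons.IH[where A = "insert i A"])
    fix u v :: "real ^ 'a"
    assume uv: "\<And>j. j \<notin> insert i A \<Longrightarrow> u $ j = v $ j"
    have "g (upd u i s) = g (upd v i s)" for s
      by (rule Cons.prems(2)) (use uv in \<open>auto simp: upd_def\<close>)
    then show "lp_norm lebesgue (p i) (\<lambda>s. g (upd u i s)) = lp_norm lebesgue (p i) (\<lambda>s. g (upd v i s))"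
      by simp
  next
    show "x $ j = y $ j" if "j \<notin> set is" "j \<notin> insert i A" for j
      by (rule Cons.prems(1)) (use that in auto)
  qed
qed

text \<open>After all coordinates have been processed the iterated norm is constant, so the point at which
  it is evaluated does not matter.\<close>

lemma iter_norm_const:
  fixes p :: "'n::{finite,linorder} \<Rightarrow> ennreal"
  shows "iter_norm p (sorted_list_of_set UNIV) g x = iter_norm p (sorted_list_of_set UNIV) g y"
proof (rule iter_norm_cong[where A = "{}"])
  fix u v :: "'n rvec"
  assume "\<And>j. j \<notin> {} \<Longrightarrow> u $ j = v $ j"
  then have "u = v" by (simp add: vec_eq_iff)
  then show "g u = g v" by simp
qed simp

definition mixed_norm ::
    "('n::{finite,linorder} \<Rightarrow> ennreal) \<Rightarrow> ('n rvec \<Rightarrow> complex) \<Rightarrow> ennreal" where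
  "mixed_norm p f = iter_norm p (sorted_list_of_set UNIV) (\<lambda>x. ennreal (norm (f x))) 0"

subsection \<open>Mixed Bourgain--Morrey spaces\<close>

definition dyadic_cube :: "int \<Rightarrow> int ^ 'n \<Rightarrow> (real ^ 'n) set" where
  "dyadic_cube j m =
     {x. \<forall>i. 2 powi (- j) * of_int (m $ i) \<le> x $ i \<and> x $ i < 2 powi (- j) * (of_int (m $ i) + 1)}"

definition dyadic_cubes :: "(real ^ 'n) set set" where
  "dyadic_cubes = {dyadic_cube j m | j m. True}"

definition bm_norm ::
    "('n::{finite,linorder} \<Rightarrow> ennreal) \<Rightarrow> ennreal \<Rightarrow> ennreal \<Rightarrow> ('n rvec \<Rightarrow> complex) \<Rightarrow> ennreal" where
  "bm_norm p t r f =
     (if r = \<infinity> then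
        (SUP Q\<in>dyadic_cubes.
           ennreal (measure lebesgue Q powr scale_exp p t) * mixed_norm p (\<lambda>x. f x * indicator Q x))
      else
        epow (\<Sum>\<^sub>\<infinity>Q\<in>dyadic_cubes.
                ennreal (measure lebesgue Q powr (enn2real r * scale_exp p t)) *
                epow (mixed_norm p (\<lambda>x. f x * indicator Q x)) (enn2real r))
          (1 / enn2real r))"

definition bm_space ::
    "('n::{finite,linorder} \<Rightarrow> ennreal) \<Rightarrow> ennreal \<Rightarrow> ennreal \<Rightarrow> ('n rvec \<Rightarrow> complex) set" where
  "bm_space p t r = {f \<in> borel_measurable lebesgue. bm_norm p t r f < \<infinity>}"

subsection \<open>Block spaces\<close>

text \<open>The parameters below are \<open>p\<close>, \<open>t\<close>, \<open>r\<close>; the primes are applied inside, so \<open>block p t\<close> is a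
  \<open>(p', t')\<close>-block and \<open>block_space p t r\<close> is the space with parameters \<open>p'\<close>, \<open>t'\<close>, \<open>r'\<close>.\<close>

definition block ::
    "('n::{finite,linorder} \<Rightarrow> ennreal) \<Rightarrow> ennreal \<Rightarrow> ('n rvec) set \<Rightarrow> ('n rvec \<Rightarrow> complex) \<Rightarrow> bool" where
  "block p t Q b \<longleftrightarrow>
     b \<in> borel_measurable lebesgue \<and>
     (AE x in lebesgue. x \<notin> Q \<longrightarrow> b x = 0) \<and>
     mixed_norm (\<lambda>i. conj_exp (p i)) b \<le> ennreal (measure lebesgue Q powr scale_exp p t)"

definition seq_norm :: "ennreal \<Rightarrow> ('i \<Rightarrow> complex) \<Rightarrow> ennreal" where
  "seq_norm s l = lp_norm (count_space UNIV) s (\<lambda>i. ennreal (norm (l i)))"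

text \<open>The index set carries no order, so the series is an unordered sum.\<close>

definition block_rep ::
    "('n::{finite,linorder} \<Rightarrow> ennreal) \<Rightarrow> ennreal \<Rightarrow> ennreal \<Rightarrow> ('n rvec \<Rightarrow> complex) \<Rightarrow>
     (int \<times> 'n ivec \<Rightarrow> complex) \<Rightarrow> (int \<times> 'n ivec \<Rightarrow> 'n rvec \<Rightarrow> complex) \<Rightarrow> bool" where
  "block_rep p t r g l b \<longleftrightarrow>
     seq_norm (conj_exp r) l < \<infinity> \<and>
     (\<forall>j k. block p t (dyadic_cube j k) (b (j, k))) \<and>
     (AE x in lebesgue. ((\<lambda>i. l i * b i x) has_sum g x) UNIV)"

definition block_space ::
    "('n::{finite,linorder} \<Rightarrow> ennreal) \<Rightarrow> ennreal \<Rightarrow> ennreal \<Rightarrow> ('n rvec \<Rightarrow> complex) set" where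
  "block_space p t r = {g \<in> borel_measurable lebesgue. \<exists>l b. block_rep p t r g l b}"

definition block_norm ::
    "('n::{finite,linorder} \<Rightarrow> ennreal) \<Rightarrow> ennreal \<Rightarrow> ennreal \<Rightarrow> ('n rvec \<Rightarrow> complex) \<Rightarrow> ennreal" where
  "block_norm p t r g = Inf {seq_norm (conj_exp r) l | l. \<exists>b. block_rep p t r g l b}"

subsection \<open>Functionals on the block space\<close>

text \<open>A linear functional on the space of almost-everywhere classes is a map on functions that is
  linear on the space and takes equal values on almost everywhere equal functions.\<close>

definition linear_functional ::
    "('n::{finite,linorder} \<Rightarrow> ennreal) \<Rightarrow> ennreal \<Rightarrow> ennreal \<Rightarrow> (('n rvec \<Rightarrow> complex) \<Rightarrow> complex) \<Rightarrow> bool" where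
  "linear_functional p t r L \<longleftrightarrow>
     (\<forall>g\<in>block_space p t r. \<forall>h\<in>block_space p t r. L (\<lambda>x. g x + h x) = L g + L h) \<and>
     (\<forall>c. \<forall>g\<in>block_space p t r. L (\<lambda>x. c * g x) = c * L g) \<and>
     (\<forall>g\<in>block_space p t r. \<forall>h\<in>block_space p t r. (AE x in lebesgue. g x = h x) \<longrightarrow> L g = L h)"

definition bounded_functional ::
    "('n::{finite,linorder} \<Rightarrow> ennreal) \<Rightarrow> ennreal \<Rightarrow> ennreal \<Rightarrow> (('n rvec \<Rightarrow> complex) \<Rightarrow> complex) \<Rightarrow> bool" where
  "bounded_functional p t r L \<longleftrightarrow>
     (\<exists>C\<ge>0. \<forall>g\<in>block_space p t r. ennreal (norm (L g)) \<le> ennreal C * block_norm p t r g)"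

definition continuous_functional ::
    "('n::{finite,linorder} \<Rightarrow> ennreal) \<Rightarrow> ennreal \<Rightarrow> ennreal \<Rightarrow> (('n rvec \<Rightarrow> complex) \<Rightarrow> complex) \<Rightarrow> bool" where
  "continuous_functional p t r L \<longleftrightarrow>
     (\<forall>g\<in>block_space p t r. \<forall>\<epsilon>>0. \<exists>\<delta>>0. \<forall>h\<in>block_space p t r.
        block_norm p t r (\<lambda>x. h x - g x) < ennreal \<delta> \<longrightarrow> norm (L h - L g) < \<epsilon>)"

definition dual_norm ::
    "('n::{finite,linorder} \<Rightarrow> ennreal) \<Rightarrow> ennreal \<Rightarrow> ennreal \<Rightarrow> (('n rvec \<Rightarrow> complex) \<Rightarrow> complex) \<Rightarrow> ennreal" where
  "dual_norm p t r L =
     (SUP g\<in>{g \<in> block_space p t r. block_norm p t r g \<le> 1}. ennreal (norm (L g)))"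

definition pairing :: "(real ^ 'n \<Rightarrow> complex) \<Rightarrow> (real ^ 'n \<Rightarrow> complex) \<Rightarrow> complex" where
  "pairing f g = (\<integral>x. g x * f x \<partial>lebesgue)"

end

theory Submission
  imports Defs
begin

text \<open>
Fix a function \<open>f\<close> in the mixed Bourgain-Morrey space and a series \<open>g = \<Sum>\<^sub>Q \<lambda>\<^sub>Q b\<^sub>Q\<close> of blocks. Hoelder's
inequality for mixed norms on each cube, followed by Hoelder's inequality for sequences over the
cubes, bounds \<open>\<integral> \<bar>g f\<bar>\<close> by the \<open>r'\<close>-norm of \<open>\<lambda>\<close> times the norm of \<open>f\<close> (\<open>pairing_le_rep\<close>). Hence \<open>f\<close> induces
a functional whose norm is at most that of \<open>f\<close>.

Both uses of Hoelder's inequality are sharp, and this gives the converse inequality. On a single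
cube the mixed norm of \<open>f\<close> is nearly attained by a bounded function (\<open>mixed_enorm_duality\<close>), which
is built one coordinate at a time (\<open>iter_norm_extremal\<close>); over the cubes one uses the extremal
sequence of \<open>\<ell>\<^sup>r\<close> (\<open>lp_norm_le_by_duality\<close>). So every locally integrable \<open>f\<close> that represents a functional of
bound \<open>K\<close> on the bounded functions living on single cubes has norm at most \<open>K\<close>
(\<open>bm_norm_le_of_bounded_functional\<close>); in particular \<open>f\<close> belongs to the space.

For a bounded functional \<open>L\<close>, the set function \<open>B \<mapsto> L \<chi>\<^sub>B\<close> on the sets covered by finitely many cubes
is countably additive by dominated convergence for mixed norms; it vanishes on null sets and is
bounded on the subsets of each such set. Its real and imaginary parts therefore have densities: their positive
and negative variations are measures to which the Radon-Nikodym theorem applies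
(\<open>local_charge.ex_density\<close>). This produces the candidate \<open>f\<close>, and the converse inequality places it in
the Bourgain-Morrey space. A bounded functional that vanishes on bounded functions living on single
cubes is zero (\<open>bounded_linear_on_eq_0\<close>): a block is the limit of its truncations because the
conjugate exponents are finite, and a block series is the limit of its partial sums because \<open>r'\<close> is
finite. Hence \<open>L\<close> is integration against \<open>f\<close> on the whole space.

The block norm is a seminorm, so the Hahn-Banach theorem yields for each \<open>g\<close> a functional of norm at
most one whose value at \<open>g\<close> is the norm of \<open>g\<close>. Being represented by some \<open>f\<close>, it shows that the
maximum in the last formula is attained.
\<close>

section \<open>Powers of extended nonnegative numbers\<close>

lemma epow_ennreal: "0 \<le> x \<Longrightarrow> epow (ennreal x) a = ennreal (x powr a)"
  by (simp add: epow_def)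

lemma epow_0 [simp]: "epow 0 a = 0"
  by (simp add: epow_def)

lemma epow_top [simp]: "epow top a = top"
  by (simp add: epow_def)

lemma epow_eq_top [simp]: "epow x a = top \<longleftrightarrow> x = top"
  by (simp add: epow_def)

lemma epow_one_exp [simp]: "epow x 1 = x"
  by (cases x) (simp_all add: epow_ennreal)

lemma epow_1 [simp]: "epow 1 a = 1"
  using epow_ennreal[of 1 a] by simp

lemma epow_indicator [simp]: "epow (indicator A x) a = indicator A x"
  by (simp add: indicator_def)

lemma epow_eq_0 [simp]: "epow x a = 0 \<longleftrightarrow> x = 0"
  by (cases x) (simp_all add: epow_ennreal)

lemma epow_less_top: "x < top \<Longrightarrow> epow x a < top"
  by (metis epow_eq_top less_top)

lemma epow_epow: "epow (epow x a) b = epow x (a * b)"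
  by (cases x) (simp_all add: epow_ennreal powr_powr)

lemma epow_inverse: "a \<noteq> 0 \<Longrightarrow> epow (epow x a) (1 / a) = x" "a \<noteq> 0 \<Longrightarrow> epow (epow x (1 / a)) a = x"
  by (simp_all add: epow_epow)

lemma epow_mult: "epow (x * y) a = epow x a * epow y a"
proof (cases "x = 0 \<or> y = 0")
  case False
  then show ?thesis
    by (cases x; cases y)
      (auto simp: epow_ennreal ennreal_mult[symmetric] powr_mult ennreal_top_mult ennreal_mult_top)
qed auto

lemma epow_add: "epow x (a + b) = epow x a * epow x b"
  by (cases x) (auto simp: epow_ennreal powr_add ennreal_mult ennreal_top_mult)

lemma epow_mono: "x \<le> y \<Longrightarrow> 0 \<le> a \<Longrightarrow> epow x a \<le> epow y a"
  by (cases x; cases y) (auto simp: epow_ennreal powr_mono2 top_unique intro!: ennreal_leI)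

lemma epow_le_iff:
  assumes "0 < a"
  shows "epow x a \<le> epow y a \<longleftrightarrow> x \<le> y"
proof
  assume "epow x a \<le> epow y a"
  from epow_mono[OF this, of "1 / a"] show "x \<le> y"
    using assms by (simp add: epow_inverse)
qed (use assms in \<open>simp add: epow_mono\<close>)

lemma epow_le_swap: "0 < a \<Longrightarrow> epow x (1 / a) \<le> y \<longleftrightarrow> x \<le> epow y a"
  by (metis epow_inverse(2) epow_le_iff less_irrefl)

text \<open>
With \<open>epow_le_swap\<close> this says that, for \<open>a > 0\<close>, the map \<open>epow _ a\<close> is an order isomorphism with inverse \<open>epow _ (1 / a)\<close>,
which is all that continuity needs.
\<close>

lemma le_epow_swap: "0 < a \<Longrightarrow> y \<le> epow x (1 / a) \<longleftrightarrow> epow y a \<le> x"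
  by (metis epow_inverse(2) epow_le_iff less_irrefl)

lemma tendsto_epow:
  assumes f: "(f \<longlongrightarrow> l) F" and a: "0 < a"
  shows "((\<lambda>x. epow (f x) a) \<longlongrightarrow> epow l a) F"
proof (rule order_tendstoI)
  fix c assume "c < epow l a"
  then have "epow c (1 / a) < l"
    using a by (simp add: le_epow_swap not_le[symmetric])
  from order_tendstoD(1)[OF f this] show "\<forall>\<^sub>F x in F. c < epow (f x) a"
    by (rule eventually_mono) (use a in \<open>simp add: le_epow_swap not_le[symmetric]\<close>)
next
  fix c assume "epow l a < c"
  then have "l < epow c (1 / a)"
    using a by (simp add: epow_le_swap not_le[symmetric])
  from order_tendstoD(2)[OF f this] show "\<forall>\<^sub>F x in F. epow (f x) a < c"
    by (rule eventually_mono) (use a in \<open>simp add: epow_le_swap not_le[symmetric]\<close>)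
qed

lemma measurable_epow [measurable]: "(\<lambda>x. epow x a) \<in> borel_measurable borel"
  unfolding epow_def by measurable

lemma measurable_epow' [measurable (raw)]:
  "f \<in> borel_measurable M \<Longrightarrow> (\<lambda>x. epow (f x) a) \<in> borel_measurable M"
  using measurable_compose[OF _ measurable_epow] .

section \<open>Lebesgue norms in one variable\<close>

text \<open>
For these exponents \<open>lp_norm\<close> is a power of an integral, never an essential supremum, and the triangle
inequality holds.
\<close>

definition fin_exp :: "ennreal \<Rightarrow> bool" where
  "fin_exp s \<longleftrightarrow> 1 \<le> s \<and> s < \<infinity>"

lemma fin_expD:
  assumes "fin_exp s"
  shows "1 \<le> enn2real s" "s \<noteq> \<infinity>"
  using assms unfolding fin_exp_def
  by (cases s; simp add: ennreal_1[symmetric] del: ennreal_1)+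

lemma fin_exp_one [simp]: "fin_exp 1"
  by (simp add: fin_exp_def)

lemma lp_norm_eq:
  "fin_exp s \<Longrightarrow> lp_norm M s g = epow (\<integral>\<^sup>+ x. epow (g x) (enn2real s) \<partial>M) (1 / enn2real s)"
  using fin_expD(2)[of s] by (simp add: lp_norm_def)

lemma lp_norm_one: "lp_norm M 1 g = (\<integral>\<^sup>+ x. g x \<partial>M)"
  by (simp add: lp_norm_eq fin_exp_def)

lemma epow_lp_norm:
  "fin_exp s \<Longrightarrow> epow (lp_norm M s g) (enn2real s) = (\<integral>\<^sup>+ x. epow (g x) (enn2real s) \<partial>M)"
  using fin_expD(1)[of s] by (simp add: lp_norm_eq epow_inverse)

lemma lp_norm_mono_AE:
  assumes "fin_exp s" "AE x in M. f x \<le> g x"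
  shows "lp_norm M s f \<le> lp_norm M s g"
  unfolding lp_norm_eq[OF assms(1)] using fin_expD(1)[OF assms(1)]
  by (intro epow_mono nn_integral_mono_AE eventually_mono[OF assms(2)]) auto

lemma lp_norm_cong_AE:
  assumes "fin_exp s" "AE x in M. f x = g x"
  shows "lp_norm M s f = lp_norm M s g"
  by (intro antisym lp_norm_mono_AE assms eventually_mono[OF assms(2)]) auto

lemma lp_norm_0 [simp]: "fin_exp s \<Longrightarrow> lp_norm M s (\<lambda>x. 0) = 0"
  by (simp add: lp_norm_eq)

lemma lp_norm_cmult:
  assumes "fin_exp s" "f \<in> borel_measurable M"
  shows "lp_norm M s (\<lambda>x. c * f x) = c * lp_norm M s f"
  using assms fin_expD(1)[OF assms(1)]
  by (simp add: lp_norm_eq epow_mult nn_integral_cmult epow_inverse)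

lemma lp_norm_eq_0_iff:
  assumes "fin_exp s" "f \<in> borel_measurable M"
  shows "lp_norm M s f = 0 \<longleftrightarrow> (AE x in M. f x = 0)"
  using assms by (simp add: lp_norm_eq nn_integral_0_iff_AE)

text \<open>
Nonnegative integrals do not change under completion, even for integrands that are not measurable.
This is why all iterated norms below can be computed with \<^term>\<open>lborel\<close>, for which Tonelli's theorem is
available.
\<close>

lemma lp_norm_completion: "lp_norm (completion M) s f = lp_norm M s f" if "fin_exp s"
  using that by (simp add: lp_norm_eq nn_integral_completion)

lemma conj_exp_enn2real:
  assumes "1 < s" "s < \<infinity>"
  shows "1 < enn2real s" "1 < conj_exp s" "conj_exp s < \<infinity>" "fin_exp s" "fin_exp (conj_exp s)"
    "1 < enn2real (conj_exp s)" "1 / enn2real s + 1 / enn2real (conj_exp s) = 1"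
    "(enn2real s - 1) * enn2real (conj_exp s) = enn2real s"
proof -
  obtain x where x: "s = ennreal x" "0 \<le> x"
    using assms by (cases s) auto
  then have x1: "1 < x"
    using assms by (simp add: ennreal_less_iff[of 1, simplified])
  have c: "conj_exp s = ennreal (x / (x - 1))"
  proof -
    have "1 - inverse s = ennreal (1 - 1 / x)"
      using x x1 by (simp add: inverse_ennreal ennreal_minus[symmetric] divide_inverse)
    then show ?thesis
      unfolding conj_exp_def using x1 by (simp add: inverse_ennreal field_simps)
  qed
  have y1: "1 < x / (x - 1)" using x1 by (simp add: field_simps)
  show "1 < enn2real s" using x x1 by simp
  show *: "1 < conj_exp s" "conj_exp s < \<infinity>" "fin_exp s"
    using x x1 y1 assms unfolding c fin_exp_def by (auto simp: ennreal_1[symmetric] ennreal_less_iff simp del: ennreal_1)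
  then show "fin_exp (conj_exp s)" by (auto simp: fin_exp_def)
  show "1 < enn2real (conj_exp s)" "1 / enn2real s + 1 / enn2real (conj_exp s) = 1"
    "(enn2real s - 1) * enn2real (conj_exp s) = enn2real s"
    using x x1 y1 unfolding c by (auto simp: field_simps)
qed

lemma Youngs_inequality_ennreal:
  assumes a: "1 < a" and b: "1 < b" and ab: "1 / a + 1 / b = 1"
  shows "x * y \<le> ennreal (1 / a) * epow x a + ennreal (1 / b) * epow y b"
proof (cases "x = 0 \<or> y = 0")
  case False
  show ?thesis
  proof (cases x)
    case x: (real u)
    show ?thesis
    proof (cases y)
      case y: (real v)
      have "u * v \<le> u powr a / a + v powr b / b"
        using Youngs_inequality[of a b u v] a b ab x y by simp
      then have "x * y \<le> ennreal (u powr a / a + v powr b / b)"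
        using x y by (simp add: ennreal_mult[symmetric] ennreal_leI)
      also have "\<dots> = ennreal (1 / a) * epow x a + ennreal (1 / b) * epow y b"
        using x y a b by (simp add: epow_ennreal ennreal_mult[symmetric] ennreal_plus[symmetric] del: ennreal_plus)
      finally show ?thesis .
    next
      case top
      then show ?thesis using b by (simp add: ennreal_mult_top)
    qed
  next
    case top
    then show ?thesis using a by (simp add: ennreal_mult_top)
  qed
qed auto

text \<open>
Normalising both factors to norm one and integrating Young's inequality gives the bound; the
normalisation is possible unless one of the norms is \<open>0\<close> or \<open>\<infinity>\<close>.
\<close>

lemma lp_norm_Holder:
  assumes s: "1 < s" "s < \<infinity>" and [measurable]: "f \<in> borel_measurable M" "g \<in> borel_measurable M"
  shows "(\<integral>\<^sup>+ x. f x * g x \<partial>M) \<le> lp_norm M s f * lp_norm M (conj_exp s) g"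
proof -
  note e = conj_exp_enn2real[OF s]
  let ?a = "enn2real s" and ?b = "enn2real (conj_exp s)"
  define A where "A = lp_norm M s f"
  define B where "B = lp_norm M (conj_exp s) g"
  consider "A = 0 \<or> B = 0" | "A \<noteq> 0" "B \<noteq> 0" "A = top \<or> B = top" | "A \<noteq> 0" "B \<noteq> 0" "A \<noteq> top" "B \<noteq> top"
    by blast
  then show ?thesis
  proof cases
    case 1
    then have "(AE x in M. f x = 0) \<or> (AE x in M. g x = 0)"
      using e by (simp add: A_def B_def lp_norm_eq_0_iff)
    then have "AE x in M. f x * g x = 0" by auto
    then have "(\<integral>\<^sup>+ x. f x * g x \<partial>M) = 0"
      by (subst nn_integral_0_iff_AE) auto
    then show ?thesis by simp
  next
    case 2
    then show ?thesis unfolding A_def[symmetric] B_def[symmetric]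
      by (auto simp: ennreal_mult_top ennreal_top_mult)
  next
    case 3
    define u where "u x = f x / A" for x
    define v where "v x = g x / B" for x
    have [measurable]: "u \<in> borel_measurable M" "v \<in> borel_measurable M"
      unfolding u_def v_def by measurable
    have fu: "f x = A * u x" and gv: "g x = B * v x" for x
      using 3 unfolding u_def v_def
      by (metis ennreal_times_divide mult.commute mult_divide_eq_ennreal)+
    have "A = A * lp_norm M s u"
      using lp_norm_cmult[OF e(4), of u M A] unfolding fu[symmetric] A_def[symmetric] by simp
    then have "lp_norm M s u = 1"
      using 3 by (metis ennreal_mult_cancel_left mult.right_neutral)
    then have u1: "(\<integral>\<^sup>+ x. epow (u x) ?a \<partial>M) = 1"
      using epow_lp_norm[OF e(4), of M u] by simp
    have "B = B * lp_norm M (conj_exp s) v"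
      using lp_norm_cmult[OF e(5), of v M B] unfolding gv[symmetric] B_def[symmetric] by simp
    then have "lp_norm M (conj_exp s) v = 1"
      using 3 by (metis ennreal_mult_cancel_left mult.right_neutral)
    then have v1: "(\<integral>\<^sup>+ x. epow (v x) ?b \<partial>M) = 1"
      using epow_lp_norm[OF e(5), of M v] by simp
    have "(\<integral>\<^sup>+ x. u x * v x \<partial>M)
        \<le> (\<integral>\<^sup>+ x. ennreal (1 / ?a) * epow (u x) ?a + ennreal (1 / ?b) * epow (v x) ?b \<partial>M)"
      by (intro nn_integral_mono Youngs_inequality_ennreal e)
    also have "\<dots> = ennreal (1 / ?a) + ennreal (1 / ?b)"
      by (simp add: nn_integral_add nn_integral_cmult u1 v1)
    also have "\<dots> = 1"
      using e by (subst ennreal_plus[symmetric]) auto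
    finally have 1: "(\<integral>\<^sup>+ x. u x * v x \<partial>M) \<le> 1" .
    have "(\<integral>\<^sup>+ x. f x * g x \<partial>M) = (\<integral>\<^sup>+ x. (A * B) * (u x * v x) \<partial>M)"
      by (simp add: fu gv ac_simps)
    also have "\<dots> = (A * B) * (\<integral>\<^sup>+ x. u x * v x \<partial>M)"
      by (rule nn_integral_cmult) simp
    also have "\<dots> \<le> A * B * 1"
      by (intro mult_left_mono 1) simp
    finally show ?thesis by (simp add: A_def B_def)
  qed
qed

text \<open>
Equality in Hoelder's inequality: \<open>h\<^sup>s\<^sup>-\<^sup>1\<close> has conjugate norm \<open>\<parallel>h\<parallel>\<^sup>s\<^sup>-\<^sup>1\<close>, because \<open>(s - 1) s' = s\<close>.
\<close>

lemma lp_norm_extremal: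
  fixes h :: "'a \<Rightarrow> ennreal"
  assumes s: "1 < s" "s < \<infinity>" and [measurable]: "h \<in> borel_measurable M"
    and fin: "lp_norm M s h < \<infinity>"
  defines "k \<equiv> \<lambda>x. epow (h x) (enn2real s - 1) / epow (lp_norm M s h) (enn2real s - 1)"
  shows "lp_norm M s h \<noteq> 0 \<Longrightarrow> lp_norm M (conj_exp s) k = 1"
    and "lp_norm M s h \<noteq> 0 \<Longrightarrow> (\<integral>\<^sup>+ x. h x * k x \<partial>M) = lp_norm M s h"
proof -
  note e = conj_exp_enn2real[OF s]
  let ?a = "enn2real s" and ?b = "enn2real (conj_exp s)"
  define A where "A = lp_norm M s h"
  assume A0': "lp_norm M s h \<noteq> 0"
  then have A: "A \<noteq> 0" "A \<noteq> top" using fin by (auto simp: A_def)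
  have A': "epow A (?a - 1) \<noteq> 0" "epow A (?a - 1) \<noteq> top"
    using A by auto
  have k: "k x = inverse (epow A (?a - 1)) * epow (h x) (?a - 1)" for x
    by (simp add: k_def A_def divide_ennreal_def mult.commute)
  have "lp_norm M (conj_exp s) (\<lambda>x. epow (h x) (?a - 1)) = epow (epow A ?a) (1 / ?b)"
    using e by (simp add: lp_norm_eq[OF e(5)] epow_epow A_def epow_lp_norm)
  also have "\<dots> = epow A (?a - 1)"
  proof -
    have "?a * (1 / ?b) = ?a - 1" using e(6,8) by (simp add: field_simps)
    then show ?thesis by (simp add: epow_epow)
  qed
  finally have 1: "lp_norm M (conj_exp s) (\<lambda>x. epow (h x) (?a - 1)) = epow A (?a - 1)" .
  have inv: "inverse (epow A (?a - 1)) * epow A (?a - 1) = 1"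
    using A' by (metis divide_ennreal_def ennreal_divide_self mult.commute less_top)
  show "lp_norm M (conj_exp s) k = 1"
    unfolding k using 1 by (subst lp_norm_cmult) (auto simp: e inv)
  have "(\<integral>\<^sup>+ x. h x * k x \<partial>M) = (\<integral>\<^sup>+ x. inverse (epow A (?a - 1)) * epow (h x) ?a \<partial>M)"
    using epow_add[of _ 1 "?a - 1"] by (simp add: k ac_simps)
  also have "\<dots> = inverse (epow A (?a - 1)) * (\<integral>\<^sup>+ x. epow (h x) ?a \<partial>M)"
    by (rule nn_integral_cmult) simp
  also have "(\<integral>\<^sup>+ x. epow (h x) ?a \<partial>M) = epow A (?a - 1) * A"
    using epow_add[of A "?a - 1" 1] by (simp add: epow_lp_norm[OF e(4), symmetric] A_def)
  also have "inverse (epow A (?a - 1)) * (epow A (?a - 1) * A) = A"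
    using inv by (simp add: mult.assoc[symmetric])
  finally show "(\<integral>\<^sup>+ x. h x * k x \<partial>M) = lp_norm M s h" by (simp add: A_def)
qed

lemma convex_epow:
  assumes a: "1 \<le> a" and uv: "0 \<le> \<alpha>" "0 \<le> \<beta>" "\<alpha> + \<beta> = 1"
  shows "epow (ennreal \<alpha> * x + ennreal \<beta> * y) a \<le> ennreal \<alpha> * epow x a + ennreal \<beta> * epow y a"
proof (cases "\<alpha> = 0 \<or> \<beta> = 0")
  case True
  then show ?thesis using uv by auto
next
  case False
  show ?thesis
  proof (cases x)
    case x: (real u)
    show ?thesis
    proof (cases y)
      case y: (real v)
      have "(\<alpha> * u + \<beta> * v) powr a \<le> \<alpha> * u powr a + \<beta> * v powr a"
      proof (cases "u = 0 \<or> v = 0")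
        case True
        have "\<gamma> powr a \<le> \<gamma>" if "0 \<le> \<gamma>" "\<gamma> \<le> 1" for \<gamma> :: real
          using powr_mono'[OF a, of \<gamma>] that by (cases "\<gamma> = 0") auto
        then have "\<alpha> powr a * u powr a \<le> \<alpha> * u powr a" "\<beta> powr a * v powr a \<le> \<beta> * v powr a"
          using uv by (auto intro!: mult_right_mono)
        then show ?thesis
          using True x y uv by (auto simp: powr_mult)
      next
        case False
        have *: "\<alpha> = 1 - \<beta>" using uv by simp
        show ?thesis
          using convex_onD[OF powr_convex[OF a], of \<beta> u v] x y uv(1,2) False unfolding * by simp
      qed
      then show ?thesis
        using x y uv
        by (simp add: epow_ennreal ennreal_mult[symmetric] ennreal_plus[symmetric] ennreal_leI
            del: ennreal_plus)
    next
      case top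
      then show ?thesis using False uv by (simp add: ennreal_mult_top)
    qed
  next
    case top
    then show ?thesis using False uv by (simp add: ennreal_mult_top)
  qed
qed

text \<open>
If \<open>A\<close> and \<open>B\<close> bound the two norms, then \<open>(f + g) / (A + B)\<close> is a convex combination of \<open>f / A\<close> and \<open>g / B\<close>,
and convexity of the power bounds its norm by one. Bounds that are slightly larger than the norms
keep \<open>A\<close> and \<open>B\<close> positive.
\<close>

lemma lp_norm_triangle:
  assumes s: "fin_exp s" and [measurable]: "f \<in> borel_measurable M" "g \<in> borel_measurable M"
  shows "lp_norm M s (\<lambda>x. f x + g x) \<le> lp_norm M s f + lp_norm M s g"
proof -
  note e = fin_expD[OF s]
  let ?a = "enn2real s"
  have pos: "lp_norm M s (\<lambda>x. f' x + g' x) \<le> A + B"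
    if AB: "0 < A" "0 < B" "lp_norm M s f' \<le> ennreal A" "lp_norm M s g' \<le> ennreal B"
      and [measurable]: "f' \<in> borel_measurable M" "g' \<in> borel_measurable M" for A B :: real and f' g'
  proof -
    define \<alpha> where "\<alpha> = A / (A + B)"
    define \<beta> where "\<beta> = B / (A + B)"
    have ab: "0 \<le> \<alpha>" "0 \<le> \<beta>" "\<alpha> + \<beta> = 1"
      using AB by (auto simp: \<alpha>_def \<beta>_def add_divide_distrib[symmetric])
    define u where "u x = ennreal (1 / A) * f' x" for x
    define v where "v x = ennreal (1 / B) * g' x" for x
    have [measurable]: "u \<in> borel_measurable M" "v \<in> borel_measurable M"
      unfolding u_def v_def by measurable
    have "lp_norm M s u \<le> ennreal (1 / A) * ennreal A"
      unfolding u_def by (subst lp_norm_cmult) (auto simp: s AB intro!: mult_left_mono)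
    also have "\<dots> = 1" using AB by (simp add: ennreal_mult[symmetric])
    finally have u1: "(\<integral>\<^sup>+ x. epow (u x) ?a \<partial>M) \<le> 1"
      using epow_mono[of "lp_norm M s u" 1 ?a] e by (simp add: epow_lp_norm[OF s])
    have "lp_norm M s v \<le> ennreal (1 / B) * ennreal B"
      unfolding v_def by (subst lp_norm_cmult) (auto simp: s AB intro!: mult_left_mono)
    also have "\<dots> = 1" using AB by (simp add: ennreal_mult[symmetric])
    finally have v1: "(\<integral>\<^sup>+ x. epow (v x) ?a \<partial>M) \<le> 1"
      using epow_mono[of "lp_norm M s v" 1 ?a] e by (simp add: epow_lp_norm[OF s])
    have "f' x + g' x = ennreal (A + B) * (ennreal \<alpha> * u x + ennreal \<beta> * v x)" for x
    proof -
      have "ennreal (A + B) * (ennreal \<alpha> * (ennreal (1 / A) * f' x)) = f' x"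
        "ennreal (A + B) * (ennreal \<beta> * (ennreal (1 / B) * g' x)) = g' x"
        using AB unfolding mult.assoc[symmetric]
        by (simp_all add: ennreal_mult[symmetric] \<alpha>_def \<beta>_def del: ennreal_plus)
      then show ?thesis by (simp add: u_def v_def distrib_left del: ennreal_plus)
    qed
    then have "lp_norm M s (\<lambda>x. f' x + g' x) = ennreal (A + B) * lp_norm M s (\<lambda>x. ennreal \<alpha> * u x + ennreal \<beta> * v x)"
      by (simp only:) (rule lp_norm_cmult, auto simp: s)
    also have "lp_norm M s (\<lambda>x. ennreal \<alpha> * u x + ennreal \<beta> * v x) \<le> 1"
    proof -
      have "(\<integral>\<^sup>+ x. epow (ennreal \<alpha> * u x + ennreal \<beta> * v x) ?a \<partial>M)
          \<le> (\<integral>\<^sup>+ x. ennreal \<alpha> * epow (u x) ?a + ennreal \<beta> * epow (v x) ?a \<partial>M)"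
        by (intro nn_integral_mono convex_epow e ab)
      also have "\<dots> = ennreal \<alpha> * (\<integral>\<^sup>+ x. epow (u x) ?a \<partial>M) + ennreal \<beta> * (\<integral>\<^sup>+ x. epow (v x) ?a \<partial>M)"
        by (simp add: nn_integral_add nn_integral_cmult)
      also have "\<dots> \<le> ennreal \<alpha> * 1 + ennreal \<beta> * 1"
        by (intro add_mono mult_left_mono u1 v1) auto
      also have "\<dots> = 1" using ab by (simp add: ennreal_plus[symmetric] del: ennreal_plus)
      finally show ?thesis
        unfolding lp_norm_eq[OF s] using e epow_mono[of _ 1 "1 / ?a"] by simp
    qed
    then have "ennreal (A + B) * lp_norm M s (\<lambda>x. ennreal \<alpha> * u x + ennreal \<beta> * v x) \<le> ennreal (A + B) * 1"
      by (intro mult_left_mono) auto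
    finally show ?thesis using AB by simp
  qed
  show ?thesis
  proof (cases "lp_norm M s f = top \<or> lp_norm M s g = top")
    case True
    then show ?thesis by auto
  next
    case False
    then obtain A B where AB: "lp_norm M s f = ennreal A" "0 \<le> A" "lp_norm M s g = ennreal B" "0 \<le> B"
      by (cases "lp_norm M s f"; cases "lp_norm M s g") auto
    show ?thesis
    proof (rule ennreal_le_epsilon)
      fix \<epsilon> :: real assume "0 < \<epsilon>"
      then have "lp_norm M s (\<lambda>x. f x + g x) \<le> ennreal (A + \<epsilon> / 2) + ennreal (B + \<epsilon> / 2)"
        using AB pos[of "A + \<epsilon> / 2" "B + \<epsilon> / 2" f g]
        by (subst ennreal_plus[symmetric]) (auto intro!: ennreal_leI simp del: ennreal_plus)
      also have "\<dots> = lp_norm M s f + lp_norm M s g + ennreal \<epsilon>"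
        using AB \<open>0 < \<epsilon>\<close> by (simp add: ennreal_plus[symmetric] del: ennreal_plus)
      finally show "lp_norm M s (\<lambda>x. f x + g x) \<le> lp_norm M s f + lp_norm M s g + ennreal \<epsilon>" .
    qed
  qed
qed

section \<open>Sequence spaces over a countable index set\<close>

lemma finite_to_nat_less: "finite {i :: 'i::countable. to_nat i < n}"
  by (rule finite_imageD[of to_nat])
    (auto intro: finite_subset[of _ "{..<n}"] inj_on_subset[OF inj_to_nat])

lemma nn_integral_count_space_eq_infsum:
  fixes f :: "'i::countable \<Rightarrow> ennreal"
  shows "(\<integral>\<^sup>+ i. f i \<partial>count_space UNIV) = (\<Sum>\<^sub>\<infinity>i. f i)"
proof -
  have inf: "(\<Sum>\<^sub>\<infinity>i. f i) = (SUP F\<in>{F. finite F \<and> F \<subseteq> UNIV}. sum f F)"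
    by (rule nonneg_infsum_complete) simp
  define F where "F n = {i :: 'i. to_nat i < n}" for n
  have fin: "finite (F n)" for n
    unfolding F_def by (rule finite_to_nat_less)
  have ind: "(\<integral>\<^sup>+ i. f i * indicator A i \<partial>count_space UNIV) = sum f A" if "finite A" for A
    using that by (subst nn_integral_count_space'[of A]) auto
  show ?thesis
  proof (rule antisym)
    have "(\<lambda>n. \<integral>\<^sup>+ i. f i * indicator (F n) i \<partial>count_space UNIV) \<longlonglongrightarrow> (\<integral>\<^sup>+ i. f i \<partial>count_space UNIV)"
    proof (rule nn_integral_LIMSEQ)
      show "(\<lambda>n. f i * indicator (F n) i) \<longlonglongrightarrow> f i" for i
        by (intro tendsto_eventually eventually_sequentiallyI[of "Suc (to_nat i)"]) (auto simp: F_def)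
      show "incseq (\<lambda>n i. f i * indicator (F n) i)"
        by (auto simp: incseq_def le_fun_def F_def indicator_def)
    qed auto
    moreover have "(\<integral>\<^sup>+ i. f i * indicator (F n) i \<partial>count_space UNIV) \<le> (\<Sum>\<^sub>\<infinity>i. f i)" for n
      unfolding ind[OF fin] inf by (rule SUP_upper) (auto simp: fin)
    ultimately show "(\<integral>\<^sup>+ i. f i \<partial>count_space UNIV) \<le> (\<Sum>\<^sub>\<infinity>i. f i)"
      by (intro LIMSEQ_le_const2) auto
    show "(\<Sum>\<^sub>\<infinity>i. f i) \<le> (\<integral>\<^sup>+ i. f i \<partial>count_space UNIV)"
      unfolding inf
    proof (rule SUP_least)
      fix A :: "'i set" assume "A \<in> {F. finite F \<and> F \<subseteq> UNIV}"
      then have "sum f A = (\<integral>\<^sup>+ i. f i * indicator A i \<partial>count_space UNIV)" by (simp add: ind)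
      also have "\<dots> \<le> (\<integral>\<^sup>+ i. f i \<partial>count_space UNIV)"
        by (intro nn_integral_mono) (auto simp: indicator_def)
      finally show "sum f A \<le> (\<integral>\<^sup>+ i. f i \<partial>count_space UNIV)" .
    qed
  qed
qed

lemma nn_integral_count_space_single:
  "(\<integral>\<^sup>+ i. (if i = j then c else 0) \<partial>count_space UNIV) = c"
  by (subst nn_integral_count_space'[of "{j}"]) auto

text \<open>
The enumeration of the index set turns the tails into a sequence, so that dominated convergence for
the counting measure applies.
\<close>

lemma lp_norm_tail:
  fixes f :: "'i::countable \<Rightarrow> ennreal"
  assumes s: "fin_exp s" and fin: "lp_norm (count_space UNIV) s f < \<infinity>"
  shows "(\<lambda>n. lp_norm (count_space UNIV) s (\<lambda>i. if to_nat i < n then 0 else f i)) \<longlonglongrightarrow> 0"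
proof -
  let ?a = "enn2real s"
  note a = fin_expD[OF s]
  have fin': "(\<integral>\<^sup>+ i. epow (f i) ?a \<partial>count_space UNIV) < \<infinity>"
    using fin by (simp add: epow_lp_norm[OF s, symmetric] epow_less_top)
  have "(\<lambda>n. \<integral>\<^sup>+ i. epow (if to_nat i < n then 0 else f i) ?a \<partial>count_space UNIV) \<longlonglongrightarrow> (\<integral>\<^sup>+ i. 0 \<partial>(count_space UNIV :: 'i measure))"
  proof (rule nn_integral_dominated_convergence[OF _ _ _ _ fin'])
    show "AE i in count_space UNIV. (\<lambda>n. epow (if to_nat i < n then 0 else f i) ?a) \<longlonglongrightarrow> 0"
    proof (rule AE_I2)
      fix i :: 'i
      show "(\<lambda>n. epow (if to_nat i < n then 0 else f i) ?a) \<longlonglongrightarrow> 0"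
        by (intro tendsto_eventually eventually_sequentiallyI[of "Suc (to_nat i)"]) auto
    qed
  qed auto
  from tendsto_epow[OF this, of "1 / ?a"] show ?thesis
    unfolding lp_norm_eq[OF s] using a by simp
qed

text \<open>
The bound on the sum over a finite set \<open>S\<close> comes from testing with the extremal sequence of the
restriction of \<open>a\<close> to \<open>S\<close>, whose conjugate norm is one.
\<close>

lemma lp_norm_le_by_duality:
  fixes a :: "'i::countable \<Rightarrow> real"
  assumes s: "1 < s" "s < \<infinity>" and a: "\<And>i. 0 \<le> a i"
    and test: "\<And>S \<mu>. finite S \<Longrightarrow> (\<And>i. 0 \<le> \<mu> i) \<Longrightarrow> ennreal (\<Sum>i\<in>S. \<mu> i * a i)
      \<le> K * lp_norm (count_space UNIV) (conj_exp s) (\<lambda>i. ennreal (if i \<in> S then \<mu> i else 0))"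
  shows "lp_norm (count_space UNIV) s (\<lambda>i. ennreal (a i)) \<le> K"
proof -
  note e = conj_exp_enn2real[OF s]
  have fin_le: "(\<Sum>i\<in>S. epow (ennreal (a i)) (enn2real s)) \<le> epow K (enn2real s)"
    if S: "finite S" for S
  proof -
    define h where "h i = (if i \<in> S then ennreal (a i) else 0)" for i
    define A where "A = lp_norm (count_space UNIV) s h"
    have sumS: "(\<integral>\<^sup>+ i. epow (h i) (enn2real s) \<partial>count_space UNIV) = (\<Sum>i\<in>S. epow (ennreal (a i)) (enn2real s))"
      by (subst nn_integral_count_space'[OF S]) (auto simp: h_def)
    have Afin: "A < \<infinity>"
    proof -
      have "(\<Sum>i\<in>S. epow (ennreal (a i)) (enn2real s)) < top"
        using S by (simp add: a epow_ennreal)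
      then show ?thesis unfolding A_def lp_norm_eq[OF e(4)] sumS by (simp add: epow_less_top)
    qed
    have "A \<le> K"
    proof (cases "A = 0")
      case False
      define k where "k i = epow (h i) (enn2real s - 1) / epow A (enn2real s - 1)" for i
      have k: "lp_norm (count_space UNIV) (conj_exp s) k = 1"
        "(\<integral>\<^sup>+ i. h i * k i \<partial>count_space UNIV) = A"
        using lp_norm_extremal[OF s, of h "count_space UNIV"] Afin False
        unfolding k_def A_def by auto
      have kfin: "k i = ennreal (enn2real (k i))" for i
      proof -
        have "epow (h i) (enn2real s - 1) < top" by (simp add: h_def epow_less_top)
        moreover have "epow A (enn2real s - 1) \<noteq> 0" using False by simp
        ultimately have "k i < top" unfolding k_def
          by (simp add: less_top[symmetric] ennreal_divide_eq_top_iff)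
        then show ?thesis by simp
      qed
      have "A = (\<Sum>i\<in>S. h i * k i)"
        unfolding k(2)[symmetric] by (rule nn_integral_count_space'[OF S]) (auto simp: h_def)
      also have "\<dots> = (\<Sum>i\<in>S. ennreal (enn2real (k i) * a i))"
        by (intro sum.cong refl) (subst kfin, simp add: h_def a ennreal_mult mult.commute)
      also have "\<dots> = ennreal (\<Sum>i\<in>S. enn2real (k i) * a i)"
        by (rule sum_ennreal) (simp add: a)
      also have "\<dots> \<le> K * lp_norm (count_space UNIV) (conj_exp s) (\<lambda>i. ennreal (if i \<in> S then enn2real (k i) else 0))"
        by (rule test[OF S]) simp
      also have "\<dots> \<le> K * lp_norm (count_space UNIV) (conj_exp s) k"
      proof (intro mult_left_mono lp_norm_mono_AE e AE_I2)
        fix i show "ennreal (if i \<in> S then enn2real (k i) else 0) \<le> k i"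
          using kfin[of i] by auto
      qed simp
      finally show ?thesis by (simp add: k)
    qed simp
    then have "epow A (enn2real s) \<le> epow K (enn2real s)"
      using e by (intro epow_mono) auto
    then show ?thesis unfolding A_def by (simp add: epow_lp_norm[OF e(4)] sumS)
  qed
  have "(\<integral>\<^sup>+ i. epow (ennreal (a i)) (enn2real s) \<partial>count_space UNIV) \<le> epow K (enn2real s)"
    unfolding nn_integral_count_space_eq_infsum
    by (subst nonneg_infsum_complete) (auto intro!: SUP_least fin_le)
  then show ?thesis
    unfolding lp_norm_eq[OF e(4)] using e by (subst epow_le_swap) auto
qed

lemma norm_has_sum_le:
  fixes h :: "'i \<Rightarrow> 'b::real_normed_vector"
  assumes "(h has_sum s) UNIV"
  shows "ennreal (norm s) \<le> (\<integral>\<^sup>+ i. ennreal (norm (h i)) \<partial>count_space UNIV)"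
proof -
  have lim: "((\<lambda>F. ennreal (norm (sum h F))) \<longlongrightarrow> ennreal (norm s)) (finite_subsets_at_top UNIV)"
    using assms unfolding has_sum_def by (intro tendsto_ennrealI tendsto_norm)
  have "ennreal (norm (sum h F)) \<le> (\<integral>\<^sup>+ i. ennreal (norm (h i)) \<partial>count_space UNIV)" if "finite F" for F
  proof -
    have "ennreal (norm (sum h F)) \<le> ennreal (\<Sum>i\<in>F. norm (h i))"
      by (intro ennreal_leI norm_sum)
    also have "\<dots> = (\<Sum>i\<in>F. ennreal (norm (h i)))" by simp
    also have "\<dots> = (\<integral>\<^sup>+ i. ennreal (norm (h i)) * indicator F i \<partial>count_space UNIV)"
      using that by (subst nn_integral_count_space'[of F]) auto
    also have "\<dots> \<le> (\<integral>\<^sup>+ i. ennreal (norm (h i)) \<partial>count_space UNIV)"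
      by (intro nn_integral_mono) (auto simp: indicator_def)
    finally show ?thesis .
  qed
  then show ?thesis
    by (intro tendsto_upperbound[OF lim] eventually_finite_subsets_at_top_weakI) auto
qed

lemma tendsto_0_le_ennreal:
  fixes f h :: "nat \<Rightarrow> ennreal"
  assumes "h \<longlonglongrightarrow> 0" "\<And>k. f k \<le> h k"
  shows "f \<longlonglongrightarrow> 0"
  by (rule tendsto_sandwich[OF _ _ tendsto_const assms(1)]) (simp_all add: assms(2))

section \<open>Iterated norms\<close>

lemma upd_nth [simp]: "upd x i s $ j = (if j = i then s else x $ j)"
  by (simp add: upd_def)

lemma upd_upd [simp]: "upd (upd x i s) i t = upd x i t"
  by (simp add: vec_eq_iff)

lemma upd_commute: "i \<noteq> j \<Longrightarrow> upd (upd x i s) j t = upd (upd x j t) i s"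
  by (simp add: vec_eq_iff)

lemma measurable_vec_lambda:
  fixes f :: "'a \<Rightarrow> 'n::finite \<Rightarrow> real"
  assumes [measurable]: "\<And>j. (\<lambda>z. f z j) \<in> borel_measurable M"
  shows "(\<lambda>z. \<chi> j. f z j) \<in> borel_measurable M"
proof (subst borel_measurable_euclidean_space, rule ballI)
  fix b :: "real ^ 'n" assume "b \<in> Basis"
  then obtain i where "b = axis i 1"
    by (auto simp: Basis_vec_def)
  then show "(\<lambda>z. (\<chi> j. f z j) \<bullet> b) \<in> borel_measurable M"
    by (simp add: inner_axis)
qed

lemma measurable_vec_nth [measurable (raw)]:
  fixes f :: "'a \<Rightarrow> real ^ 'n"
  assumes "f \<in> borel_measurable M"
  shows "(\<lambda>z. f z $ j) \<in> borel_measurable M"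
  using borel_measurable_inner[OF assms borel_measurable_const[of "axis j 1"]]
  by (simp add: inner_axis)

lemma measurable_upd [measurable (raw)]:
  fixes f :: "'a \<Rightarrow> real ^ 'n"
  assumes [measurable]: "f \<in> borel_measurable M" "g \<in> borel_measurable M"
  shows "(\<lambda>z. upd (f z) i (g z)) \<in> borel_measurable M"
  unfolding upd_def
proof (rule measurable_vec_lambda)
  show "(\<lambda>z. if j = i then g z else f z $ j) \<in> borel_measurable M" for j
    by (cases "j = i") simp_all
qed

text \<open>
The norm in the coordinate \<open>i\<close> alone, as a function on the whole space that does not depend on the
\<open>i\<close>-th coordinate of its argument. It is the step by which \<open>iter_norm\<close> recurses.
\<close>

definition slice_norm :: "('n \<Rightarrow> ennreal) \<Rightarrow> 'n \<Rightarrow> (real ^ 'n \<Rightarrow> ennreal) \<Rightarrow> real ^ 'n \<Rightarrow> ennreal" where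
  "slice_norm p i F x = lp_norm lborel (p i) (\<lambda>s. F (upd x i s))"

lemma iter_norm_Cons:
  assumes "fin_exp (p i)"
  shows "iter_norm p (i # is) F = iter_norm p is (slice_norm p i F)"
  using assms by (simp add: slice_norm_def[abs_def] lp_norm_completion)

lemma slice_norm_measurable [measurable (raw)]:
  fixes F :: "real ^ 'n \<Rightarrow> ennreal"
  assumes "fin_exp (p i)" and [measurable]: "F \<in> borel_measurable borel"
  shows "slice_norm p i F \<in> borel_measurable borel"
  unfolding slice_norm_def lp_norm_eq[OF assms(1)] by measurable

lemma iter_norm_mono:
  assumes "\<And>i. i \<in> set is \<Longrightarrow> fin_exp (p i)" "\<And>x. F x \<le> G x"
  shows "iter_norm p is F x \<le> iter_norm p is G x"
  using assms
proof (induction "is" arbitrary: F G)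
  case (Cons i "is")
  have "slice_norm p i F x \<le> slice_norm p i G x" for x
    unfolding slice_norm_def using Cons.prems by (intro lp_norm_mono_AE) auto
  then show ?case
    using Cons.prems by (simp only: iter_norm_Cons list.set_intros) (rule Cons.IH, auto)
qed simp

lemma iter_norm_cmult:
  assumes "\<And>i. i \<in> set is \<Longrightarrow> fin_exp (p i)" "F \<in> borel_measurable borel"
  shows "iter_norm p is (\<lambda>x. c * F x) x = c * iter_norm p is F x"
  using assms
proof (induction "is" arbitrary: F)
  case (Cons i "is")
  note [measurable] = Cons.prems(2)
  have "slice_norm p i (\<lambda>x. c * F x) = (\<lambda>x. c * slice_norm p i F x)"
    unfolding slice_norm_def using Cons.prems by (subst lp_norm_cmult) auto
  then show ?case
    using Cons.prems by (simp only: iter_norm_Cons list.set_intros) (rule Cons.IH, auto intro!: slice_norm_measurable)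
qed simp

lemma iter_norm_zero:
  assumes "\<And>i. i \<in> set is \<Longrightarrow> fin_exp (p i)"
  shows "iter_norm p is (\<lambda>x. 0) x = 0"
  using iter_norm_cmult[of "is" p "\<lambda>x. 0" 0 x] assms by simp

lemma iter_norm_triangle:
  assumes "\<And>i. i \<in> set is \<Longrightarrow> fin_exp (p i)" "F \<in> borel_measurable borel" "G \<in> borel_measurable borel"
  shows "iter_norm p is (\<lambda>x. F x + G x) x \<le> iter_norm p is F x + iter_norm p is G x"
  using assms
proof (induction "is" arbitrary: F G)
  case (Cons i "is")
  note [measurable] = Cons.prems(2,3)
  have p: "fin_exp (p i)" using Cons.prems by simp
  have "iter_norm p is (slice_norm p i (\<lambda>x. F x + G x)) x
      \<le> iter_norm p is (\<lambda>x. slice_norm p i F x + slice_norm p i G x) x"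
    unfolding slice_norm_def using Cons.prems by (intro iter_norm_mono lp_norm_triangle) auto
  also have "\<dots> \<le> iter_norm p is (slice_norm p i F) x + iter_norm p is (slice_norm p i G) x"
    using Cons.prems p by (intro Cons.IH slice_norm_measurable) auto
  finally show ?case by (simp only: iter_norm_Cons[of p, OF p])
qed simp

text \<open>
With exponent one in every coordinate, \<open>iter_norm\<close> is the iterated integral. The inequality is the
one-variable inequality applied in one coordinate after the other.
\<close>

lemma iter_norm_Holder:
  assumes "\<And>i. i \<in> set is \<Longrightarrow> 1 < p i \<and> p i < \<infinity>" "F \<in> borel_measurable borel" "G \<in> borel_measurable borel"
  shows "iter_norm (\<lambda>_. 1) is (\<lambda>x. F x * G x) x \<le> iter_norm p is F x * iter_norm (\<lambda>i. conj_exp (p i)) is G x"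
  using assms
proof (induction "is" arbitrary: F G)
  case (Cons i "is")
  note [measurable] = Cons.prems(2,3)
  have p: "1 < p i" "p i < \<infinity>" using Cons.prems by auto
  note e = conj_exp_enn2real[OF p]
  have "iter_norm (\<lambda>_. 1) is (slice_norm (\<lambda>_. 1) i (\<lambda>x. F x * G x)) x
      \<le> iter_norm (\<lambda>_. 1) is (\<lambda>x. slice_norm p i F x * slice_norm (\<lambda>i. conj_exp (p i)) i G x) x"
    unfolding slice_norm_def lp_norm_one by (intro iter_norm_mono lp_norm_Holder p) auto
  also have "\<dots> \<le> iter_norm p is (slice_norm p i F) x *
      iter_norm (\<lambda>i. conj_exp (p i)) is (slice_norm (\<lambda>i. conj_exp (p i)) i G) x"
    using Cons.prems by (intro Cons.IH slice_norm_measurable) (auto simp: e)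
  finally show ?case using e by (simp only: iter_norm_Cons fin_exp_one)
qed simp

text \<open>
Functions that agree almost everywhere have equal iterated norms. The exceptional set is described
by a Borel function \<open>h\<close> with vanishing iterated integral: integrating out one coordinate of \<open>h\<close> gives
the function that plays the same role for the slice norms. The functions \<open>F\<close> and \<open>G\<close> are arbitrary,
since slices of Lebesgue measurable functions can fail to be measurable.
\<close>

lemma iter_norm_null:
  assumes "\<And>i. i \<in> set is \<Longrightarrow> fin_exp (p i)" "h \<in> borel_measurable borel"
    and "\<And>x. h x = 0 \<Longrightarrow> F x = G x" "iter_norm (\<lambda>_. 1) is h x = 0"
  shows "iter_norm p is F x = iter_norm p is G x"
  using assms
proof (induction "is" arbitrary: F G h)
  case (Cons i "is")
  note [measurable] = Cons.prems(2)
  have p: "fin_exp (p i)" using Cons.prems by auto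
  have "iter_norm p is (slice_norm p i F) x = iter_norm p is (slice_norm p i G) x"
  proof (rule Cons.IH)
    fix y assume "slice_norm (\<lambda>_. 1) i h y = 0"
    then have "AE s in lborel. h (upd y i s) = 0"
      by (simp add: slice_norm_def lp_norm_eq_0_iff)
    then have "AE s in lborel. F (upd y i s) = G (upd y i s)"
      by eventually_elim (rule Cons.prems(3))
    then show "slice_norm p i F y = slice_norm p i G y"
      unfolding slice_norm_def by (rule lp_norm_cong_AE[OF p])
  qed (use Cons.prems in \<open>auto intro: slice_norm_measurable simp: iter_norm_Cons simp del: iter_norm.simps(2)\<close>)
  then show ?case by (simp only: iter_norm_Cons[of p, OF p])
qed simp

lemma lp_norm_LIMSEQ:
  assumes s: "fin_exp s" and [measurable]: "\<And>k. f k \<in> borel_measurable M"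
    and inc: "incseq f" and lim: "\<And>x. (\<lambda>k. f k x) \<longlonglongrightarrow> g x"
  shows "(\<lambda>k. lp_norm M s (f k)) \<longlonglongrightarrow> lp_norm M s g"
  unfolding lp_norm_eq[OF s] using fin_expD[OF s] inc
  by (intro tendsto_epow nn_integral_LIMSEQ lim) (auto simp: incseq_def le_fun_def epow_mono)

text \<open>
Monotone convergence, one coordinate after the other.
\<close>

lemma iter_norm_LIMSEQ:
  assumes "\<And>i. i \<in> set is \<Longrightarrow> fin_exp (p i)" "\<And>k. F k \<in> borel_measurable borel"
    and "incseq F" "\<And>x. (\<lambda>k. F k x) \<longlonglongrightarrow> G x"
  shows "(\<lambda>k. iter_norm p is (F k) x) \<longlonglongrightarrow> iter_norm p is G x"
  using assms
proof (induction "is" arbitrary: F G)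
  case (Cons i "is")
  note [measurable] = Cons.prems(2)
  have p: "fin_exp (p i)" using Cons.prems by auto
  have inc: "F k z \<le> F (Suc k) z" for k z
    using incseq_SucD[OF Cons.prems(3), of k] by (rule le_funD)
  have "(\<lambda>k. iter_norm p is (slice_norm p i (F k)) x) \<longlonglongrightarrow> iter_norm p is (slice_norm p i G) x"
  proof (rule Cons.IH)
    show "incseq (\<lambda>k. slice_norm p i (F k))"
    proof (intro incseq_SucI le_funI)
      show "slice_norm p i (F k) y \<le> slice_norm p i (F (Suc k)) y" for k y
        unfolding slice_norm_def by (intro lp_norm_mono_AE p AE_I2 inc)
    qed
    show "(\<lambda>k. slice_norm p i (F k) y) \<longlonglongrightarrow> slice_norm p i G y" for y
      unfolding slice_norm_def
      using Cons.prems(4) by (intro lp_norm_LIMSEQ p incseq_SucI le_funI inc) auto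
  qed (use Cons.prems p in \<open>auto intro: slice_norm_measurable\<close>)
  then show ?case by (simp only: iter_norm_Cons[of p, OF p])
qed simp

text \<open>
Boundedness by \<open>C\<close> and support in a box of half side \<open>R\<close>, where only the coordinates that are still to
be integrated are restricted. Both properties pass to slice norms, which are therefore finite.
\<close>

definition box_bounded :: "real \<Rightarrow> real \<Rightarrow> 'n list \<Rightarrow> (real ^ 'n \<Rightarrow> ennreal) \<Rightarrow> bool" where
  "box_bounded C R is F \<longleftrightarrow> 0 \<le> C \<and> 0 \<le> R \<and> F \<in> borel_measurable borel \<and>
     (\<forall>x. F x \<le> ennreal C) \<and> (\<forall>x. \<forall>i\<in>set is. R < \<bar>x $ i\<bar> \<longrightarrow> F x = 0)"

lemma box_bounded_le:
  assumes "box_bounded C R (i # is) F"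
  shows "F (upd x i s) \<le> ennreal C * indicator {-R..R} s"
proof (cases "s \<in> {-R..R}")
  case False
  then have "R < \<bar>upd x i s $ i\<bar>" by auto
  then have "F (upd x i s) = 0"
    using assms unfolding box_bounded_def by (meson list.set_intros(1))
  then show ?thesis by simp
qed (use assms in \<open>auto simp: box_bounded_def\<close>)

lemma box_bounded_slice:
  assumes F: "box_bounded C R (i # is) F" and p: "fin_exp (p i)" and i: "i \<notin> set is"
  shows "box_bounded (C * (2 * R) powr (1 / enn2real (p i))) R is (slice_norm p i F)"
proof -
  have [measurable]: "F \<in> borel_measurable borel" and CR: "0 \<le> C" "0 \<le> R"
    using F by (auto simp: box_bounded_def)
  have "slice_norm p i F x \<le> ennreal (C * (2 * R) powr (1 / enn2real (p i)))" for x
  proof -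
    have "slice_norm p i F x \<le> lp_norm lborel (p i) (\<lambda>s. ennreal C * indicator {-R..R} s)"
      unfolding slice_norm_def by (intro lp_norm_mono_AE p AE_I2 box_bounded_le[OF F])
    also have "\<dots> = ennreal C * epow (ennreal (2 * R)) (1 / enn2real (p i))"
      using CR by (subst lp_norm_cmult) (auto simp: p lp_norm_eq[OF p])
    also have "\<dots> = ennreal (C * (2 * R) powr (1 / enn2real (p i)))"
      using CR by (subst epow_ennreal) (auto simp only: ennreal_mult[OF _ powr_ge_zero] mult_nonneg_nonneg zero_le_numeral)
    finally show ?thesis .
  qed
  moreover have "slice_norm p i F x = 0" if "j \<in> set is" "R < \<bar>x $ j\<bar>" for x j
  proof -
    have "F (upd x i s) = 0" for s
      using F that i unfolding box_bounded_def by (metis list.set_intros(2) upd_nth)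
    then show ?thesis using p by (simp add: slice_norm_def)
  qed
  ultimately show ?thesis
    using CR p by (auto simp: box_bounded_def intro!: slice_norm_measurable)
qed

text \<open>
Convergence is only required at points where the majorant \<open>G\<close> is finite. This is the form that is
stable under the induction: where the slice norm of \<open>G\<close> is finite, \<open>G\<close> is finite almost everywhere
on the slice, so that dominated convergence in the coordinate \<open>i\<close> applies there.
\<close>

lemma iter_norm_dominated:
  assumes "\<And>i. i \<in> set is \<Longrightarrow> fin_exp (p i)"
    and "\<And>k. F k \<in> borel_measurable borel" "G \<in> borel_measurable borel"
    and "\<And>k y. F k y \<le> G y" "\<And>y. G y < \<infinity> \<Longrightarrow> (\<lambda>k. F k y) \<longlonglongrightarrow> 0"
    and "iter_norm p is G x < \<infinity>"
  shows "(\<lambda>k. iter_norm p is (F k) x) \<longlonglongrightarrow> 0"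
  using assms
proof (induction "is" arbitrary: F G)
  case (Cons i "is")
  have p: "fin_exp (p i)" using Cons.prems by auto
  note [measurable] = Cons.prems(2,3)
  let ?a = "enn2real (p i)"
  note a = fin_expD[OF p]
  have "(\<lambda>k. iter_norm p is (slice_norm p i (F k)) x) \<longlonglongrightarrow> 0"
  proof (rule Cons.IH)
    show "slice_norm p i (F k) y \<le> slice_norm p i G y" for k y
      unfolding slice_norm_def by (intro lp_norm_mono_AE p AE_I2 Cons.prems)
    show "(\<lambda>k. slice_norm p i (F k) y) \<longlonglongrightarrow> 0" if "slice_norm p i G y < \<infinity>" for y
    proof -
      have fin: "(\<integral>\<^sup>+ s. epow (G (upd y i s)) ?a \<partial>lborel) < \<infinity>"
        using that by (simp add: epow_lp_norm[OF p, symmetric] slice_norm_def epow_less_top)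
      then have "AE s in lborel. epow (G (upd y i s)) ?a \<noteq> \<infinity>"
        by (intro nn_integral_noteq_infinite) auto
      then have lim: "AE s in lborel. (\<lambda>k. epow (F k (upd y i s)) ?a) \<longlonglongrightarrow> 0"
      proof eventually_elim
        fix s assume "epow (G (upd y i s)) ?a \<noteq> \<infinity>"
        then have "(\<lambda>k. F k (upd y i s)) \<longlonglongrightarrow> 0"
          by (intro Cons.prems(5)) (simp add: less_top)
        from tendsto_epow[OF this, of ?a] show "(\<lambda>k. epow (F k (upd y i s)) ?a) \<longlonglongrightarrow> 0"
          using a by simp
      qed
      have "(\<lambda>k. \<integral>\<^sup>+ s. epow (F k (upd y i s)) ?a \<partial>lborel) \<longlonglongrightarrow> (\<integral>\<^sup>+ s. 0 \<partial>(lborel :: real measure))"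
        by (rule nn_integral_dominated_convergence[OF _ _ _ _ fin lim])
          (use a in \<open>auto intro!: epow_mono Cons.prems\<close>)
      then show ?thesis
        using a tendsto_epow[of _ 0 _ "1 / ?a"] unfolding slice_norm_def lp_norm_eq[OF p] by simp
    qed
  qed (use Cons.prems p in \<open>auto intro!: slice_norm_measurable simp: iter_norm_Cons simp del: iter_norm.simps(2)\<close>)
  then show ?case by (simp only: iter_norm_Cons[of p, OF p])
qed simp

text \<open>
The mixed norm is attained by duality. Let \<open>F1\<close> be the slice norm of \<open>F\<close> in the coordinate \<open>i\<close> and let
\<open>G1\<close> be dual to \<open>F1\<close> in the remaining coordinates; then \<open>G1\<close> times the one-variable extremal function of
\<open>F\<close> on each slice is dual to \<open>F\<close>. This requires \<open>G1\<close> to be constant along the coordinate \<open>i\<close>, as \<open>F1\<close> is,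
and for that reason the induction also carries the invariances of \<open>F\<close> over to \<open>G\<close>.
\<close>

lemma iter_norm_extremal:
  assumes "\<And>i. i \<in> set is \<Longrightarrow> 1 < p i \<and> p i < \<infinity>" "distinct is" "box_bounded C R is F"
  shows "\<exists>G \<in> borel_measurable borel.
      (\<forall>x. iter_norm (\<lambda>i. conj_exp (p i)) is G x \<le> 1) \<and>
      (\<forall>x. iter_norm (\<lambda>_. 1) is (\<lambda>x. F x * G x) x = iter_norm p is F x) \<and>
      (\<forall>j. (\<forall>x s. F (upd x j s) = F x) \<longrightarrow> (\<forall>x s. G (upd x j s) = G x))"
  using assms
proof (induction "is" arbitrary: F C)
  case Nil
  then show ?case by (intro bexI[of _ "\<lambda>_. 1"]) auto
next
  case (Cons i "is")
  have p: "1 < p i" "p i < \<infinity>" using Cons.prems by auto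
  note e = conj_exp_enn2real[OF p]
  have [measurable]: "F \<in> borel_measurable borel"
    using Cons.prems(3) by (auto simp: box_bounded_def)
  define F1 where "F1 = slice_norm p i F"
  have F1: "box_bounded (C * (2 * R) powr (1 / enn2real (p i))) R is F1"
    unfolding F1_def using Cons.prems by (intro box_bounded_slice) (auto simp: e)
  from Cons.IH[OF _ _ F1] Cons.prems obtain G1 where [measurable]: "G1 \<in> borel_measurable borel"
    and G1: "\<And>x. iter_norm (\<lambda>i. conj_exp (p i)) is G1 x \<le> 1"
    and FG1: "\<And>x. iter_norm (\<lambda>_. 1) is (\<lambda>x. F1 x * G1 x) x = iter_norm p is F1 x"
    and inv: "\<And>j x s. (\<And>x s. F1 (upd x j s) = F1 x) \<Longrightarrow> G1 (upd x j s) = G1 x"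
    by auto
  have [measurable]: "F1 \<in> borel_measurable borel"
    using F1 by (auto simp: box_bounded_def)
  have F1i: "F1 (upd x i s) = F1 x" for x s
    by (simp add: F1_def slice_norm_def)
  then have G1i: "G1 (upd x i s) = G1 x" for x s
    by (rule inv)
  have F1fin: "F1 x < \<infinity>" for x
    using F1 unfolding box_bounded_def by (metis ennreal_less_top infinity_ennreal_def order_le_less_trans)
  let ?a = "enn2real (p i) - 1"
  \<comment> \<open>On slices where the norm \<open>F1\<close> vanishes, \<open>F\<close> may be positive on a null set, where the quotient would be \<open>\<infinity>\<close>.\<close>
  define G where "G x = (if F1 x = 0 then 0 else G1 x * (epow (F x) ?a / epow (F1 x) ?a))" for x
  have [measurable]: "G \<in> borel_measurable borel"
    unfolding G_def by measurable
  have ext: "F1 x \<noteq> 0 \<Longrightarrow> lp_norm lborel (conj_exp (p i)) (\<lambda>s. epow (F (upd x i s)) ?a / epow (F1 x) ?a) = 1"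
    "F1 x \<noteq> 0 \<Longrightarrow> (\<integral>\<^sup>+ s. F (upd x i s) * (epow (F (upd x i s)) ?a / epow (F1 x) ?a) \<partial>lborel) = F1 x" for x
    using lp_norm_extremal[OF p, of "\<lambda>s. F (upd x i s)" lborel] F1fin[of x]
    unfolding F1_def slice_norm_def by simp_all
  have "slice_norm (\<lambda>i. conj_exp (p i)) i G x \<le> G1 x" for x
  proof (cases "F1 x = 0")
    case True
    then show ?thesis by (simp add: slice_norm_def G_def F1i e)
  next
    case False
    then show ?thesis
      by (simp add: slice_norm_def G_def F1i G1i lp_norm_cmult e ext)
  qed
  then have 1: "iter_norm (\<lambda>i. conj_exp (p i)) (i # is) G x \<le> 1" for x
    unfolding iter_norm_Cons[of "\<lambda>i. conj_exp (p i)" i, OF e(5)]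
    using Cons.prems(1) by (intro order_trans[OF iter_norm_mono G1]) (auto intro: conj_exp_enn2real)
  have "slice_norm (\<lambda>_. 1) i (\<lambda>x. F x * G x) x = F1 x * G1 x" for x
  proof (cases "F1 x = 0")
    case True
    then show ?thesis by (simp add: slice_norm_def G_def F1i)
  next
    case False
    have "slice_norm (\<lambda>_. 1) i (\<lambda>x. F x * G x) x =
        (\<integral>\<^sup>+ s. G1 x * (F (upd x i s) * (epow (F (upd x i s)) ?a / epow (F1 x) ?a)) \<partial>lborel)"
      using False by (simp add: slice_norm_def lp_norm_one G_def F1i G1i ac_simps)
    also have "\<dots> = G1 x * F1 x"
      using False by (subst nn_integral_cmult) (auto simp: ext)
    finally show ?thesis by (simp add: mult.commute)
  qed
  then have "slice_norm (\<lambda>_. 1) i (\<lambda>x. F x * G x) = (\<lambda>x. F1 x * G1 x)" by blast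
  then have 2: "iter_norm (\<lambda>_. 1) (i # is) (\<lambda>x. F x * G x) x = iter_norm p (i # is) F x" for x
    using FG1[of x] by (simp add: iter_norm_Cons e F1_def[symmetric] del: iter_norm.simps(2))
  have 3: "G (upd x j s) = G x" if F: "\<And>x s. F (upd x j s) = F x" for j x s
  proof -
    have F1j: "F1 (upd x j s) = F1 x" for x s
    proof (cases "j = i")
      case False
      then show ?thesis by (simp add: F1_def slice_norm_def upd_commute[of j i] F)
    qed (simp add: F1i)
    then have "G1 (upd x j s) = G1 x" for x s
      by (rule inv)
    then show ?thesis by (simp add: G_def F1j F)
  qed
  show ?case
    using 1 2 3 by (intro bexI[of _ G]) auto
qed

lemma lborel_vec_eq_PiM:
  "(lborel :: (real ^ 'n) measure) = distr (\<Pi>\<^sub>M i\<in>UNIV. lborel) borel (\<lambda>y. \<chi> i. y i)"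
proof (rule lborel_eqI)
  interpret product_sigma_finite "\<lambda>_::'n. lborel :: real measure" by standard
  have m [measurable]: "(\<lambda>y. \<chi> i. y i) \<in> borel_measurable (\<Pi>\<^sub>M i\<in>UNIV::'n set. (lborel :: real measure))"
    by (rule measurable_vec_lambda) measurable
  fix l u :: "real ^ 'n"
  assume lu: "\<And>b. b \<in> Basis \<Longrightarrow> l \<bullet> b \<le> u \<bullet> b"
  then have lu': "l $ i \<le> u $ i" for i
    by (metis inner_axis' axis_in_Basis_iff mult_1 inner_real_def Basis_real_def insertI1 cart_eq_inner_axis axis_index_axis axis_index)
  have "emeasure (distr (\<Pi>\<^sub>M i\<in>UNIV. lborel) borel (\<lambda>y. \<chi> i. y i)) (box l u)
     = emeasure (\<Pi>\<^sub>M i\<in>UNIV. lborel) (\<Pi>\<^sub>E i\<in>UNIV. {l $ i <..< u $ i})"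
    by (subst emeasure_distr) (auto simp: mem_box_cart space_PiM PiE_def Pi_def intro!: arg_cong2[where f = emeasure])
  also have "\<dots> = (\<Prod>i\<in>UNIV. ennreal (u $ i - l $ i))"
    by (subst emeasure_PiM) (auto simp: lu')
  also have "\<dots> = ennreal (\<Prod>i\<in>UNIV. u $ i - l $ i)"
    by (rule prod_ennreal) (simp add: lu')
  also have "(\<Prod>i\<in>UNIV. u $ i - l $ i) = (\<Prod>b\<in>Basis. (u - l) \<bullet> b)"
  proof -
    have inj: "inj (\<lambda>i::'n. axis i (1::real))" by (auto simp: inj_on_def axis_eq_axis)
    have "(Basis :: (real ^ 'n) set) = range (\<lambda>i. axis i 1)" by (auto simp: Basis_vec_def)
    from prod.reindex_cong[OF inj this, of "(\<bullet>) (u - l)" "\<lambda>i. u $ i - l $ i"] show ?thesis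
      by (simp add: inner_axis)
  qed
  finally show "emeasure (distr (\<Pi>\<^sub>M i\<in>UNIV. lborel) borel (\<lambda>y. \<chi> i. y i)) (box l u) = (\<Prod>b\<in>Basis. (u - l) \<bullet> b)" .
qed simp

text \<open>
Tonelli's theorem for the iterated integral; the coordinates outside the list are parameters.
\<close>

lemma iter_norm_one_eq_PiM:
  fixes F :: "real ^ 'n \<Rightarrow> ennreal"
  assumes "distinct is" "F \<in> borel_measurable borel"
  shows "iter_norm (\<lambda>_. 1) is F x =
    (\<integral>\<^sup>+ y. F (\<chi> j. if j \<in> set is then y j else x $ j) \<partial>(\<Pi>\<^sub>M j\<in>set is. lborel))"
  using assms
proof (induction "is" arbitrary: F)
  case Nil
  then show ?case by (simp add: PiM_empty nn_integral_count_space_finite)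
next
  case (Cons i "is")
  interpret product_sigma_finite "\<lambda>_::'n. lborel :: real measure" by standard
  note [measurable] = Cons.prems(2)
  have m: "(\<lambda>y. \<chi> j. if j \<in> J then y j else x $ j) \<in> borel_measurable (\<Pi>\<^sub>M j\<in>J. (lborel :: real measure))" for J
  proof (rule measurable_vec_lambda)
    show "(\<lambda>y. if j \<in> J then y j else x $ j) \<in> borel_measurable (\<Pi>\<^sub>M j\<in>J. (lborel :: real measure))" for j
      by (cases "j \<in> J") simp_all
  qed
  have "iter_norm (\<lambda>_. 1) (i # is) F x = iter_norm (\<lambda>_. 1) is (slice_norm (\<lambda>_. 1) i F) x"
    by (simp only: iter_norm_Cons fin_exp_one)
  also have "\<dots> = (\<integral>\<^sup>+ y. slice_norm (\<lambda>_. 1) i F (\<chi> j. if j \<in> set is then y j else x $ j) \<partial>(\<Pi>\<^sub>M j\<in>set is. lborel))"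
    using Cons.prems by (intro Cons.IH slice_norm_measurable) auto
  also have "\<dots> = (\<integral>\<^sup>+ y. \<integral>\<^sup>+ s. F (\<chi> j. if j \<in> set (i # is) then (y(i := s)) j else x $ j) \<partial>lborel \<partial>(\<Pi>\<^sub>M j\<in>set is. lborel))"
    unfolding slice_norm_def lp_norm_one
    by (intro nn_integral_cong arg_cong[where f = F]) (auto simp: vec_eq_iff)
  also have "\<dots> = (\<integral>\<^sup>+ y. F (\<chi> j. if j \<in> set (i # is) then y j else x $ j) \<partial>(\<Pi>\<^sub>M j\<in>set (i # is). lborel))"
    unfolding list.set
  proof (rule product_nn_integral_insert[symmetric])
    show "i \<notin> set is" using Cons.prems by simp
    show "(\<lambda>y. F (\<chi> j. if j \<in> insert i (set is) then y j else x $ j)) \<in> borel_measurable (\<Pi>\<^sub>M j\<in>insert i (set is). lborel)"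
      by (rule measurable_compose[OF m Cons.prems(2)])
  qed simp
  finally show ?case .
qed

lemma iter_norm_one_eq_lborel:
  fixes F :: "'n::{finite,linorder} rvec \<Rightarrow> ennreal"
  assumes "F \<in> borel_measurable borel"
  shows "iter_norm (\<lambda>_. 1) (sorted_list_of_set UNIV) F x = (\<integral>\<^sup>+ y. F y \<partial>lborel)"
proof -
  note [measurable] = assms
  have [measurable]: "(\<lambda>y. \<chi> i. y i) \<in> borel_measurable (\<Pi>\<^sub>M i\<in>UNIV::'n set. (lborel :: real measure))"
    by (rule measurable_vec_lambda) measurable
  have "(\<integral>\<^sup>+ y. F y \<partial>lborel) = (\<integral>\<^sup>+ y. F y \<partial>distr (\<Pi>\<^sub>M i\<in>UNIV. lborel) borel (\<lambda>y. \<chi> i. y i))"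
    by (simp only: lborel_vec_eq_PiM[symmetric])
  also have "\<dots> = (\<integral>\<^sup>+ y. F (\<chi> i. y i) \<partial>(\<Pi>\<^sub>M i\<in>UNIV. lborel))"
    by (rule nn_integral_distr) measurable
  finally show ?thesis
    using iter_norm_one_eq_PiM[of "sorted_list_of_set UNIV" F x] by simp
qed

section \<open>Mixed norms of Lebesgue measurable functions\<close>

text \<open>
Mixed norms are handled for extended nonnegative functions, so that powers, products and monotone
limits of absolute values need no coercions.
\<close>

definition mixed_enorm :: "('n::{finite,linorder} \<Rightarrow> ennreal) \<Rightarrow> ('n rvec \<Rightarrow> ennreal) \<Rightarrow> ennreal" where
  "mixed_enorm p F = iter_norm p (sorted_list_of_set UNIV) F 0"

lemma mixed_norm_eq_enorm: "mixed_norm p f = mixed_enorm p (\<lambda>x. ennreal (norm (f x)))"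
  by (simp add: mixed_norm_def mixed_enorm_def)

lemma mixed_enorm_cong_AE:
  assumes p: "\<And>i. fin_exp (p i)" and FG: "AE x in lborel. F x = G x"
  shows "mixed_enorm p F = mixed_enorm p G"
proof -
  obtain N where N: "N \<in> null_sets lborel" "{x. F x \<noteq> G x} \<subseteq> N"
    using FG by (auto elim!: AE_E simp: null_sets_def)
  have "iter_norm (\<lambda>_. 1) (sorted_list_of_set UNIV) (indicator N) 0 = (\<integral>\<^sup>+ x. indicator N x \<partial>lborel)"
    using N by (intro iter_norm_one_eq_lborel) (auto simp: null_sets_def)
  also have "\<dots> = 0" using N by (auto simp: null_sets_def)
  finally show ?thesis
    unfolding mixed_enorm_def using N p
    by (intro iter_norm_null[where h = "indicator N"]) (auto simp: null_sets_def indicator_def split: if_splits)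
qed

lemma mixed_enorm_mono_AE:
  assumes p: "\<And>i. fin_exp (p i)" and FG: "AE x in lborel. F x \<le> G x"
  shows "mixed_enorm p F \<le> mixed_enorm p G"
proof -
  have "mixed_enorm p F = mixed_enorm p (\<lambda>x. min (F x) (G x))"
    using FG by (intro mixed_enorm_cong_AE p) (auto simp: min_def)
  also have "\<dots> \<le> mixed_enorm p G"
    unfolding mixed_enorm_def by (intro iter_norm_mono p) auto
  finally show ?thesis .
qed

text \<open>
Slices of a Lebesgue measurable function need not be measurable. The statements on iterated norms
are therefore transferred from Borel representatives.
\<close>

lemma ex_borel_AE_eq:
  fixes F :: "'n::finite rvec \<Rightarrow> ennreal"
  assumes "F \<in> borel_measurable lebesgue"
  obtains F' where "F' \<in> borel_measurable borel" "AE x in lborel. F x = F' x"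
  using completion_ex_borel_measurable[OF assms] by auto

lemma mixed_enorm_cmult:
  assumes p: "\<And>i. fin_exp (p i)" and F: "F \<in> borel_measurable lebesgue"
  shows "mixed_enorm p (\<lambda>x. c * F x) = c * mixed_enorm p F"
proof -
  obtain F' where F': "F' \<in> borel_measurable borel" "AE x in lborel. F x = F' x"
    using ex_borel_AE_eq[OF F] .
  have "mixed_enorm p (\<lambda>x. c * F x) = mixed_enorm p (\<lambda>x. c * F' x)"
    using F'(2) by (intro mixed_enorm_cong_AE p) auto
  also have "\<dots> = c * mixed_enorm p F'"
    unfolding mixed_enorm_def by (intro iter_norm_cmult p F')
  also have "mixed_enorm p F' = mixed_enorm p F"
    using F'(2) by (intro mixed_enorm_cong_AE p) auto
  finally show ?thesis .
qed

lemma mixed_enorm_zero: "(\<And>i. fin_exp (p i)) \<Longrightarrow> mixed_enorm p (\<lambda>x. 0) = 0"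
  by (simp add: mixed_enorm_def iter_norm_zero)

lemma mixed_enorm_triangle:
  assumes p: "\<And>i. fin_exp (p i)"
    and F: "F \<in> borel_measurable lebesgue" and G: "G \<in> borel_measurable lebesgue"
  shows "mixed_enorm p (\<lambda>x. F x + G x) \<le> mixed_enorm p F + mixed_enorm p G"
proof -
  obtain F' where F': "F' \<in> borel_measurable borel" "AE x in lborel. F x = F' x"
    using ex_borel_AE_eq[OF F] .
  obtain G' where G': "G' \<in> borel_measurable borel" "AE x in lborel. G x = G' x"
    using ex_borel_AE_eq[OF G] .
  have "mixed_enorm p (\<lambda>x. F x + G x) = mixed_enorm p (\<lambda>x. F' x + G' x)"
    using F'(2) G'(2) by (intro mixed_enorm_cong_AE p) auto
  also have "\<dots> \<le> mixed_enorm p F' + mixed_enorm p G'"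
    unfolding mixed_enorm_def by (intro iter_norm_triangle p F' G')
  also have "mixed_enorm p F' = mixed_enorm p F"
    using F'(2) by (intro mixed_enorm_cong_AE p) auto
  also have "mixed_enorm p G' = mixed_enorm p G"
    using G'(2) by (intro mixed_enorm_cong_AE p) auto
  finally show ?thesis .
qed

lemma mixed_enorm_Holder:
  assumes p: "\<And>i. 1 < p i \<and> p i < \<infinity>"
    and F: "F \<in> borel_measurable lebesgue" and G: "G \<in> borel_measurable lebesgue"
  shows "(\<integral>\<^sup>+ x. F x * G x \<partial>lebesgue) \<le> mixed_enorm p F * mixed_enorm (\<lambda>i. conj_exp (p i)) G"
proof -
  note e = conj_exp_enn2real[OF conjunct1[OF p] conjunct2[OF p]]
  obtain F' where F': "F' \<in> borel_measurable borel" "AE x in lborel. F x = F' x"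
    using ex_borel_AE_eq[OF F] .
  obtain G' where G': "G' \<in> borel_measurable borel" "AE x in lborel. G x = G' x"
    using ex_borel_AE_eq[OF G] .
  have "(\<integral>\<^sup>+ x. F x * G x \<partial>lebesgue) = (\<integral>\<^sup>+ x. F' x * G' x \<partial>lborel)"
    unfolding nn_integral_completion
    using F'(2) G'(2) by (intro nn_integral_cong_AE) auto
  also have "\<dots> = iter_norm (\<lambda>_. 1) (sorted_list_of_set UNIV) (\<lambda>x. F' x * G' x) 0"
    using F' G' by (intro iter_norm_one_eq_lborel[symmetric]) auto
  also have "\<dots> \<le> mixed_enorm p F' * mixed_enorm (\<lambda>i. conj_exp (p i)) G'"
    unfolding mixed_enorm_def by (intro iter_norm_Holder p F' G')
  also have "mixed_enorm p F' = mixed_enorm p F"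
    using F'(2) by (intro mixed_enorm_cong_AE e) auto
  also have "mixed_enorm (\<lambda>i. conj_exp (p i)) G' = mixed_enorm (\<lambda>i. conj_exp (p i)) G"
    using G'(2) by (intro mixed_enorm_cong_AE e) auto
  finally show ?thesis .
qed

lemma iter_norm_box_finite:
  assumes "\<And>i. i \<in> set is \<Longrightarrow> fin_exp (p i)" "distinct is" "box_bounded C R is F"
  shows "iter_norm p is F x < \<infinity>"
  using assms
proof (induction "is" arbitrary: F C)
  case Nil
  then show ?case
    by (auto simp: box_bounded_def intro: order_le_less_trans[OF _ ennreal_less_top])
next
  case (Cons i "is")
  have p: "fin_exp (p i)" using Cons.prems by auto
  show ?case
    unfolding iter_norm_Cons[of p, OF p]
    by (rule Cons.IH[OF _ _ box_bounded_slice[of C R i _ F p, OF Cons.prems(3) p]]) (use Cons.prems in auto)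
qed

lemma bounded_vec_box:
  fixes A :: "(real ^ 'n) set"
  assumes "bounded A"
  obtains R where "0 \<le> R" "\<And>x i. x \<in> A \<Longrightarrow> \<bar>x $ i\<bar> \<le> R"
proof -
  obtain R where R: "\<And>x. x \<in> A \<Longrightarrow> norm x \<le> R"
    using assms by (auto simp: bounded_iff)
  have "\<bar>x $ i\<bar> \<le> max R 0" if "x \<in> A" for x i
    using R[OF that] component_le_norm_cart[of x i] by linarith
  then show ?thesis by (intro that[of "max R 0"]) auto
qed

lemma mixed_enorm_bounded_finite:
  fixes A :: "('n::{finite,linorder}) rvec set"
  assumes p: "\<And>i. fin_exp (p i)" and "bounded A" "A \<in> sets borel" "0 \<le> C"
  shows "mixed_enorm p (\<lambda>x. ennreal C * indicator A x) < \<infinity>"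
proof -
  obtain R where R: "0 \<le> R" "\<And>x i. x \<in> A \<Longrightarrow> \<bar>x $ i\<bar> \<le> R"
    using bounded_vec_box[OF \<open>bounded A\<close>] by metis
  show ?thesis
    unfolding mixed_enorm_def
  proof (rule iter_norm_box_finite)
    show "box_bounded C R (sorted_list_of_set UNIV) (\<lambda>x. ennreal C * indicator A x)"
      using R assms by (auto simp: box_bounded_def indicator_def not_le[symmetric])
  qed (auto simp: p)
qed

text \<open>
After passing to Borel representatives, the sequence is set to zero on a Borel null set outside of
which all hypotheses hold, so that they hold everywhere.
\<close>

lemma mixed_enorm_dominated:
  fixes F :: "nat \<Rightarrow> 'n::{finite,linorder} rvec \<Rightarrow> ennreal"
  assumes p: "\<And>i. fin_exp (p i)"
    and F: "\<And>k. F k \<in> borel_measurable lebesgue" and G: "G \<in> borel_measurable lebesgue"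
    and le: "\<And>k. AE x in lborel. F k x \<le> G x" and fin: "mixed_enorm p G < \<infinity>"
    and lim: "AE x in lborel. (\<lambda>k. F k x) \<longlonglongrightarrow> 0"
  shows "(\<lambda>k. mixed_enorm p (F k)) \<longlonglongrightarrow> 0"
proof -
  have "\<exists>F'. F' \<in> borel_measurable borel \<and> (AE x in lborel. F k x = F' x)" for k
    using ex_borel_AE_eq[OF F[of k]] by blast
  then obtain F' where F': "\<And>k. F' k \<in> borel_measurable borel" "\<And>k. AE x in lborel. F k x = F' k x"
    by metis
  obtain G' where G': "G' \<in> borel_measurable borel" "AE x in lborel. G x = G' x"
    using ex_borel_AE_eq[OF G] .
  have "AE x in lborel. (\<forall>k. F k x = F' k x) \<and> (\<forall>k. F k x \<le> G x) \<and> G x = G' x \<and> (\<lambda>k. F k x) \<longlonglongrightarrow> 0"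
    using F'(2) G'(2) le lim by (simp add: AE_all_countable)
  then obtain N where N: "N \<in> null_sets lborel"
    and N': "\<And>x. x \<in> space lborel - N \<Longrightarrow>
      (\<forall>k. F k x = F' k x) \<and> (\<forall>k. F k x \<le> G x) \<and> G x = G' x \<and> (\<lambda>k. F k x) \<longlonglongrightarrow> 0"
    by (rule AE_E3) blast
  have off: "F k x = F' k x" "F' k x \<le> G' x" "(\<lambda>k. F' k x) \<longlonglongrightarrow> 0" if "x \<notin> N" for x k
  proof -
    have *: "F k x = F' k x" "F k x \<le> G x" "G x = G' x" "(\<lambda>k. F k x) \<longlonglongrightarrow> 0" for k
      using N'[unfolded space_lborel space_borel, OF DiffI[OF UNIV_I that]] by blast+
    from *(1) show "F k x = F' k x" .
    from *(2)[of k] show "F' k x \<le> G' x" unfolding * .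
    from *(4) show "(\<lambda>k. F' k x) \<longlonglongrightarrow> 0" unfolding *(1) .
  qed
  \<comment> \<open>Zero on the exceptional set keeps \<open>H k\<close> below the majorant there.\<close>
  define H where "H k x = (if x \<in> N then 0 else F' k x)" for k x
  have [measurable]: "N \<in> sets borel" "F' k \<in> borel_measurable borel" for k
    using N F'(1) by (auto simp: null_sets_def)
  have H_eq: "mixed_enorm p (H k) = mixed_enorm p (F k)" for k
    using AE_not_in[OF N] by (intro mixed_enorm_cong_AE p) (auto simp: H_def off elim!: eventually_mono)
  have "(\<lambda>k. mixed_enorm p (H k)) \<longlonglongrightarrow> 0"
    unfolding mixed_enorm_def
  proof (rule iter_norm_dominated[of _ _ _ G'])
    show "H k \<in> borel_measurable borel" for k
      unfolding H_def by measurable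
    show "H k x \<le> G' x" for k x
      using off[of x] by (cases "x \<in> N") (simp_all add: H_def)
    show "(\<lambda>k. H k x) \<longlonglongrightarrow> 0" for x
      using off[of x] by (cases "x \<in> N") (simp_all add: H_def)
    have "mixed_enorm p G' < \<infinity>"
      using fin mixed_enorm_cong_AE[OF p G'(2)] by simp
    then show "iter_norm p (sorted_list_of_set UNIV) G' 0 < \<infinity>"
      by (simp only: mixed_enorm_def)
  qed (simp_all add: p G'(1))
  then show ?thesis by (simp only: H_eq)
qed

text \<open>
Two truncations are needed: \<open>F\<close> is cut off from above so that it is bounded on a box and has a dual
function, and this dual function is cut off to become bounded. If the levels are high enough, the
strict inequality \<open>c < \<dots>\<close> survives, by monotone convergence.
\<close>

lemma mixed_enorm_duality:
  fixes A :: "('n::{finite,linorder}) rvec set"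
  assumes p: "\<And>i. 1 < p i \<and> p i < \<infinity>"
    and A: "bounded A" and [measurable]: "A \<in> sets borel"
    and F: "F \<in> borel_measurable lebesgue" and F0: "\<And>x. x \<notin> A \<Longrightarrow> F x = 0"
    and c: "c < mixed_enorm p F"
  obtains G and k :: nat where "G \<in> borel_measurable borel" "\<And>x. G x \<le> of_nat k" "\<And>x. x \<notin> A \<Longrightarrow> G x = 0"
    "mixed_enorm (\<lambda>i. conj_exp (p i)) G \<le> 1" "c < (\<integral>\<^sup>+ x. F x * G x \<partial>lebesgue)"
proof -
  note e = conj_exp_enn2real[OF conjunct1[OF p] conjunct2[OF p]]
  obtain R where R: "0 \<le> R" "\<And>x i. x \<in> A \<Longrightarrow> \<bar>x $ i\<bar> \<le> R"
    using bounded_vec_box[OF \<open>bounded A\<close>] by metis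
  obtain F' where F': "F' \<in> borel_measurable borel" "AE x in lborel. F x = F' x"
    using ex_borel_AE_eq[OF F] .
  note [measurable] = F'(1)
  define F2 where "F2 x = F' x * indicator A x" for x
  have [measurable]: "F2 \<in> borel_measurable borel" unfolding F2_def by measurable
  have F2: "AE x in lborel. F x = F2 x"
    using F'(2) by eventually_elim (auto simp: F2_def indicator_def F0)
  have "mixed_enorm p F = mixed_enorm p F2"
    by (intro mixed_enorm_cong_AE e F2)
  have trunc: "(\<lambda>k. min y (of_nat k)) \<longlonglongrightarrow> y" for y :: ennreal
    using tendsto_min[OF tendsto_const[of y] of_nat_tendsto_top_ennreal] by simp
  have "(\<lambda>k. mixed_enorm p (\<lambda>x. min (F2 x) (of_nat k))) \<longlonglongrightarrow> mixed_enorm p F2"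
    unfolding mixed_enorm_def
    by (intro iter_norm_LIMSEQ trunc e) (auto simp: incseq_def le_fun_def min_le_iff_disj)
  then have "\<forall>\<^sub>F k in sequentially. c < mixed_enorm p (\<lambda>x. min (F2 x) (of_nat k))"
    using c \<open>mixed_enorm p F = mixed_enorm p F2\<close> by (auto intro: order_tendstoD)
  then obtain m where m: "c < mixed_enorm p (\<lambda>x. min (F2 x) (of_nat m))"
    by (auto simp: eventually_sequentially)
  define F3 where "F3 x = min (F2 x) (of_nat m)" for x
  have [measurable]: "F3 \<in> borel_measurable borel" unfolding F3_def by measurable
  have F30: "F3 x = 0" if "x \<notin> A" for x using that by (simp add: F3_def F2_def)
  have F3m: "F3 x \<le> ennreal (real m)" for x by (simp add: F3_def ennreal_of_nat_eq_real_of_nat)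
  have "box_bounded (real m) R (sorted_list_of_set UNIV) F3"
    unfolding box_bounded_def using R F30 F3m by (auto simp: not_le[symmetric])
  from iter_norm_extremal[OF _ _ this, of p] p
  obtain G where [measurable]: "G \<in> borel_measurable borel"
    and G1: "mixed_enorm (\<lambda>i. conj_exp (p i)) G \<le> 1"
    and G2: "iter_norm (\<lambda>_. 1) (sorted_list_of_set UNIV) (\<lambda>x. F3 x * G x) 0 = mixed_enorm p F3"
    unfolding mixed_enorm_def by auto
  have "(\<lambda>k. \<integral>\<^sup>+ x. F3 x * min (G x) (of_nat k) \<partial>lborel) \<longlonglongrightarrow> (\<integral>\<^sup>+ x. F3 x * G x \<partial>lborel)"
  proof (rule nn_integral_LIMSEQ)
    show "(\<lambda>k. F3 x * min (G x) (of_nat k)) \<longlonglongrightarrow> F3 x * G x" for x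
      using F3m[of x] by (intro ennreal_tendsto_cmult trunc) (auto intro: order_le_less_trans)
  qed (auto simp: incseq_def le_fun_def min_le_iff_disj intro!: mult_left_mono)
  moreover have "c < (\<integral>\<^sup>+ x. F3 x * G x \<partial>lborel)"
    using m G2 by (subst iter_norm_one_eq_lborel[symmetric, of _ 0]) (auto simp: F3_def[abs_def])
  ultimately have "\<forall>\<^sub>F k in sequentially. c < (\<integral>\<^sup>+ x. F3 x * min (G x) (of_nat k) \<partial>lborel)"
    by (rule order_tendstoD)
  then obtain k where k: "c < (\<integral>\<^sup>+ x. F3 x * min (G x) (of_nat k) \<partial>lborel)"
    by (auto simp: eventually_sequentially)
  define G' where "G' x = min (G x) (of_nat k) * indicator A x" for x
  show ?thesis
  proof (rule that[of G' k])
    show "G' \<in> borel_measurable borel" unfolding G'_def by measurable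
    show "G' x \<le> of_nat k" for x by (auto simp: G'_def indicator_def)
    show "G' x = 0" if "x \<notin> A" for x using that by (simp add: G'_def)
    have "mixed_enorm (\<lambda>i. conj_exp (p i)) G' \<le> mixed_enorm (\<lambda>i. conj_exp (p i)) G"
      by (intro mixed_enorm_mono_AE e AE_I2) (auto simp: G'_def indicator_def)
    then show "mixed_enorm (\<lambda>i. conj_exp (p i)) G' \<le> 1" using G1 by simp
    have "(\<integral>\<^sup>+ x. F3 x * min (G x) (of_nat k) \<partial>lborel) \<le> (\<integral>\<^sup>+ x. F x * G' x \<partial>lborel)"
    proof (rule nn_integral_mono_AE)
      show "AE x in lborel. F3 x * min (G x) (of_nat k) \<le> F x * G' x"
        using F2
      proof eventually_elim
        fix x assume "F x = F2 x"
        then show "F3 x * min (G x) (of_nat k) \<le> F x * G' x"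
          using F30[of x] by (cases "x \<in> A") (auto simp: G'_def F3_def intro!: mult_right_mono)
      qed
    qed
    then show "c < (\<integral>\<^sup>+ x. F x * G' x \<partial>lebesgue)"
      using k by (simp add: nn_integral_completion)
  qed
qed

section \<open>The Hahn-Banach theorem for spaces of complex functions\<close>

definition fun_subspace :: "('a \<Rightarrow> complex) set \<Rightarrow> bool" where
  "fun_subspace V \<longleftrightarrow> (\<lambda>x. 0) \<in> V \<and> (\<forall>f\<in>V. \<forall>g\<in>V. (\<lambda>x. f x + g x) \<in> V) \<and>
     (\<forall>c. \<forall>f\<in>V. (\<lambda>x. c * f x) \<in> V)"

definition sublinear_on :: "('a \<Rightarrow> complex) set \<Rightarrow> (('a \<Rightarrow> complex) \<Rightarrow> real) \<Rightarrow> bool" where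
  "sublinear_on V q \<longleftrightarrow> (\<forall>f\<in>V. \<forall>g\<in>V. q (\<lambda>x. f x + g x) \<le> q f + q g) \<and>
     (\<forall>c\<ge>0. \<forall>f\<in>V. q (\<lambda>x. of_real c * f x) = c * q f)"

lemma fun_subspaceD:
  assumes "fun_subspace V"
  shows "(\<lambda>x. 0) \<in> V"
    and "f \<in> V \<Longrightarrow> h \<in> V \<Longrightarrow> (\<lambda>x. f x + h x) \<in> V"
    and "f \<in> V \<Longrightarrow> (\<lambda>x. c * f x) \<in> V"
    and "f \<in> V \<Longrightarrow> (\<lambda>x. - f x) \<in> V"
proof -
  show *: "f \<in> V \<Longrightarrow> (\<lambda>x. c * f x) \<in> V" for c
    using assms by (simp add: fun_subspace_def)
  show "f \<in> V \<Longrightarrow> (\<lambda>x. - f x) \<in> V"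
    using *[of "-1"] by simp
qed (use assms in \<open>simp_all add: fun_subspace_def\<close>)

lemma sublinear_onD:
  assumes "sublinear_on V q"
  shows "f \<in> V \<Longrightarrow> h \<in> V \<Longrightarrow> q (\<lambda>x. f x + h x) \<le> q f + q h"
    and "0 \<le> c \<Longrightarrow> f \<in> V \<Longrightarrow> q (\<lambda>x. of_real c * f x) = c * q f"
  using assms by (simp_all add: sublinear_on_def)

lemma sublinear_onI:
  assumes add: "\<And>f g. f \<in> V \<Longrightarrow> g \<in> V \<Longrightarrow> q (\<lambda>x. f x + g x) \<le> q f + q g"
    and 0: "q (\<lambda>x. 0) = 0"
    and mult: "\<And>c f. 0 < c \<Longrightarrow> f \<in> V \<Longrightarrow> q (\<lambda>x. of_real c * f x) \<le> c * q f"
    and V: "fun_subspace V"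
  shows "sublinear_on V q"
  unfolding sublinear_on_def
proof (intro conjI ballI allI impI add)
  fix c :: real and f assume c: "0 \<le> c" and f: "f \<in> V"
  show "q (\<lambda>x. of_real c * f x) = c * q f"
  proof (cases "c = 0")
    case True
    then show ?thesis using 0 by simp
  next
    case False
    then have c: "0 < c" using c by simp
    have cf: "(\<lambda>x. of_real c * f x) \<in> V" using V f by (rule fun_subspaceD)
    have "(\<lambda>x. of_real (1 / c) * (of_real c * f x)) = f"
      using c by (auto simp: fun_eq_iff)
    then have "q f \<le> (1 / c) * q (\<lambda>x. of_real c * f x)"
      using mult[of "1 / c", OF _ cf] c by simp
    then have "c * q f \<le> q (\<lambda>x. of_real c * f x)"
      using c by (simp add: field_simps)
    then show ?thesis using mult[OF c f] by simp
  qed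
qed

lemma sublinear_on_zero: "sublinear_on V q \<Longrightarrow> fun_subspace V \<Longrightarrow> q (\<lambda>x. 0) = 0"
  using sublinear_onD(2)[of V q 0 "\<lambda>x. 0"] fun_subspaceD(1)[of V] by simp

lemma sublinear_on_neg:
  assumes q: "sublinear_on V q" and V: "fun_subspace V" and f: "f \<in> V"
  shows "- q (\<lambda>x. - f x) \<le> q f"
proof -
  have m: "(\<lambda>x. - f x) \<in> V"
    using V f by (rule fun_subspaceD)
  have "q (\<lambda>x. f x + - f x) \<le> q f + q (\<lambda>x. - f x)"
    by (rule sublinear_onD(1)[OF q f m])
  then show ?thesis using sublinear_on_zero[OF q V] by simp
qed

text \<open>
The idea of the proof of the Hahn-Banach theorem: \<open>directional_inf q g\<close> is a sublinear minorant of \<open>q\<close>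
with value at most \<open>- q g\<close> at \<open>- g\<close>. A sublinear functional \<open>q\<close> that is minimal must agree with
all its minorants of this kind, and this forces \<open>q (f + g) = q f + q g\<close>.
\<close>

definition directional_inf ::
    "(('a \<Rightarrow> complex) \<Rightarrow> real) \<Rightarrow> ('a \<Rightarrow> complex) \<Rightarrow> ('a \<Rightarrow> complex) \<Rightarrow> real" where
  "directional_inf q g f = (INF s\<in>{0..}. q (\<lambda>x. f x + of_real s * g x) - s * q g)"

lemma directional_inf:
  assumes q: "sublinear_on V q" and V: "fun_subspace V" and g: "g \<in> V"
  shows "sublinear_on V (directional_inf q g)"
    and "f \<in> V \<Longrightarrow> 0 \<le> s \<Longrightarrow> directional_inf q g f \<le> q (\<lambda>x. f x + of_real s * g x) - s * q g"
    and "f \<in> V \<Longrightarrow> directional_inf q g f \<le> q f"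
proof -
  note add = fun_subspaceD(2)[OF V] and mult = fun_subspaceD(3)[OF V] and neg = fun_subspaceD(4)[OF V]
  note qadd = sublinear_onD(1)[OF q] and qmult = sublinear_onD(2)[OF q]
  have lower: "- q (\<lambda>x. - f x) \<le> q (\<lambda>x. f x + of_real s * g x) - s * q g" if f: "f \<in> V" and s: "0 \<le> s" for f s
  proof -
    have "q (\<lambda>x. (f x + of_real s * g x) + - f x) \<le> q (\<lambda>x. f x + of_real s * g x) + q (\<lambda>x. - f x)"
      by (rule qadd[OF add[OF f mult[OF g]] neg[OF f]])
    then show ?thesis using qmult[OF s g] by simp
  qed
  have bdd: "bdd_below ((\<lambda>s. q (\<lambda>x. f x + of_real s * g x) - s * q g) ` {0..})" if "f \<in> V" for f
    using lower[OF that] by (intro bdd_belowI[of _ "- q (\<lambda>x. - f x)"]) auto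
  show le: "directional_inf q g f \<le> q (\<lambda>x. f x + of_real s * g x) - s * q g" if "f \<in> V" "0 \<le> s" for f s
    unfolding directional_inf_def by (rule cINF_lower[OF bdd]) (use that in auto)
  show le': "directional_inf q g f \<le> q f" if "f \<in> V" for f
    using le[OF that, of 0] by simp
  show "sublinear_on V (directional_inf q g)"
  proof (rule sublinear_onI[OF _ _ _ V])
    fix f h assume f: "f \<in> V" and h: "h \<in> V"
    have *: "directional_inf q g (\<lambda>x. f x + h x)
        \<le> (q (\<lambda>x. f x + of_real s * g x) - s * q g) + (q (\<lambda>x. h x + of_real t * g x) - t * q g)"
      if "0 \<le> s" "0 \<le> t" for s t
    proof -
      have "q (\<lambda>x. (f x + h x) + of_real (s + t) * g x)
          = q (\<lambda>x. (f x + of_real s * g x) + (h x + of_real t * g x))"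
        by (simp add: algebra_simps)
      also have "\<dots> \<le> q (\<lambda>x. f x + of_real s * g x) + q (\<lambda>x. h x + of_real t * g x)"
        by (rule qadd[OF add[OF f mult[OF g]] add[OF h mult[OF g]]])
      finally show ?thesis
        using le[OF add[OF f h], of "s + t"] that by (simp add: algebra_simps)
    qed
    have "directional_inf q g (\<lambda>x. f x + h x) - directional_inf q g f
        \<le> q (\<lambda>x. h x + of_real t * g x) - t * q g" if "0 \<le> t" for t
    proof -
      have "directional_inf q g (\<lambda>x. f x + h x) - (q (\<lambda>x. h x + of_real t * g x) - t * q g)
          \<le> directional_inf q g f"
        unfolding directional_inf_def[of q g f]
        by (rule cINF_greatest) (use *[OF _ that] in \<open>auto simp: algebra_simps\<close>)
      then show ?thesis by simp
    qed
    then have "directional_inf q g (\<lambda>x. f x + h x) - directional_inf q g f \<le> directional_inf q g h"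
      unfolding directional_inf_def[of q g h] by (intro cINF_greatest) auto
    then show "directional_inf q g (\<lambda>x. f x + h x) \<le> directional_inf q g f + directional_inf q g h"
      by simp
  next
    have 0: "(\<lambda>x. 0) \<in> V" using V by (rule fun_subspaceD)
    have "0 \<le> directional_inf q g (\<lambda>x. 0)"
      unfolding directional_inf_def by (rule cINF_greatest) (auto simp: qmult g)
    moreover have "directional_inf q g (\<lambda>x. 0) \<le> 0"
      using le'[OF 0] sublinear_on_zero[OF q V] by simp
    ultimately show "directional_inf q g (\<lambda>x. 0) = 0" by simp
  next
    fix c :: real and f assume c: "0 < c" and f: "f \<in> V"
    have "directional_inf q g (\<lambda>x. of_real c * f x) / c \<le> directional_inf q g f"
      unfolding directional_inf_def[of q g f]
    proof (rule cINF_greatest)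
      fix s :: real assume "s \<in> {0..}"
      then have s: "0 \<le> s" by simp
      have "q (\<lambda>x. of_real c * f x + of_real (c * s) * g x) = c * q (\<lambda>x. f x + of_real s * g x)"
        using qmult[of c "\<lambda>x. f x + of_real s * g x"] c add[OF f mult[OF g]]
        by (simp add: algebra_simps)
      then show "directional_inf q g (\<lambda>x. of_real c * f x) / c \<le> q (\<lambda>x. f x + of_real s * g x) - s * q g"
        using le[OF mult[OF f], of "c * s" "of_real c"] c s by (simp add: field_simps)
    qed simp
    then show "directional_inf q g (\<lambda>x. of_real c * f x) \<le> c * directional_inf q g f"
      using c by (simp add: field_simps)
  qed
qed

text \<open>
By Zorn's lemma, since the pointwise infimum of a chain is again sublinear; it is finite because a
sublinear \<open>q \<le> p\<close> satisfies \<open>- p (- f) \<le> q f\<close>. The functionals are set to zero outside \<open>V\<close> to make the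
pointwise order on \<open>V\<close> antisymmetric.
\<close>

lemma ex_minimal_sublinear:
  assumes p: "sublinear_on V p" and V: "fun_subspace V"
  obtains q where "sublinear_on V q" "\<And>f. f \<in> V \<Longrightarrow> q f \<le> p f"
    "\<And>q'. sublinear_on V q' \<Longrightarrow> (\<And>f. f \<in> V \<Longrightarrow> q' f \<le> q f) \<Longrightarrow> (\<And>f. f \<in> V \<Longrightarrow> q' f = q f)"
proof -
  define A where "A = {q. sublinear_on V q \<and> (\<forall>f\<in>V. q f \<le> p f) \<and> (\<forall>f. f \<notin> V \<longrightarrow> q f = 0)}"
  define P where "P q q' \<longleftrightarrow> (\<forall>f\<in>V. q' f \<le> q f)" for q q' :: "('a \<Rightarrow> complex) \<Rightarrow> real"
  have clip: "sublinear_on V (\<lambda>f. if f \<in> V then q f else 0)" if "sublinear_on V q" for q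
    using sublinear_onD[OF that] fun_subspaceD(2,3)[OF V] by (simp add: sublinear_on_def)
  have po: "partial_order_on A (relation_of P A)"
  proof (rule partial_order_on_relation_ofI)
    show "a = b" if "a \<in> A" "b \<in> A" "P a b" "P b a" for a b
    proof
      fix f show "a f = b f"
        using that by (cases "f \<in> V") (simp_all add: A_def P_def antisym)
    qed
    show "P a c" if "P a b" "P b c" for a b c
      using that unfolding P_def by (meson order_trans)
  qed (simp add: P_def)
  have lower: "- p (\<lambda>x. - f x) \<le> q f" if "q \<in> A" "f \<in> V" for q f
  proof -
    have "(\<lambda>x. - f x) \<in> V"
      using V \<open>f \<in> V\<close> by (rule fun_subspaceD)
    then have "q (\<lambda>x. - f x) \<le> p (\<lambda>x. - f x)" using that by (auto simp: A_def)
    moreover have "- q (\<lambda>x. - f x) \<le> q f"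
      using that V by (intro sublinear_on_neg) (auto simp: A_def)
    ultimately show ?thesis by simp
  qed
  have "\<exists>m\<in>A. \<forall>a\<in>A. P m a \<longrightarrow> a = m"
  proof (rule predicate_Zorn[OF po])
    fix C assume C: "C \<in> Chains (relation_of P A)"
    then have CA: "C \<subseteq> A" and chain: "\<And>a b. a \<in> C \<Longrightarrow> b \<in> C \<Longrightarrow> P a b \<or> P b a"
      by (auto simp: Chains_def relation_of_def)
    show "\<exists>u\<in>A. \<forall>a\<in>C. P a u"
    proof (cases "C = {}")
      case True
      have "(\<lambda>f. if f \<in> V then p f else 0) \<in> A"
        using clip[OF p] by (auto simp: A_def)
      then show ?thesis using True by auto
    next
      case False
      define u where "u f = (if f \<in> V then INF a\<in>C. a f else 0)" for f
      have bdd: "bdd_below ((\<lambda>a. a f) ` C)" if "f \<in> V" for f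
        using lower[OF _ that] CA by (intro bdd_belowI[of _ "- p (\<lambda>x. - f x)"]) auto
      have u_le: "u f \<le> a f" if "a \<in> C" "f \<in> V" for a f
        unfolding u_def using that bdd by (auto intro: cINF_lower)
      have sub: "sublinear_on V u"
      proof (rule sublinear_onI[OF _ _ _ V])
        fix f g assume f: "f \<in> V" and g: "g \<in> V"
        then have fg: "(\<lambda>x. f x + g x) \<in> V" by (rule fun_subspaceD[OF V])
        have *: "u (\<lambda>x. f x + g x) \<le> a f + b g" if "a \<in> C" "b \<in> C" for a b
        proof -
          have "\<exists>d\<in>C. d f \<le> a f \<and> d g \<le> b g"
            using chain[OF that] that f g unfolding P_def by blast
          then obtain d where d: "d \<in> C" "d f \<le> a f" "d g \<le> b g" by blast
          have "u (\<lambda>x. f x + g x) \<le> d (\<lambda>x. f x + g x)" using d fg by (intro u_le)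
          also have "\<dots> \<le> d f + d g"
            using d CA by (intro sublinear_onD(1)[OF _ f g]) (auto simp: A_def)
          finally show ?thesis using d by simp
        qed
        have "u (\<lambda>x. f x + g x) - u f \<le> b g" if "b \<in> C" for b
        proof -
          have "u (\<lambda>x. f x + g x) - b g \<le> (INF a\<in>C. a f)"
            using *[OF _ that] False by (intro cINF_greatest) (auto simp: algebra_simps)
          then show ?thesis using f by (simp add: u_def[of f])
        qed
        then have "u (\<lambda>x. f x + g x) - u f \<le> (INF b\<in>C. b g)"
          using False by (intro cINF_greatest) auto
        then show "u (\<lambda>x. f x + g x) \<le> u f + u g" using g by (simp add: u_def[of g])
      next
        have "a (\<lambda>x. 0) = 0" if "a \<in> C" for a
          using that CA sublinear_on_zero[OF _ V] by (auto simp: A_def)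
        then have "(\<lambda>a. a (\<lambda>x. 0)) ` C = {0}" using False by force
        then have "(INF a\<in>C. a (\<lambda>x. 0)) = 0" by simp
        then show "u (\<lambda>x. 0) = 0" by (simp add: u_def)
      next
        fix c :: real and f assume c: "0 < c" and f: "f \<in> V"
        have cf: "(\<lambda>x. of_real c * f x) \<in> V" using V f by (rule fun_subspaceD)
        have "u (\<lambda>x. of_real c * f x) / c \<le> (INF a\<in>C. a f)"
        proof (rule cINF_greatest[OF False])
          fix a assume a: "a \<in> C"
          then have "a (\<lambda>x. of_real c * f x) = c * a f"
            using CA c by (intro sublinear_onD(2)[OF _ _ f]) (auto simp: A_def)
          then show "u (\<lambda>x. of_real c * f x) / c \<le> a f"
            using u_le[OF a cf] c by (simp add: field_simps)
        qed
        then show "u (\<lambda>x. of_real c * f x) \<le> c * u f"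
          using f c by (simp add: u_def[of f] field_simps)
      qed
      have "u \<in> A"
      proof -
        obtain a where "a \<in> C" using False by auto
        then have "u f \<le> p f" if "f \<in> V" for f
          using u_le[OF _ that] CA that by (force simp: A_def)
        then show ?thesis using sub by (auto simp: A_def) (simp add: u_def)
      qed
      then show ?thesis using u_le by (auto simp: P_def)
    qed
  qed
  then obtain q where q: "q \<in> A" and min: "\<And>a. a \<in> A \<Longrightarrow> P q a \<Longrightarrow> a = q" by blast
  show ?thesis
  proof (rule that[of q])
    show "sublinear_on V q" "\<And>f. f \<in> V \<Longrightarrow> q f \<le> p f" using q by (auto simp: A_def)
    fix q' f assume q': "sublinear_on V q'" "\<And>f. f \<in> V \<Longrightarrow> q' f \<le> q f" and f: "f \<in> V"
    have "(\<lambda>f. if f \<in> V then q' f else 0) = q"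
    proof (rule min)
      show "(\<lambda>f. if f \<in> V then q' f else 0) \<in> A"
        using clip[OF q'(1)] order_trans[OF q'(2)] q by (simp add: A_def)
      show "P q (\<lambda>f. if f \<in> V then q' f else 0)" using q'(2) by (auto simp: P_def)
    qed
    from fun_cong[OF this, of f] show "q' f = q f" using f by simp
  qed
qed

text \<open>
A minimal functional below \<open>directional_inf p g\<close>, and not merely below \<open>p\<close>, has the maximal possible
value at \<open>g\<close>.
\<close>

lemma Hahn_Banach_real:
  assumes p: "sublinear_on V p" and V: "fun_subspace V" and g: "g \<in> V"
  obtains q where "\<And>f h. f \<in> V \<Longrightarrow> h \<in> V \<Longrightarrow> q (\<lambda>x. f x + h x) = q f + q h"
    "\<And>c f. f \<in> V \<Longrightarrow> q (\<lambda>x. of_real c * f x) = c * q f"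
    "\<And>f. f \<in> V \<Longrightarrow> q f \<le> p f" "q g = p g"
proof -
  note neg = fun_subspaceD(4)[OF V]
  note d = directional_inf[OF p V g]
  obtain q where q: "sublinear_on V q" and q_le: "\<And>f. f \<in> V \<Longrightarrow> q f \<le> directional_inf p g f"
    and min: "\<And>q' f. sublinear_on V q' \<Longrightarrow> (\<And>f. f \<in> V \<Longrightarrow> q' f \<le> q f) \<Longrightarrow> f \<in> V \<Longrightarrow> q' f = q f"
    by (rule ex_minimal_sublinear[OF d(1) V]) blast
  have add: "q (\<lambda>x. f x + h x) = q f + q h" if f: "f \<in> V" and h: "h \<in> V" for f h
  proof -
    note dh = directional_inf[OF q V h]
    have "q f = directional_inf q h f"
      using min[OF dh(1) dh(3) f] by simp
    also have "\<dots> \<le> q (\<lambda>x. f x + of_real 1 * h x) - 1 * q h"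
      by (rule dh(2)) (use f in auto)
    finally have "q f + q h \<le> q (\<lambda>x. f x + h x)" by simp
    moreover have "q (\<lambda>x. f x + h x) \<le> q f + q h"
      by (rule sublinear_onD(1)[OF q f h])
    ultimately show ?thesis by simp
  qed
  have qneg: "q (\<lambda>x. - f x) = - q f" if "f \<in> V" for f
    using add[OF that neg[OF that]] sublinear_on_zero[OF q V] by simp
  show ?thesis
  proof (rule that[of q])
    show "q (\<lambda>x. of_real c * f x) = c * q f" if f: "f \<in> V" for c f
    proof (cases "0 \<le> c")
      case True
      then show ?thesis by (rule sublinear_onD(2)[OF q _ f])
    next
      case False
      then have "q (\<lambda>x. of_real (- c) * - f x) = (- c) * q (\<lambda>x. - f x)"
        by (intro sublinear_onD(2)[OF q _ neg[OF f]]) simp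
      then show ?thesis using qneg[OF f] by simp
    qed
    show "q f \<le> p f" if "f \<in> V" for f
      using q_le[OF that] d(3)[OF that] by simp
    have "q (\<lambda>x. - g x) \<le> directional_inf p g (\<lambda>x. - g x)"
      by (rule q_le[OF neg[OF g]])
    also have "\<dots> \<le> p (\<lambda>x. - g x + of_real 1 * g x) - 1 * p g"
      by (rule d(2)[OF neg[OF g]]) simp
    also have "\<dots> = - p g" using sublinear_on_zero[OF p V] by simp
    finally have "p g \<le> q g" using qneg[OF g] by simp
    then show "q g = p g" using q_le[OF g] d(3)[OF g] by simp
  qed (rule add)
qed

text \<open>
The real functional \<open>q\<close> is the real part of \<open>L f = q f - \<i> q (\<i> f)\<close>. Multiplying \<open>f\<close> by a number of modulus
one makes \<open>L f\<close> real, so the bound for \<open>q\<close> carries over to \<open>\<bar>L f\<bar>\<close>.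
\<close>

theorem Hahn_Banach_complex:
  assumes V: "fun_subspace V" and g: "g \<in> V"
    and tri: "\<And>f h. f \<in> V \<Longrightarrow> h \<in> V \<Longrightarrow> N (\<lambda>x. f x + h x) \<le> N f + N h"
    and hom: "\<And>c f. f \<in> V \<Longrightarrow> N (\<lambda>x. c * f x) = norm c * N f"
  obtains L :: "('a \<Rightarrow> complex) \<Rightarrow> complex"
  where "\<And>f h. f \<in> V \<Longrightarrow> h \<in> V \<Longrightarrow> L (\<lambda>x. f x + h x) = L f + L h"
    "\<And>c f. f \<in> V \<Longrightarrow> L (\<lambda>x. c * f x) = c * L f"
    "\<And>f. f \<in> V \<Longrightarrow> norm (L f) \<le> N f" "L g = of_real (N g)"
proof -
  note add = fun_subspaceD(2)[OF V] and mult = fun_subspaceD(3)[OF V]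
  have "sublinear_on V N"
    using tri hom by (simp add: sublinear_on_def)
  then obtain q where
    qadd: "\<And>f h. f \<in> V \<Longrightarrow> h \<in> V \<Longrightarrow> q (\<lambda>x. f x + h x) = q f + q h"
    and qmult: "\<And>c f. f \<in> V \<Longrightarrow> q (\<lambda>x. of_real c * f x) = c * q f"
    and q_le: "\<And>f. f \<in> V \<Longrightarrow> q f \<le> N f" and qg: "q g = N g"
    by (rule Hahn_Banach_real[OF _ V g]) blast
  define L where "L f = Complex (q f) (- q (\<lambda>x. \<i> * f x))" for f
  have Ladd: "L (\<lambda>x. f x + h x) = L f + L h" if "f \<in> V" "h \<in> V" for f h
    using qadd[OF that] qadd[OF mult[OF that(1)] mult[OF that(2)], of \<i> \<i>]
    by (simp add: L_def distrib_left complex_eq_iff)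
  have Lreal: "L (\<lambda>x. of_real c * f x) = of_real c * L f" if "f \<in> V" for c f
    using qmult[OF that, of c] qmult[OF mult[OF that, of \<i>], of c]
    by (simp add: L_def complex_eq_iff mult.left_commute)
  have Li: "L (\<lambda>x. \<i> * f x) = \<i> * L f" if "f \<in> V" for f
  proof -
    have "q (\<lambda>x. \<i> * (\<i> * f x)) = - q f"
      using qmult[OF that, of "-1"] by (simp add: mult.assoc[symmetric])
    then show ?thesis by (simp add: L_def complex_eq_iff)
  qed
  have Lmult: "L (\<lambda>x. c * f x) = c * L f" if f: "f \<in> V" for c f
  proof -
    have "(\<lambda>x. c * f x) = (\<lambda>x. of_real (Re c) * f x + of_real (Im c) * (\<i> * f x))"
      by (subst complex_eq[of c]) (simp add: fun_eq_iff algebra_simps)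
    then have "L (\<lambda>x. c * f x) = of_real (Re c) * L f + of_real (Im c) * (\<i> * L f)"
      by (simp only: Ladd[OF mult[OF f] mult[OF mult[OF f]]] Lreal[OF f] Lreal[OF mult[OF f]] Li[OF f])
    also have "\<dots> = c * L f"
      by (subst (3) complex_eq[of c]) (simp add: algebra_simps)
    finally show ?thesis .
  qed
  have bound: "norm (L f) \<le> N f" if f: "f \<in> V" for f
  proof (cases "L f = 0")
    case True
    have "q (\<lambda>x. 0 * f x) \<le> N (\<lambda>x. 0 * f x)" by (rule q_le[OF mult[OF f]])
    have "0 \<le> N f"
    proof -
      have "N (\<lambda>x. f x + (-1) * f x) \<le> N f + N (\<lambda>x. (-1) * f x)"
        by (rule tri[OF f mult[OF f]])
      then show ?thesis using hom[OF f, of "-1"] hom[OF f, of 0] by simp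
    qed
    then show ?thesis using True by simp
  next
    case False
    define c where "c = cnj (L f) / of_real (norm (L f))"
    have c1: "norm c = 1" using False by (simp add: c_def norm_divide)
    have "L (\<lambda>x. c * f x) = c * L f" by (rule Lmult[OF f])
    also have "\<dots> = of_real (norm (L f))"
      using False complex_norm_square[of "L f"]
      by (simp add: c_def nonzero_divide_eq_eq power2_eq_square mult.commute)
    finally have "q (\<lambda>x. c * f x) = norm (L f)"
      by (metis L_def Re_complex_of_real complex.sel(1))
    then show ?thesis using q_le[OF mult[OF f], of c] hom[OF f, of c] c1 by simp
  qed
  have "L g = of_real (N g)"
  proof -
    have "Re (L g) = N g" by (simp add: L_def qg)
    moreover have "norm (L g) \<le> N g" by (rule bound[OF g])
    ultimately have "Im (L g) = 0"
      using cmod_power2[of "L g"] complex_Re_le_cmod[of "L g"] by auto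
    then show ?thesis using \<open>Re (L g) = N g\<close> by (simp add: complex_eq_iff)
  qed
  with Ladd Lmult bound show ?thesis by (intro that[of L])
qed

section \<open>Densities of locally defined set functions\<close>

text \<open>
A set function on an ideal \<open>\<B>\<close> of measurable sets that behaves like the indefinite integral of a locally
integrable real function. The model case is \<open>B \<mapsto> Re (L \<chi>\<^sub>B)\<close> for a bounded functional \<open>L\<close>, where \<open>\<chi>\<^sub>B\<close> lies in the
block space only for sets \<open>B\<close> that finitely many cubes cover.
\<close>

locale local_charge =
  fixes M :: "'a measure" and \<B> :: "'a set set" and u :: "'a set \<Rightarrow> real" and C :: "nat \<Rightarrow> 'a set"
  assumes sigma_fin: "sigma_finite_measure M"
    and sets: "B \<in> \<B> \<Longrightarrow> B \<in> sets M"
    and subset: "B \<in> \<B> \<Longrightarrow> A \<in> sets M \<Longrightarrow> A \<subseteq> B \<Longrightarrow> A \<in> \<B>"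
    and union: "A \<in> \<B> \<Longrightarrow> B \<in> \<B> \<Longrightarrow> A \<union> B \<in> \<B>"
    and cover: "C n \<in> \<B>" "(\<Union>n. C n) = space M"
    and sums: "range D \<subseteq> \<B> \<Longrightarrow> disjoint_family D \<Longrightarrow> (\<Union>n. D n) \<in> \<B> \<Longrightarrow> (\<lambda>n. u (D n)) sums u (\<Union>n. D n)"
    and null: "B \<in> \<B> \<Longrightarrow> emeasure M B = 0 \<Longrightarrow> u B = 0"
    and bounded: "B \<in> \<B> \<Longrightarrow> \<exists>K. \<forall>A\<in>\<B>. A \<subseteq> B \<longrightarrow> \<bar>u A\<bar> \<le> K"

begin

lemma empty: "{} \<in> \<B>" "u {} = 0"
proof -
  show *: "{} \<in> \<B>" using subset[OF cover(1)] by simp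
  then show "u {} = 0" by (rule null) simp
qed

lemma additive:
  assumes "A \<in> \<B>" "B \<in> \<B>" "A \<inter> B = {}"
  shows "u (A \<union> B) = u A + u B"
proof -
  have *: "(\<Union>n. binaryset A B n) = A \<union> B" by (simp add: UN_binaryset_eq)
  have "(\<lambda>n. u (binaryset A B n)) sums u (\<Union>n. binaryset A B n)"
    using assms empty union by (intro sums) (auto simp: * range_binaryset_eq disjoint_family_on_def binaryset_def)
  moreover have "(\<lambda>n. u (binaryset A B n)) sums (u A + u B)"
    by (rule binaryset_sums) (rule empty)
  ultimately show ?thesis using * sums_unique2 by metis
qed

text \<open>
The positive variation of \<open>u\<close>. Taking the supremum over subsets from \<open>\<B>\<close> defines it on all measurable
sets; the empty subset makes it nonnegative.
\<close>

definition upper :: "'a set \<Rightarrow> ennreal" where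
  "upper A = (SUP B\<in>{B \<in> \<B>. B \<subseteq> A}. ennreal (u B))"

lemma upper_ge: "B \<in> \<B> \<Longrightarrow> B \<subseteq> A \<Longrightarrow> ennreal (u B) \<le> upper A"
  unfolding upper_def by (rule SUP_upper) simp

lemma upper_le: "(\<And>B. B \<in> \<B> \<Longrightarrow> B \<subseteq> A \<Longrightarrow> ennreal (u B) \<le> c) \<Longrightarrow> upper A \<le> c"
  unfolding upper_def by (rule SUP_least) auto

lemma upper_mono: "A \<subseteq> A' \<Longrightarrow> upper A \<le> upper A'"
  by (intro upper_le upper_ge) auto

lemma upper_superadditive:
  assumes "A \<inter> A' = {}"
  shows "upper A + upper A' \<le> upper (A \<union> A')"
proof -
  have *: "ennreal (u B) + ennreal (u B') \<le> upper (A \<union> A')"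
    if B: "B \<in> \<B>" "B \<subseteq> A" "B' \<in> \<B>" "B' \<subseteq> A'" for B B'
  proof (cases "0 \<le> u B \<and> 0 \<le> u B'")
    case True
    have "B \<inter> B' = {}" using B assms by auto
    then have "ennreal (u B) + ennreal (u B') = ennreal (u (B \<union> B'))"
      using True B by (simp add: additive)
    also have "\<dots> \<le> upper (A \<union> A')" using B by (intro upper_ge union) auto
    finally show ?thesis .
  next
    case False
    then have "ennreal (u B) = 0 \<or> ennreal (u B') = 0" by (auto simp: ennreal_neg)
    moreover have "ennreal (u B) \<le> upper (A \<union> A')" "ennreal (u B') \<le> upper (A \<union> A')"
      using B by (intro upper_ge; auto)+
    ultimately show ?thesis by auto
  qed
  have ne: "{B \<in> \<B>. B \<subseteq> X} \<noteq> {}" for X using empty by auto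
  have "upper A + ennreal (u B') \<le> upper (A \<union> A')" if "B' \<in> \<B>" "B' \<subseteq> A'" for B'
    unfolding upper_def[of A] ennreal_SUP_add_left[OF ne, symmetric]
    by (rule SUP_least) (use * that in auto)
  then have "(SUP B\<in>{B \<in> \<B>. B \<subseteq> A'}. upper A + ennreal (u B)) \<le> upper (A \<union> A')"
    by (intro SUP_least) simp
  moreover have "upper A + upper A' = (SUP B\<in>{B \<in> \<B>. B \<subseteq> A'}. upper A + ennreal (u B))"
    unfolding upper_def[of A'] by (rule ennreal_SUP_add_right[OF ne])
  ultimately show ?thesis by simp
qed

text \<open>
Superadditivity, applied to finite unions, gives one inequality; the other one holds since \<open>u\<close> of a
set \<open>B\<close> is the sum of the values of \<open>u\<close> at the pieces of \<open>B\<close>.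
\<close>

lemma countably_additive_upper: "countably_additive (sets M) upper"
proof (rule countably_additiveI)
  fix A :: "nat \<Rightarrow> 'a set"
  assume A: "range A \<subseteq> sets M" "disjoint_family A" "(\<Union>n. A n) \<in> sets M"
  have "(\<Sum>n. upper (A n)) \<le> upper (\<Union>n. A n)"
  proof (rule suminf_le_const)
    have "(\<Sum>i<n. upper (A i)) \<le> upper (\<Union>i<n. A i)" for n
    proof (induction n)
      case (Suc n)
      have *: "(\<Union>i<Suc n. A i) = (\<Union>i<n. A i) \<union> A n"
        by (auto simp: lessThan_Suc)
      have "(\<Union>i<n. A i) \<inter> A n = {}"
        using disjoint_family_onD[OF A(2), of _ n] by fastforce
      have "(\<Sum>i<n. upper (A i)) + upper (A n) \<le> upper (\<Union>i<n. A i) + upper (A n)"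
        using Suc by (rule add_right_mono)
      also have "\<dots> \<le> upper ((\<Union>i<n. A i) \<union> A n)"
        by (rule upper_superadditive) fact
      finally show ?case unfolding sum.lessThan_Suc *[symmetric] .

    qed simp
    also have "upper (\<Union>i<n. A i) \<le> upper (\<Union>n. A n)" for n
      by (rule upper_mono) auto
    finally show "(\<Sum>i<n. upper (A i)) \<le> upper (\<Union>n. A n)" for n .
  qed simp
  moreover have "upper (\<Union>n. A n) \<le> (\<Sum>n. upper (A n))"
  proof (rule upper_le)
    fix B assume B: "B \<in> \<B>" "B \<subseteq> (\<Union>n. A n)"
    have BA: "B \<inter> A n \<in> \<B>" for n
      using B A by (intro subset[OF B(1)]) (auto intro: sets)
    have eq: "(\<Union>n. B \<inter> A n) = B" using B by auto
    have "(\<lambda>n. u (B \<inter> A n)) sums u (\<Union>n. B \<inter> A n)"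
      using BA A(2) B by (intro sums) (auto simp: Int_absorb2 disjoint_family_on_def)
    then have lim: "(\<lambda>n. ennreal (\<Sum>i<n. u (B \<inter> A i))) \<longlonglongrightarrow> ennreal (u B)"
      unfolding eq sums_def by (rule tendsto_ennrealI)
    have "ennreal (\<Sum>i<n. u (B \<inter> A i)) \<le> (\<Sum>n. upper (A n))" for n
    proof -
      have "ennreal (\<Sum>i<n. u (B \<inter> A i)) \<le> ennreal (\<Sum>i<n. max 0 (u (B \<inter> A i)))"
        by (intro ennreal_leI sum_mono) simp
      also have "\<dots> = (\<Sum>i<n. ennreal (max 0 (u (B \<inter> A i))))" by simp
      also have "\<dots> \<le> (\<Sum>i<n. upper (A i))"
        using upper_ge[OF BA] by (intro sum_mono) (auto simp: max_def)
      also have "\<dots> \<le> (\<Sum>n. upper (A n))" by (rule sum_le_suminf) auto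
      finally show ?thesis .
    qed
    then show "ennreal (u B) \<le> (\<Sum>n. upper (A n))"
      by (intro LIMSEQ_le_const2[OF lim]) auto
  qed
  ultimately show "(\<Sum>n. upper (A n)) = upper (\<Union>n. A n)" by (rule antisym)
qed

definition upper_measure :: "'a measure" where
  "upper_measure = measure_of (space M) (sets M) upper"

lemma emeasure_upper: "A \<in> sets M \<Longrightarrow> emeasure upper_measure A = upper A"
proof -
  have "upper {} = 0"
    using empty by (intro antisym upper_le) auto
  then show "A \<in> sets M \<Longrightarrow> emeasure upper_measure A = upper A"
    unfolding upper_measure_def
    by (intro emeasure_measure_of_sigma sets.sigma_algebra_axioms countably_additive_upper) (auto simp: positive_def)
qed

lemma sets_upper: "sets upper_measure = sets M"
  by (simp add: upper_measure_def)

lemma upper_finite: "A \<in> \<B> \<Longrightarrow> upper A < \<infinity>"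
proof -
  assume "A \<in> \<B>"
  from bounded[OF this] obtain K where K: "\<And>B. B \<in> \<B> \<Longrightarrow> B \<subseteq> A \<Longrightarrow> \<bar>u B\<bar> \<le> K" by blast
  have "upper A \<le> ennreal K"
  proof (rule upper_le)
    fix B assume "B \<in> \<B>" "B \<subseteq> A"
    from K[OF this] show "ennreal (u B) \<le> ennreal K" by (intro ennreal_leI) simp
  qed
  then show ?thesis by (auto intro: order_le_less_trans)
qed

lemma ex_upper_density:
  obtains f where "f \<in> borel_measurable M" "\<And>A. A \<in> sets M \<Longrightarrow> (\<integral>\<^sup>+ x. f x * indicator A x \<partial>M) = upper A"
proof -
  interpret sigma_finite_measure M by (rule sigma_fin)
  have "absolutely_continuous M upper_measure"
    unfolding absolutely_continuous_def null_sets_def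
  proof (auto simp: sets_upper emeasure_upper)
    fix A assume A: "A \<in> sets M" "emeasure M A = 0"
    have "u B = 0" if "B \<in> \<B>" "B \<subseteq> A" for B
      using that A by (intro null) (auto dest: emeasure_mono[OF _ A(1)])
    then show "upper A = 0" by (intro antisym upper_le) auto
  qed
  from Radon_Nikodym[OF this sets_upper] obtain f where f: "f \<in> borel_measurable M" "density M f = upper_measure"
    by auto
  show ?thesis
  proof (rule that[OF f(1)])
    fix A assume A: "A \<in> sets M"
    then show "(\<integral>\<^sup>+ x. f x * indicator A x \<partial>M) = upper A"
      using emeasure_density[OF f(1) A] by (simp add: f(2) emeasure_upper)
  qed
qed

end

lemma local_charge_uminus:
  assumes "local_charge M \<B> u C"
  shows "local_charge M \<B> (\<lambda>A. - u A) C"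
proof -
  interpret local_charge M \<B> u C by fact
  show ?thesis
  proof (rule local_charge.intro)
    show "(\<lambda>n. - u (D n)) sums - u (\<Union>n. D n)"
      if "range D \<subseteq> \<B>" "disjoint_family D" "(\<Union>n. D n) \<in> \<B>" for D
      by (intro sums_minus sums that)
    show "A \<in> \<B>" if "B \<in> \<B>" "A \<in> sets M" "A \<subseteq> B" for A B
      by (rule subset[OF that])
    show "\<exists>K. \<forall>A\<in>\<B>. A \<subseteq> B \<longrightarrow> \<bar>- u A\<bar> \<le> K" if "B \<in> \<B>" for B
      using bounded[OF that] by simp
  qed (simp_all add: sigma_fin sets union cover null)
qed

text \<open>
The positive variation of \<open>u\<close> equals \<open>u\<close> plus the negative variation (the Jordan decomposition), so the
difference of the two Radon-Nikodym densities is a density of \<open>u\<close>. The densities are finite almost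
everywhere because the variations are finite on each set of the covering.
\<close>

lemma (in local_charge) ex_density:
  obtains f :: "'a \<Rightarrow> real" where "f \<in> borel_measurable M"
    "\<And>A. A \<in> \<B> \<Longrightarrow> integrable M (\<lambda>x. f x * indicator A x)"
    "\<And>A. A \<in> \<B> \<Longrightarrow> (\<integral>x. f x * indicator A x \<partial>M) = u A"
proof -
  interpret neg: local_charge M \<B> "\<lambda>A. - u A" C
    by (rule local_charge_uminus) (rule local_charge_axioms)
  obtain f1 where [measurable]: "f1 \<in> borel_measurable M"
    and f1: "\<And>A. A \<in> sets M \<Longrightarrow> (\<integral>\<^sup>+ x. f1 x * indicator A x \<partial>M) = upper A"
    by (rule ex_upper_density) blast
  obtain f2 where [measurable]: "f2 \<in> borel_measurable M"
    and f2: "\<And>A. A \<in> sets M \<Longrightarrow> (\<integral>\<^sup>+ x. f2 x * indicator A x \<partial>M) = neg.upper A"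
    by (rule neg.ex_upper_density) blast
  have Jordan: "ennreal (u A + enn2real (neg.upper A)) = upper A" "0 \<le> u A + enn2real (neg.upper A)"
    if A: "A \<in> \<B>" for A
  proof -
    have fin: "neg.upper A < \<infinity>" by (rule neg.upper_finite[OF A])
    \<comment> \<open>Taking complements in \<open>A\<close> exchanges the suprema of \<open>u\<close> and of \<open>- u\<close> up to the constant \<open>u A\<close>.\<close>
    have diff: "u (A - B) = u A - u B" "A - B \<in> \<B>" if "B \<in> \<B>" "B \<subseteq> A" for B
    proof -
      show AB: "A - B \<in> \<B>" using that A by (intro subset[OF A]) (auto intro: sets)
      have "u (B \<union> (A - B)) = u B + u (A - B)" using that AB by (intro additive) auto
      moreover have "B \<union> (A - B) = A" using that by auto
      ultimately show "u (A - B) = u A - u B" by simp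
    qed
    have neg_ge: "- u B \<le> enn2real (neg.upper A)" if "B \<in> \<B>" "B \<subseteq> A" for B
    proof -
      have "enn2real (ennreal (- u B)) \<le> enn2real (neg.upper A)"
        using neg.upper_ge[OF that] fin by (intro enn2real_mono) auto
      then show ?thesis by (cases "0 \<le> - u B") (auto intro: order_trans[OF _ enn2real_nonneg])
    qed
    show nn: "0 \<le> u A + enn2real (neg.upper A)" using neg_ge[OF A] by simp
    have "upper A \<le> ennreal (u A + enn2real (neg.upper A))"
    proof (rule upper_le)
      fix B assume B: "B \<in> \<B>" "B \<subseteq> A"
      have "- u (A - B) \<le> enn2real (neg.upper A)"
        using diff[OF B] by (intro neg_ge) auto
      then show "ennreal (u B) \<le> ennreal (u A + enn2real (neg.upper A))"
        using diff[OF B] by (intro ennreal_leI) simp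
    qed
    moreover have "ennreal (u A + enn2real (neg.upper A)) \<le> upper A"
    proof -
      have ufin: "upper A < \<infinity>" by (rule upper_finite[OF A])
      have ge: "u B \<le> enn2real (upper A)" if "B \<in> \<B>" "B \<subseteq> A" for B
      proof -
        have "enn2real (ennreal (u B)) \<le> enn2real (upper A)"
          using upper_ge[OF that] ufin by (intro enn2real_mono) auto
        then show ?thesis by (cases "0 \<le> u B") (auto intro: order_trans[OF _ enn2real_nonneg])
      qed
      have "neg.upper A \<le> ennreal (enn2real (upper A) - u A)"
      proof (rule neg.upper_le)
        fix B assume B: "B \<in> \<B>" "B \<subseteq> A"
        have "u (A - B) \<le> enn2real (upper A)" using diff[OF B] by (intro ge) auto
        then show "ennreal (- u B) \<le> ennreal (enn2real (upper A) - u A)"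
          using diff[OF B] by (intro ennreal_leI) simp
      qed
      moreover have "0 \<le> enn2real (upper A) - u A" using ge[OF A] by simp
      ultimately have "enn2real (neg.upper A) \<le> enn2real (upper A) - u A"
        by (metis enn2real_ennreal enn2real_mono ennreal_less_top)
      then have "ennreal (u A + enn2real (neg.upper A)) \<le> ennreal (enn2real (upper A))"
        by (intro ennreal_leI) simp
      also have "ennreal (enn2real (upper A)) = upper A"
        using ufin by simp
      finally show ?thesis .
    qed
    ultimately show "ennreal (u A + enn2real (neg.upper A)) = upper A" by (rule antisym[symmetric])
  qed
  have fin: "AE x in M. h x < \<infinity>"
    if [measurable]: "h \<in> borel_measurable M" and h: "\<And>A. A \<in> \<B> \<Longrightarrow> (\<integral>\<^sup>+ x. h x * indicator A x \<partial>M) < \<infinity>" for h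
  proof -
    have "AE x in M. h x * indicator (C n) x \<noteq> \<infinity>" for n
      using h[OF cover(1)[of n]] sets[OF cover(1)[of n]] by (intro nn_integral_noteq_infinite) auto
    then have "AE x in M. \<forall>n. h x * indicator (C n) x \<noteq> \<infinity>" by (simp add: AE_all_countable)
    then show ?thesis
    proof (rule AE_mp, intro AE_I2 impI)
      fix x assume "x \<in> space M" and *: "\<forall>n. h x * indicator (C n) x \<noteq> \<infinity>"
      then obtain n where "x \<in> C n" using cover(2) by auto
      then show "h x < \<infinity>" using *[rule_format, of n] by (simp add: less_top)
    qed
  qed
  have int: "integrable M (\<lambda>x. enn2real (h x) * indicator A x)"
    "(\<integral>x. enn2real (h x) * indicator A x \<partial>M) = enn2real (\<integral>\<^sup>+ x. h x * indicator A x \<partial>M)"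
    if [measurable]: "h \<in> borel_measurable M" and h: "\<And>A. A \<in> \<B> \<Longrightarrow> (\<integral>\<^sup>+ x. h x * indicator A x \<partial>M) < \<infinity>"
      and A: "A \<in> \<B>" for h A
  proof -
    have [measurable]: "A \<in> sets M" using A by (rule sets)
    have eq: "(\<integral>\<^sup>+ x. ennreal (enn2real (h x) * indicator A x) \<partial>M) = (\<integral>\<^sup>+ x. h x * indicator A x \<partial>M)"
      using fin[of h] h
      by (intro nn_integral_cong_AE) (auto elim!: eventually_mono simp: indicator_def less_top)
    show "integrable M (\<lambda>x. enn2real (h x) * indicator A x)"
      using h[OF A] eq by (intro integrableI_nonneg) auto
    show "(\<integral>x. enn2real (h x) * indicator A x \<partial>M) = enn2real (\<integral>\<^sup>+ x. h x * indicator A x \<partial>M)"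
      by (subst integral_eq_nn_integral) (auto simp: eq)
  qed
  have f1fin: "(\<integral>\<^sup>+ x. f1 x * indicator A x \<partial>M) < \<infinity>" if "A \<in> \<B>" for A
    using upper_finite[OF that] f1[OF sets[OF that]] by simp
  have f2fin: "(\<integral>\<^sup>+ x. f2 x * indicator A x \<partial>M) < \<infinity>" if "A \<in> \<B>" for A
    using neg.upper_finite[OF that] f2[OF sets[OF that]] by simp
  show ?thesis
  proof (rule that[of "\<lambda>x. enn2real (f1 x) - enn2real (f2 x)"])
    fix A assume A: "A \<in> \<B>"
    show "integrable M (\<lambda>x. (enn2real (f1 x) - enn2real (f2 x)) * indicator A x)"
      unfolding left_diff_distrib using A f1fin f2fin by (intro Bochner_Integration.integrable_diff int) auto
    have "(\<integral>x. (enn2real (f1 x) - enn2real (f2 x)) * indicator A x \<partial>M) = enn2real (upper A) - enn2real (neg.upper A)"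
      unfolding left_diff_distrib using A f1fin f2fin
      by (subst Bochner_Integration.integral_diff) (auto simp: int f1 f2 sets)
    also have "enn2real (upper A) = u A + enn2real (neg.upper A)"
      using Jordan[OF A] by (metis enn2real_ennreal)
    finally show "(\<integral>x. (enn2real (f1 x) - enn2real (f2 x)) * indicator A x \<partial>M) = u A" by simp
  qed simp
qed

section \<open>Dyadic cubes\<close>

text \<open>
The pairs \<open>(j, m)\<close> serve as index set for cubes as well as for the coefficients of block series.
\<close>

definition cube :: "int \<times> (int, 'n) vec \<Rightarrow> (real, 'n::finite) vec set" where
  "cube i = dyadic_cube (fst i) (snd i)"

definition corner :: "int \<times> (int, 'n) vec \<Rightarrow> (real, 'n::finite) vec" where
  "corner i = (\<chi> k. 2 powi (- fst i) * of_int (snd i $ k))"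

definition side :: "int \<times> (int, 'n) vec \<Rightarrow> real" where
  "side i = 2 powi (- fst i)"

lemma side_pos: "0 < side i"
  unfolding side_def by (rule zero_less_power_int) simp

lemma mem_cube: "x \<in> cube i \<longleftrightarrow> (\<forall>k. corner i $ k \<le> x $ k \<and> x $ k < corner i $ k + side i)"
  by (simp add: cube_def dyadic_cube_def corner_def side_def distrib_left)

lemma cube_borel [measurable]: "cube i \<in> sets borel"
proof -
  have "cube i = (\<Inter>k. {x. corner i $ k \<le> x $ k \<and> x $ k < corner i $ k + side i})"
    by (auto simp: mem_cube)
  also have "\<dots> \<in> sets borel"
    by (intro sets.finite_INT) auto
  finally show ?thesis .
qed

lemma cube_lebesgue [measurable]: "cube i \<in> sets lebesgue"
  by (simp add: cube_borel)

lemma cube_bounded: "bounded (cube i)"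
proof (rule bounded_subset[OF bounded_cbox])
  show "cube i \<subseteq> cbox (corner i) (\<chi> k. corner i $ k + side i)"
    by (auto simp: mem_cube mem_box_cart less_imp_le)
qed

lemma measure_cube_pos: "0 < measure lebesgue (cube i)"
proof -
  let ?B = "box (corner i) (\<chi> k. corner i $ k + side i)"
  have "?B \<subseteq> cube i"
    by (auto simp: mem_cube mem_box_cart less_imp_le)
  moreover have "(\<chi> k. corner i $ k + side i / 2) \<in> ?B"
    using side_pos[of i] by (auto simp: mem_box_cart)
  then have "\<not> negligible ?B"
    by (intro open_not_negligible) auto
  ultimately have "\<not> negligible (cube i)"
    using negligible_subset by blast
  moreover have "cube i \<in> lmeasurable"
    by (intro bounded_set_imp_lmeasurable cube_bounded cube_lebesgue)
  ultimately show ?thesis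
    by (metis negligible_iff_measure measure_nonneg less_eq_real_def)
qed

text \<open>
The Bourgain-Morrey norm is a sum over the set of cubes, the norm of a coefficient sequence is a sum over
indices; injectivity allows to pass from one to the other. The corner of a cube is its smallest
point, and the side length determines \<open>j\<close>.
\<close>

lemma cube_inj: "inj cube"
proof
  fix i i' :: "int \<times> (int, 'n::finite) vec"
  assume eq: "cube i = cube i'"
  have corner: "corner i \<in> cube i" for i :: "int \<times> (int, 'n) vec"
    using side_pos[of i] by (auto simp: mem_cube)
  have "corner i \<in> cube i'" "corner i' \<in> cube i"
    using corner[of i] corner[of i'] by (simp_all only: eq)
  then have c: "corner i = corner i'" by (auto simp: mem_cube vec_eq_iff intro: antisym)
  \<comment> \<open>If the first cube had the larger side, it would contain the opposite corner of the second cube, which the second cube does not contain.\<close>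
  have le: "side i \<le> side i'"
    if "cube i = cube i'" "corner i = corner i'" for i i' :: "int \<times> (int, 'n) vec"
  proof (rule ccontr)
    assume *: "\<not> side i \<le> side i'"
    have "corner i + (\<chi> k. side i') \<in> cube i"
      unfolding mem_cube using * side_pos[of i'] by auto
    then have "corner i' + (\<chi> k. side i') \<in> cube i'"
      using that by simp
    then show False unfolding mem_cube by auto
  qed
  have side: "side i = side i'"
    using le[OF eq c] le[OF eq[symmetric] c[symmetric]] by (rule antisym)
  then have j: "fst i = fst i'"
    using power_int_strict_increasing[of "- fst i" "- fst i'" "2::real"]
      power_int_strict_increasing[of "- fst i'" "- fst i" "2::real"]
    by (cases "fst i" "fst i'" rule: linorder_cases) (auto simp: side_def)
  have "snd i $ k = snd i' $ k" for k
    using arg_cong[OF c, of "\<lambda>v. v $ k"] side_pos[of i'] by (simp add: corner_def side_def j)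
  then have "snd i = snd i'" by (simp add: vec_eq_iff)
  with j show "i = i'" by (rule prod_eqI)
qed

lemma range_cube: "range cube = dyadic_cubes"
  by (force simp: cube_def dyadic_cubes_def image_def)

lemma cubes_cover: "(\<Union>m. cube (0, m)) = UNIV"
proof -
  have "x \<in> cube (0, \<chi> k. \<lfloor>x $ k\<rfloor>)" for x :: "(real, 'n::finite) vec"
    by (auto simp: cube_def dyadic_cube_def)
  then show ?thesis by auto
qed

lemma sigma_finite_lebesgue: "sigma_finite_measure (lebesgue :: 'a::euclidean_space measure)"
proof
  show "\<exists>A. countable A \<and> A \<subseteq> sets lebesgue \<and> \<Union>A = space lebesgue \<and> (\<forall>a\<in>A. emeasure (lebesgue :: 'a measure) a \<noteq> \<infinity>)"
  proof (intro exI[of _ "range (\<lambda>n::nat. cball 0 (real n))"] conjI ballI)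
    show "\<Union> (range (\<lambda>n::nat. cball (0::'a) (real n))) = space lebesgue"
      using real_arch_simple by auto
    fix a :: "'a set" assume "a \<in> range (\<lambda>n::nat. cball 0 (real n))"
    then obtain n :: nat where "a = cball 0 (real n)" by auto
    then show "emeasure lebesgue a \<noteq> \<infinity>"
      using emeasure_lborel_cball_finite[of "0 :: 'a" "real n"] by simp
  qed auto
qed

section \<open>The seminormed space of block series\<close>

text \<open>
The hypotheses under which the block norm is a seminorm and the duality argument works: \<open>1 < p\<^sub>i < \<infinity>\<close>
makes all exponents of the mixed norms and their conjugates finite, and \<open>1 < r\<close> makes \<open>r'\<close> finite.
\<close>

locale block_setting =
  fixes p :: "'n::{finite,linorder} \<Rightarrow> ennreal" and t r :: ennreal
  assumes p: "\<And>i. 1 < p i \<and> p i < \<infinity>" and r: "1 < r"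

begin

abbreviation "V \<equiv> block_space p t r"

abbreviation "N \<equiv> block_norm p t r"

abbreviation "coeff_norm \<equiv> seq_norm (conj_exp r)"

abbreviation dual_exps :: "'n \<Rightarrow> ennreal" where "dual_exps \<equiv> \<lambda>i. conj_exp (p i)"

lemmas p_exp = conj_exp_enn2real[OF conjunct1[OF p] conjunct2[OF p]]

lemma fin_exp_conj_r: "fin_exp (conj_exp r)"
proof (cases "r = \<infinity>")
  case True
  then show ?thesis by (simp add: conj_exp_def)
next
  case False
  then show ?thesis using r by (intro conj_exp_enn2real) (auto simp: less_top)
qed

text \<open>
The bound in the definition of a block on the cube with index \<open>i\<close>, and at the same time the factor of
\<open>\<parallel>f \<chi>\<^sub>Q\<parallel>\<close> in the Bourgain-Morrey norm.
\<close>

definition weight :: "int \<times> 'n ivec \<Rightarrow> real" where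
  "weight i = measure lebesgue (cube i) powr scale_exp p t"

lemma weight_pos: "0 < weight i"
  using measure_cube_pos[of i] by (simp add: weight_def)

definition cube_bounded_fun :: "int \<times> 'n ivec \<Rightarrow> ('n rvec \<Rightarrow> complex) \<Rightarrow> bool" where
  "cube_bounded_fun i g \<longleftrightarrow> g \<in> borel_measurable lebesgue \<and> (\<forall>x. x \<notin> cube i \<longrightarrow> g x = 0) \<and> (\<exists>c. \<forall>x. norm (g x) \<le> c)"

lemma block_cube:
  "block p t (cube i) b \<longleftrightarrow> b \<in> borel_measurable lebesgue \<and> (AE x in lebesgue. x \<notin> cube i \<longrightarrow> b x = 0) \<and>
     mixed_norm dual_exps b \<le> ennreal (weight i)"
  by (simp add: block_def weight_def)

lemma block_rep_iff:
  "block_rep p t r g l b \<longleftrightarrow> coeff_norm l < \<infinity> \<and> (\<forall>i. block p t (cube i) (b i)) \<and>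
     (AE x in lebesgue. ((\<lambda>i. l i * b i x) has_sum g x) UNIV)"
  by (simp add: block_rep_def cube_def)

lemma block_repD:
  assumes "block_rep p t r g l b"
  shows "coeff_norm l < \<infinity>" "block p t (cube i) (b i)"
    "AE x in lebesgue. ((\<lambda>i. l i * b i x) has_sum g x) UNIV"
  using assms unfolding block_rep_iff by blast+

lemma block_norm_le: "block_rep p t r g l b \<Longrightarrow> N g \<le> coeff_norm l"
  unfolding block_norm_def by (rule Inf_lower) auto

lemma block_norm_less: "N g < c \<Longrightarrow> \<exists>l b. block_rep p t r g l b \<and> coeff_norm l < c"
  unfolding block_norm_def Inf_less_iff by auto

lemma block_space_iff: "g \<in> V \<longleftrightarrow> g \<in> borel_measurable lebesgue \<and> N g < \<infinity>"
proof
  assume "g \<in> V"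
  then show "g \<in> borel_measurable lebesgue \<and> N g < \<infinity>"
    unfolding block_space_def
    using order_le_less_trans[OF block_norm_le block_repD(1)] by blast
next
  assume "g \<in> borel_measurable lebesgue \<and> N g < \<infinity>"
  then show "g \<in> V" using block_norm_less[of g \<infinity>] by (auto simp: block_space_def)
qed

lemma seq_norm_cmult: "coeff_norm (\<lambda>i. c * l i) = ennreal (norm c) * coeff_norm l"
  unfolding seq_norm_def by (simp add: norm_mult ennreal_mult lp_norm_cmult fin_exp_conj_r)

lemma block_rep_cmult:
  assumes "block_rep p t r g l b"
  shows "block_rep p t r (\<lambda>x. c * g x) (\<lambda>i. c * l i) b"
  using assms unfolding block_rep_iff seq_norm_cmult
  by (auto simp: ennreal_mult_less_top mult.assoc elim!: eventually_mono intro: has_sum_cmult_right)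

lemma block_norm_0: "N (\<lambda>x. 0) = 0"
proof -
  have "block_rep p t r (\<lambda>x. 0) (\<lambda>i. 0) (\<lambda>i x. 0)"
    by (simp add: block_rep_iff block_cube seq_norm_def fin_exp_conj_r mixed_norm_eq_enorm mixed_enorm_zero p_exp)
  from block_norm_le[OF this] show ?thesis
    by (simp add: seq_norm_def fin_exp_conj_r)
qed

lemma block_norm_cmult: "N (\<lambda>x. c * g x) = ennreal (norm c) * N g" if c: "c \<noteq> 0"
proof -
  have inv: "ennreal (1 / norm c) * (ennreal (norm c) * y) = y" "ennreal (norm c) * (ennreal (1 / norm c) * y) = y"
    if "c \<noteq> 0" for c :: complex and y
    using that by (simp_all add: mult.assoc[symmetric] ennreal_mult[symmetric])
  have le: "ennreal (1 / norm c) * N (\<lambda>x. c * g x) \<le> N g" if c: "c \<noteq> 0" for c g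
    unfolding block_norm_def[of p t r g]
  proof (rule Inf_greatest, clarify)
    fix l b assume "block_rep p t r g l b"
    from block_norm_le[OF block_rep_cmult[OF this, of c]]
    have "N (\<lambda>x. c * g x) \<le> ennreal (norm c) * coeff_norm l"
      by (simp add: seq_norm_cmult)
    from mult_left_mono[OF this, of "ennreal (1 / norm c)"]
    show "ennreal (1 / norm c) * N (\<lambda>x. c * g x) \<le> coeff_norm l"
      by (simp only: inv[OF c]) simp
  qed
  have "ennreal (norm c) * N g \<le> N (\<lambda>x. c * g x)"
    using le[of "1 / c" "\<lambda>x. c * g x"] c by (simp add: norm_divide)
  moreover have "N (\<lambda>x. c * g x) \<le> ennreal (norm c) * N g"
    using mult_left_mono[OF le[OF c, of g], of "ennreal (norm c)"] by (simp only: inv[OF c]) simp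
  ultimately show ?thesis by simp
qed

lemma seq_norm_add_le:
  "coeff_norm (\<lambda>i. complex_of_real (norm (l i) + norm (l' i))) \<le> coeff_norm l + coeff_norm l'"
proof -
  have "coeff_norm (\<lambda>i. complex_of_real (norm (l i) + norm (l' i))) =
      lp_norm (count_space UNIV) (conj_exp r) (\<lambda>i. ennreal (norm (l i)) + ennreal (norm (l' i)))"
    unfolding seq_norm_def norm_of_real by (simp add: ennreal_plus[symmetric] del: ennreal_plus)
  also have "\<dots> \<le> coeff_norm l + coeff_norm l'"
    unfolding seq_norm_def by (intro lp_norm_triangle fin_exp_conj_r) auto
  finally show ?thesis .
qed

text \<open>
The series are added term by term. On each cube \<open>l b + l' b'\<close> is \<open>\<bar>l\<bar> + \<bar>l'\<bar>\<close> times a combination of the two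
blocks whose coefficients have absolute values summing to one, and such a combination is a block.
\<close>

lemma block_rep_add:
  assumes g: "block_rep p t r g l b" and h: "block_rep p t r h l' b'"
  shows "\<exists>b''. block_rep p t r (\<lambda>x. g x + h x) (\<lambda>i. of_real (norm (l i) + norm (l' i))) b''"
proof -
  let ?m = "\<lambda>i. norm (l i) + norm (l' i)"
  \<comment> \<open>Where both coefficients vanish, division by zero makes the merged block zero.\<close>
  define b'' where "b'' i x = (l i * b i x + l' i * b' i x) / of_real (?m i)" for i x
  have bl: "block p t (cube i) (b i)" "block p t (cube i) (b' i)" for i
    by (rule block_repD[OF g], rule block_repD[OF h])
  have meas [measurable]: "b i \<in> borel_measurable lebesgue" "b' i \<in> borel_measurable lebesgue" for i
    using bl by (auto simp: block_cube)
  have "block p t (cube i) (b'' i)" for i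
    unfolding block_cube
  proof (intro conjI)
    show "b'' i \<in> borel_measurable lebesgue" unfolding b''_def by measurable
    have "AE x in lebesgue. x \<notin> cube i \<longrightarrow> b i x = 0" "AE x in lebesgue. x \<notin> cube i \<longrightarrow> b' i x = 0"
      using bl[of i] by (auto simp: block_cube)
    then show "AE x in lebesgue. x \<notin> cube i \<longrightarrow> b'' i x = 0"
      by eventually_elim (auto simp: b''_def)
    show "mixed_norm dual_exps (b'' i) \<le> ennreal (weight i)"
    proof (cases "?m i = 0")
      case True
      then have "b'' i = (\<lambda>x. 0)" by (auto simp: b''_def)
      then show ?thesis using bl[of i] by (simp add: mixed_norm_eq_enorm mixed_enorm_zero p_exp)
    next
      case False
      then have m: "0 < ?m i" by (smt (verit) norm_ge_zero)
      let ?\<alpha> = "norm (l i) / ?m i" and ?\<beta> = "norm (l' i) / ?m i"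
      have "norm (b'' i x) \<le> ?\<alpha> * norm (b i x) + ?\<beta> * norm (b' i x)" for x
      proof -
        have "norm (b'' i x) = norm (l i * b i x + l' i * b' i x) / ?m i"
          using m by (simp add: b''_def norm_divide del: of_real_add)
        also have "\<dots> \<le> (norm (l i) * norm (b i x) + norm (l' i) * norm (b' i x)) / ?m i"
          using m by (intro divide_right_mono norm_triangle_le) (auto simp: norm_mult)
        finally show ?thesis by (simp add: add_divide_distrib)
      qed
      then have "ennreal (norm (b'' i x)) \<le> ennreal ?\<alpha> * ennreal (norm (b i x)) + ennreal ?\<beta> * ennreal (norm (b' i x))" for x
        using m by (subst (1 2) ennreal_mult[symmetric], simp_all, subst ennreal_plus[symmetric])
          (auto intro!: ennreal_leI simp del: ennreal_plus)
      then have "mixed_norm dual_exps (b'' i) \<le>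
          mixed_enorm dual_exps (\<lambda>x. ennreal ?\<alpha> * ennreal (norm (b i x)) + ennreal ?\<beta> * ennreal (norm (b' i x)))"
        unfolding mixed_norm_eq_enorm by (intro mixed_enorm_mono_AE p_exp AE_I2)
      also have "\<dots> \<le> mixed_enorm dual_exps (\<lambda>x. ennreal ?\<alpha> * ennreal (norm (b i x))) +
          mixed_enorm dual_exps (\<lambda>x. ennreal ?\<beta> * ennreal (norm (b' i x)))"
        by (intro mixed_enorm_triangle p_exp) auto
      also have "\<dots> = ennreal ?\<alpha> * mixed_norm dual_exps (b i) + ennreal ?\<beta> * mixed_norm dual_exps (b' i)"
        unfolding mixed_norm_eq_enorm by (subst (1 2) mixed_enorm_cmult) (auto simp: p_exp)
      also have "\<dots> \<le> ennreal ?\<alpha> * ennreal (weight i) + ennreal ?\<beta> * ennreal (weight i)"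
        using bl[of i] by (intro add_mono mult_left_mono) (auto simp: block_cube)
      also have "\<dots> = ennreal (?\<alpha> + ?\<beta>) * ennreal (weight i)"
        using m by (subst ennreal_plus) (auto simp: distrib_right)
      also have "?\<alpha> + ?\<beta> = 1" using m by (simp add: add_divide_distrib[symmetric])
      finally show ?thesis by simp
    qed
  qed
  moreover have "coeff_norm (\<lambda>i. complex_of_real (?m i)) < \<infinity>"
    using block_repD(1)[OF g] block_repD(1)[OF h] seq_norm_add_le[of l l']
    by (auto intro: order_le_less_trans)
  moreover have "AE x in lebesgue. ((\<lambda>i. complex_of_real (?m i) * b'' i x) has_sum (g x + h x)) UNIV"
  proof -
    have eq: "complex_of_real (?m i) * b'' i x = l i * b i x + l' i * b' i x" for i x
    proof (cases "?m i = 0")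
      case True
      then have "l i = 0" "l' i = 0" by (smt (verit) norm_ge_zero norm_eq_zero)+
      then show ?thesis by simp
    next
      case False
      then have "complex_of_real (?m i) \<noteq> 0" using of_real_eq_0_iff by blast
      then show ?thesis by (simp add: b''_def del: of_real_add)
    qed
    have "AE x in lebesgue. ((\<lambda>i. l i * b i x) has_sum g x) UNIV" "AE x in lebesgue. ((\<lambda>i. l' i * b' i x) has_sum h x) UNIV"
      by (rule block_repD[OF g], rule block_repD[OF h])
    then show ?thesis unfolding eq
      by eventually_elim (rule has_sum_add)
  qed
  ultimately show ?thesis unfolding block_rep_iff by blast
qed

lemma block_norm_triangle: "N (\<lambda>x. g x + h x) \<le> N g + N h"
proof (cases "N g = \<infinity> \<or> N h = \<infinity>")
  case False
  show ?thesis
  proof (rule ennreal_le_epsilon)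
    fix \<epsilon> :: real assume "0 < \<epsilon>"
    have less: "N f < N f + ennreal (\<epsilon> / 2)" if "N f \<noteq> \<infinity>" for f
      using that \<open>0 < \<epsilon>\<close> by (cases "N f") (auto simp: ennreal_plus[symmetric] ennreal_less_iff simp del: ennreal_plus)
    from block_norm_less[OF less[of g]] False obtain l b where
      1: "block_rep p t r g l b" "coeff_norm l < N g + ennreal (\<epsilon> / 2)" by auto
    from block_norm_less[OF less[of h]] False obtain l' b' where
      2: "block_rep p t r h l' b'" "coeff_norm l' < N h + ennreal (\<epsilon> / 2)" by auto
    obtain b'' where "block_rep p t r (\<lambda>x. g x + h x) (\<lambda>i. of_real (norm (l i) + norm (l' i))) b''"
      using block_rep_add[OF 1(1) 2(1)] by blast
    from order_trans[OF block_norm_le[OF this] seq_norm_add_le]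
    have "N (\<lambda>x. g x + h x) \<le> coeff_norm l + coeff_norm l'" .
    also have "\<dots> \<le> (N g + ennreal (\<epsilon> / 2)) + (N h + ennreal (\<epsilon> / 2))"
      using 1(2) 2(2) by (intro add_mono) auto
    also have "\<dots> = N g + N h + (ennreal (\<epsilon> / 2) + ennreal (\<epsilon> / 2))" by (simp add: ac_simps)
    also have "ennreal (\<epsilon> / 2) + ennreal (\<epsilon> / 2) = ennreal \<epsilon>"
      using \<open>0 < \<epsilon>\<close> by (simp add: ennreal_plus[symmetric] del: ennreal_plus)
    finally show "N (\<lambda>x. g x + h x) \<le> N g + N h + ennreal \<epsilon>" .
  qed
qed auto

lemma block_norm_cong_AE:
  assumes "AE x in lebesgue. g x = h x"
  shows "N g = N h"
proof -
  have "(AE x in lebesgue. ((\<lambda>i. l i * b i x) has_sum g x) UNIV) \<longleftrightarrow>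
      (AE x in lebesgue. ((\<lambda>i. l i * b i x) has_sum h x) UNIV)" for l and b :: "int \<times> 'n ivec \<Rightarrow> 'n rvec \<Rightarrow> complex"
    by (rule eventually_cong[OF assms]) simp
  then have "block_rep p t r g l b = block_rep p t r h l b" for l b
    unfolding block_rep_iff by (simp only:)
  then have "block_rep p t r g = block_rep p t r h" by blast
  then show ?thesis unfolding block_norm_def by simp
qed

lemma block_space_subspace: "fun_subspace V"
  unfolding fun_subspace_def
proof (intro conjI ballI allI)
  show "(\<lambda>x. 0) \<in> V" by (simp add: block_space_iff block_norm_0)
  show "(\<lambda>x. g x + h x) \<in> V" if "g \<in> V" "h \<in> V" for g h
    using that block_norm_triangle[of g h] by (auto simp: block_space_iff intro: order_le_less_trans)
  show "(\<lambda>x. c * g x) \<in> V" if "g \<in> V" for c g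
  proof (cases "c = 0")
    case True
    then show ?thesis by (simp add: block_space_iff block_norm_0)
  next
    case False
    then show ?thesis using that by (auto simp: block_space_iff block_norm_cmult ennreal_mult_less_top)
  qed
qed

text \<open>
A function supported in one cube is a series with one term.
\<close>

lemma block_norm_le_single:
  assumes g: "g \<in> borel_measurable lebesgue" "AE x in lebesgue. x \<notin> cube i \<longrightarrow> g x = 0"
    and le: "mixed_norm dual_exps g \<le> ennreal (c * weight i)" and c: "0 < c"
  shows "N g \<le> ennreal c"
proof -
  note [measurable] = g(1)
  let ?l = "\<lambda>k. if k = i then complex_of_real c else 0"
  let ?b = "\<lambda>k x. if k = i then g x / of_real c else 0"
  have l: "coeff_norm ?l = ennreal c"
  proof -
    have "coeff_norm ?l = epow (\<integral>\<^sup>+ k. (if k = i then epow (ennreal c) (enn2real (conj_exp r)) else 0) \<partial>count_space UNIV) (1 / enn2real (conj_exp r))"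
      unfolding seq_norm_def lp_norm_eq[OF fin_exp_conj_r]
      by (intro arg_cong2[where f = epow] nn_integral_cong) (use c in auto)
    then show ?thesis
      using fin_expD(1)[OF fin_exp_conj_r] by (simp add: nn_integral_count_space_single epow_inverse)
  qed
  have "mixed_norm dual_exps (\<lambda>x. g x / of_real c) \<le> ennreal (weight i)"
  proof -
    have "mixed_norm dual_exps (\<lambda>x. g x / of_real c) = mixed_enorm dual_exps (\<lambda>x. ennreal (1 / c) * ennreal (norm (g x)))"
      unfolding mixed_norm_eq_enorm using c by (simp add: norm_divide ennreal_mult[symmetric])
    also have "\<dots> = ennreal (1 / c) * mixed_norm dual_exps g"
      unfolding mixed_norm_eq_enorm by (rule mixed_enorm_cmult) (auto simp: p_exp)
    also have "\<dots> \<le> ennreal (1 / c) * ennreal (c * weight i)"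
      by (intro mult_left_mono le) simp
    also have "\<dots> = ennreal (weight i)"
      using c by (simp add: ennreal_mult[symmetric] weight_pos less_imp_le)
    finally show ?thesis .
  qed
  then have "block p t (cube k) (?b k)" for k
    using g(2) by (cases "k = i") (auto simp: block_cube mixed_norm_eq_enorm mixed_enorm_zero p_exp)
  moreover have "((\<lambda>k. ?l k * ?b k x) has_sum g x) UNIV" for x
  proof -
    have "((\<lambda>k. ?l k * ?b k x) has_sum (\<Sum>k\<in>{i}. ?l k * ?b k x)) {i}" by (rule has_sum_finite) simp
    also have "(\<Sum>k\<in>{i}. ?l k * ?b k x) = g x" using c by simp
    finally show ?thesis
      by (subst has_sum_cong_neutral[of "{i}" _ _ "\<lambda>k. ?l k * ?b k x"]) auto
  qed
  ultimately have "block_rep p t r g ?l ?b"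
    unfolding block_rep_iff l by auto
  from block_norm_le[OF this] show ?thesis by (simp only: l)
qed

lemma block_norm_le_mixed_norm:
  assumes "g \<in> borel_measurable lebesgue" "AE x in lebesgue. x \<notin> cube i \<longrightarrow> g x = 0"
  shows "N g \<le> ennreal (1 / weight i) * mixed_norm dual_exps g"
proof (cases "mixed_norm dual_exps g")
  case (real A)
  show ?thesis
  proof (rule ennreal_le_epsilon)
    fix \<epsilon> :: real assume "0 < \<epsilon>"
    have "N g \<le> ennreal (A / weight i + \<epsilon>)"
      using real \<open>0 < \<epsilon>\<close> weight_pos[of i]
      by (intro block_norm_le_single[OF assms]) (auto simp: distrib_right add_nonneg_pos)
    also have "\<dots> = ennreal (1 / weight i) * mixed_norm dual_exps g + ennreal \<epsilon>"
      using real \<open>0 < \<epsilon>\<close> weight_pos[of i] by (simp add: ennreal_mult[symmetric])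
    finally show "N g \<le> ennreal (1 / weight i) * mixed_norm dual_exps g + ennreal \<epsilon>" .
  qed
next
  case top
  then show ?thesis using weight_pos[of i] by (simp add: ennreal_mult_top)
qed

text \<open>
The pieces of \<open>g\<close> on the single cubes are removed one after the other; since the cubes may overlap, a
later piece may be smaller than the restriction of \<open>g\<close> to its cube.
\<close>

lemma block_norm_le_sum:
  assumes "finite S" "g \<in> borel_measurable lebesgue" "\<And>x. x \<notin> (\<Union>i\<in>S. cube i) \<Longrightarrow> g x = 0"
  shows "N g \<le> (\<Sum>i\<in>S. ennreal (1 / weight i) * mixed_norm dual_exps (\<lambda>x. g x * indicator (cube i) x))"
  using assms
proof (induction S arbitrary: g)
  case empty
  then have "g = (\<lambda>x. 0)" by auto
  then show ?case by (simp add: block_norm_0)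
next
  case (insert i S)
  note [measurable] = insert.prems(1)
  let ?g1 = "\<lambda>x. g x * indicator (cube i) x" and ?g2 = "\<lambda>x. g x * indicator (- cube i) x"
  have [measurable]: "- cube i \<in> sets lebesgue" using cube_lebesgue[of i] by auto
  have "N g = N (\<lambda>x. ?g1 x + ?g2 x)"
    by (rule arg_cong[where f = N]) (auto simp: indicator_def fun_eq_iff)
  also have "\<dots> \<le> N ?g1 + N ?g2" by (rule block_norm_triangle)
  also have "N ?g1 \<le> ennreal (1 / weight i) * mixed_norm dual_exps ?g1"
    by (intro block_norm_le_mixed_norm) auto
  also have "N ?g2 \<le> (\<Sum>k\<in>S. ennreal (1 / weight k) * mixed_norm dual_exps (\<lambda>x. ?g2 x * indicator (cube k) x))"
    by (rule insert.IH) (use insert.prems in \<open>auto simp: indicator_def\<close>)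
  also have "\<dots> \<le> (\<Sum>k\<in>S. ennreal (1 / weight k) * mixed_norm dual_exps (\<lambda>x. g x * indicator (cube k) x))"
    unfolding mixed_norm_eq_enorm
    by (intro sum_mono mult_left_mono mixed_enorm_mono_AE p_exp AE_I2) (auto simp: indicator_def)
  finally show ?case using insert.hyps by (simp add: add_mono)
qed

lemma add_mem: "g \<in> V \<Longrightarrow> h \<in> V \<Longrightarrow> (\<lambda>x. g x + h x) \<in> V"
  and cmult_mem: "g \<in> V \<Longrightarrow> (\<lambda>x. c * g x) \<in> V"
  and zero_mem: "(\<lambda>x. 0) \<in> V"
  using fun_subspaceD[OF block_space_subspace] by blast+

lemma diff_mem: "g \<in> V \<Longrightarrow> h \<in> V \<Longrightarrow> (\<lambda>x. g x - h x) \<in> V"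
  using add_mem[of g "\<lambda>x. (-1) * h x"] cmult_mem[of h "-1"] by simp

lemma sum_mem: "finite F \<Longrightarrow> (\<And>i. i \<in> F \<Longrightarrow> g i \<in> V) \<Longrightarrow> (\<lambda>x. \<Sum>i\<in>F. g i x) \<in> V"
  by (induction F rule: finite_induct) (simp_all add: zero_mem add_mem)

lemma block_rep_remainder:
  assumes rep: "block_rep p t r g l b" and F: "finite F"
  shows "block_rep p t r (\<lambda>x. g x - (\<Sum>i\<in>F. l i * b i x)) (\<lambda>i. if i \<in> F then 0 else l i) b"
  unfolding block_rep_iff
proof (intro conjI allI)
  have "coeff_norm (\<lambda>i. if i \<in> F then 0 else l i) \<le> coeff_norm l"
    unfolding seq_norm_def by (intro lp_norm_mono_AE fin_exp_conj_r) auto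
  then show "coeff_norm (\<lambda>i. if i \<in> F then 0 else l i) < \<infinity>"
    using block_repD(1)[OF rep] by (rule order_le_less_trans)
  show "block p t (cube i) (b i)" for i by (rule block_repD[OF rep])
  show "AE x in lebesgue. ((\<lambda>i. (if i \<in> F then 0 else l i) * b i x) has_sum (g x - (\<Sum>i\<in>F. l i * b i x))) UNIV"
    using block_repD(3)[OF rep]
  proof eventually_elim
    fix x assume sum: "((\<lambda>i. l i * b i x) has_sum g x) UNIV"
    have "((\<lambda>i. - (l i * b i x)) has_sum (\<Sum>i\<in>F. - (l i * b i x))) F"
      using F by (rule has_sum_finite)
    moreover have "((\<lambda>i. if i \<in> F then - (l i * b i x) else 0) has_sum (\<Sum>i\<in>F. - (l i * b i x))) UNIV \<longleftrightarrow>
        ((\<lambda>i. - (l i * b i x)) has_sum (\<Sum>i\<in>F. - (l i * b i x))) F"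
      by (rule has_sum_cong_neutral) auto
    ultimately have "((\<lambda>i. l i * b i x + (if i \<in> F then - (l i * b i x) else 0)) has_sum
        (g x + (\<Sum>i\<in>F. - (l i * b i x)))) UNIV"
      by (intro has_sum_add sum) simp
    moreover have "(\<lambda>i. l i * b i x + (if i \<in> F then - (l i * b i x) else 0)) = (\<lambda>i. (if i \<in> F then 0 else l i) * b i x)"
      by auto
    ultimately show "((\<lambda>i. (if i \<in> F then 0 else l i) * b i x) has_sum (g x - (\<Sum>i\<in>F. l i * b i x))) UNIV"
      by (simp add: sum_negf)
  qed
qed

section \<open>Bounded functionals on the block space\<close>

text \<open>
Linearity and the bound imply that the value does not change under modifications on null sets:
functions that agree almost everywhere have a difference of norm zero.
\<close>

definition bounded_linear_on :: "real \<Rightarrow> (('n rvec \<Rightarrow> complex) \<Rightarrow> complex) \<Rightarrow> bool" where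
  "bounded_linear_on K L \<longleftrightarrow> 0 \<le> K \<and> (\<forall>g\<in>V. \<forall>h\<in>V. L (\<lambda>x. g x + h x) = L g + L h) \<and>
     (\<forall>c. \<forall>g\<in>V. L (\<lambda>x. c * g x) = c * L g) \<and>
     (\<forall>g\<in>V. ennreal (norm (L g)) \<le> ennreal K * N g)"

lemma bounded_linear_onD:
  assumes "bounded_linear_on K L"
  shows "0 \<le> K" "g \<in> V \<Longrightarrow> h \<in> V \<Longrightarrow> L (\<lambda>x. g x + h x) = L g + L h"
    "g \<in> V \<Longrightarrow> L (\<lambda>x. c * g x) = c * L g" "g \<in> V \<Longrightarrow> ennreal (norm (L g)) \<le> ennreal K * N g"
  using assms by (simp_all add: bounded_linear_on_def)

lemma bounded_linear_on_diff:
  assumes L: "bounded_linear_on K L" and "g \<in> V" "h \<in> V"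
  shows "L (\<lambda>x. g x - h x) = L g - L h"
  using bounded_linear_onD(2)[OF L, of g "\<lambda>x. (-1) * h x"] bounded_linear_onD(3)[OF L, of h "-1"]
    cmult_mem[of h "-1"] assms by simp

lemma bounded_linear_on_sum:
  assumes L: "bounded_linear_on K L" and "finite F" "\<And>i. i \<in> F \<Longrightarrow> g i \<in> V"
  shows "L (\<lambda>x. \<Sum>i\<in>F. g i x) = (\<Sum>i\<in>F. L (g i))"
  using assms(2,3)
proof (induction F rule: finite_induct)
  case empty
  show ?case using bounded_linear_onD(3)[OF L zero_mem, of 0] by simp
next
  case (insert i F)
  have "L (\<lambda>x. g i x + (\<Sum>i\<in>F. g i x)) = L (g i) + L (\<lambda>x. \<Sum>i\<in>F. g i x)"
    using insert by (intro bounded_linear_onD(2)[OF L] sum_mem) auto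
  then show ?case using insert by simp
qed

lemma bounded_linear_on_LIMSEQ_0:
  assumes L: "bounded_linear_on K L" and g: "\<And>k. g k \<in> V" and lim: "(\<lambda>k. N (g k)) \<longlonglongrightarrow> 0"
  shows "(\<lambda>k. L (g k)) \<longlonglongrightarrow> 0"
proof -
  have "(\<lambda>k. ennreal K * N (g k)) \<longlonglongrightarrow> ennreal K * 0"
    by (intro ennreal_tendsto_cmult lim) simp
  then have "(\<lambda>k. ennreal (norm (L (g k)))) \<longlonglongrightarrow> ennreal 0"
    using bounded_linear_onD(4)[OF L g] by (simp add: tendsto_0_le_ennreal)
  then have "(\<lambda>k. norm (L (g k))) \<longlonglongrightarrow> 0"
    by (rule tendsto_ennrealD) simp_all
  then show ?thesis
    by (rule tendsto_norm_zero_cancel)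
qed

lemma mixed_norm_block_finite: "block p t (cube i) b \<Longrightarrow> mixed_norm dual_exps b < \<infinity>"
  by (auto simp: block_cube intro: order_le_less_trans)

lemma block_mem: "block p t (cube i) b \<Longrightarrow> b \<in> V"
  unfolding block_space_iff
proof
  assume b: "block p t (cube i) b"
  show "b \<in> borel_measurable lebesgue" using b by (simp add: block_cube)
  have "N b \<le> ennreal (1 / weight i) * mixed_norm dual_exps b"
    using b by (intro block_norm_le_mixed_norm) (auto simp: block_cube)
  also have "\<dots> < \<infinity>" using mixed_norm_block_finite[OF b] by (simp add: ennreal_mult_less_top)
  finally show "N b < \<infinity>" .
qed

text \<open>
Density of the bounded functions living on finitely many cubes. Truncations of a block converge to it
in mixed norm, hence in the block space; the partial sums of a block series converge to its sum,
since the remainder is a block series whose coefficients are a tail of a sequence in \<open>\<ell>\<^sup>r\<^sup>'\<close>.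
\<close>

lemma bounded_linear_on_eq_0:
  assumes T: "bounded_linear_on K T"
    and 0: "\<And>i g. cube_bounded_fun i g \<Longrightarrow> T g = 0"
    and g: "g \<in> V"
  shows "T g = 0"
proof -
  have block0: "T b = 0" if b: "block p t (cube i) b" for b i
  proof -
    have [measurable]: "b \<in> borel_measurable lebesgue" and off: "AE x in lebesgue. x \<notin> cube i \<longrightarrow> b x = 0"
      using b by (auto simp: block_cube)
    define B where "B k x = (if norm (b x) \<le> real k \<and> x \<in> cube i then b x else 0)" for k x
    have [measurable]: "B k \<in> borel_measurable lebesgue" for k
      unfolding B_def by measurable
    have TB: "T (B k) = 0" for k
      by (rule 0[of i]) (auto simp: cube_bounded_fun_def B_def intro!: exI[of _ "real k"])
    have diff: "(\<lambda>x. b x - B k x) \<in> borel_measurable lebesgue" for k by measurable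
    have diff_off: "AE x in lebesgue. x \<notin> cube i \<longrightarrow> b x - B k x = 0" for k
      using off by eventually_elim (auto simp: B_def)
    have "(\<lambda>k. mixed_enorm dual_exps (\<lambda>x. ennreal (norm (b x - B k x)))) \<longlonglongrightarrow> 0"
    proof (rule mixed_enorm_dominated[of _ _ "\<lambda>x. ennreal (norm (b x))"])
      show "AE x in lborel. ennreal (norm (b x - B k x)) \<le> ennreal (norm (b x))" for k
        by (intro AE_I2 ennreal_leI) (auto simp: B_def)
      show "mixed_enorm dual_exps (\<lambda>x. ennreal (norm (b x))) < \<infinity>"
        using mixed_norm_block_finite[OF b] by (simp add: mixed_norm_eq_enorm)
      have "AE x in lborel. x \<notin> cube i \<longrightarrow> b x = 0"
        using off by (simp add: AE_completion_iff)
      then show "AE x in lborel. (\<lambda>k. ennreal (norm (b x - B k x))) \<longlonglongrightarrow> 0"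
      proof eventually_elim
        fix x assume x: "x \<notin> cube i \<longrightarrow> b x = 0"
        obtain k0 where k0: "norm (b x) \<le> real k0" using real_arch_simple by blast
        have "b x - B k x = 0" if "k0 \<le> k" for k
          using that k0 x by (auto simp: B_def)
        then show "(\<lambda>k. ennreal (norm (b x - B k x))) \<longlonglongrightarrow> 0"
          by (intro tendsto_eventually eventually_sequentiallyI[of k0]) simp
      qed
    qed (auto simp: p_exp)
    then have lim: "(\<lambda>k. mixed_norm dual_exps (\<lambda>x. b x - B k x)) \<longlonglongrightarrow> 0"
      by (simp add: mixed_norm_eq_enorm)
    have "(\<lambda>k. ennreal (1 / weight i) * mixed_norm dual_exps (\<lambda>x. b x - B k x)) \<longlonglongrightarrow> ennreal (1 / weight i) * 0"
      by (intro ennreal_tendsto_cmult lim) simp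
    then have Nlim: "(\<lambda>k. N (\<lambda>x. b x - B k x)) \<longlonglongrightarrow> 0"
      using block_norm_le_mixed_norm[OF diff diff_off] by (simp add: tendsto_0_le_ennreal)
    have le: "mixed_norm dual_exps (\<lambda>x. b x - B k x) \<le> mixed_norm dual_exps b" for k
      unfolding mixed_norm_eq_enorm
      by (intro mixed_enorm_mono_AE p_exp AE_I2 ennreal_leI) (auto simp: B_def)
    have dV: "(\<lambda>x. b x - B k x) \<in> V" for k
    proof -
      have "N (\<lambda>x. b x - B k x) \<le> ennreal (1 / weight i) * mixed_norm dual_exps (\<lambda>x. b x - B k x)"
        by (intro block_norm_le_mixed_norm diff diff_off)
      also have "\<dots> \<le> ennreal (1 / weight i) * mixed_norm dual_exps b"
        by (intro mult_left_mono le) simp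
      also have "\<dots> < \<infinity>" using mixed_norm_block_finite[OF b] by (simp add: ennreal_mult_less_top)
      finally show ?thesis by (simp add: block_space_iff diff)
    qed
    have BV: "B k \<in> V" for k
      using diff_mem[OF block_mem[OF b] dV[of k]] by simp
    have "T (\<lambda>x. b x - B k x) = T b" for k
      using bounded_linear_on_diff[OF T block_mem[OF b] BV[of k]] TB by simp
    with bounded_linear_on_LIMSEQ_0[OF T dV Nlim] show ?thesis
      by (simp add: LIMSEQ_const_iff)
  qed
  obtain l b where rep: "block_rep p t r g l b"
    using g by (auto simp: block_space_def)
  define F where "F n = {i :: int \<times> 'n ivec. to_nat i < n}" for n
  have fin: "finite (F n)" for n
    unfolding F_def by (rule finite_to_nat_less)
  let ?R = "\<lambda>n x. g x - (\<Sum>i\<in>F n. l i * b i x)"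
  have lb: "(\<lambda>x. l i * b i x) \<in> V" for i
    using block_mem[OF block_repD(2)[OF rep]] by (rule cmult_mem)
  have RV: "?R n \<in> V" for n
    by (intro diff_mem g sum_mem fin lb)
  have "(\<lambda>n. coeff_norm (\<lambda>i. if i \<in> F n then 0 else l i)) \<longlonglongrightarrow> 0"
    using lp_norm_tail[OF fin_exp_conj_r, of "\<lambda>i. ennreal (norm (l i))"] block_repD(1)[OF rep]
    unfolding seq_norm_def by (simp add: F_def if_distrib[of norm] if_distrib[of ennreal] cong: if_cong)
  then have "(\<lambda>n. N (?R n)) \<longlonglongrightarrow> 0"
    by (rule tendsto_0_le_ennreal) (rule block_norm_le[OF block_rep_remainder[OF rep fin]])
  moreover have "T (?R n) = T g" for n
  proof -
    have "T (\<lambda>x. \<Sum>i\<in>F n. l i * b i x) = (\<Sum>i\<in>F n. T (\<lambda>x. l i * b i x))"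
      by (intro bounded_linear_on_sum[OF T] fin lb)
    also have "\<dots> = (\<Sum>i\<in>F n. l i * T (b i))"
      by (intro sum.cong refl bounded_linear_onD(3)[OF T] block_mem[OF block_repD(2)[OF rep]])
    also have "\<dots> = 0" using block0[OF block_repD(2)[OF rep]] by simp
    finally show ?thesis
      using bounded_linear_on_diff[OF T g sum_mem[OF fin lb]] by simp
  qed
  ultimately show ?thesis
    using bounded_linear_on_LIMSEQ_0[OF T RV] by (simp add: LIMSEQ_const_iff)
qed

section \<open>The pairing of the two spaces\<close>

text \<open>
The terms whose \<open>\<ell>\<^sup>r\<close>-norm over all cubes is the Bourgain-Morrey norm.
\<close>

definition local_norm :: "('n rvec \<Rightarrow> complex) \<Rightarrow> int \<times> 'n ivec \<Rightarrow> ennreal" where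
  "local_norm f i = ennreal (weight i) * mixed_norm p (\<lambda>x. f x * indicator (cube i) x)"

lemma bm_norm_infinite: "r = \<infinity> \<Longrightarrow> bm_norm p t r f = (SUP i. local_norm f i)"
  unfolding bm_norm_def range_cube[symmetric] local_norm_def weight_def by (simp add: image_image)

lemma bm_norm_finite: "r < \<infinity> \<Longrightarrow> bm_norm p t r f = lp_norm (count_space UNIV) r (local_norm f)"
proof -
  assume "r < \<infinity>"
  note e = conj_exp_enn2real[OF r this]
  have "(\<Sum>\<^sub>\<infinity>Q\<in>dyadic_cubes. ennreal (measure lebesgue Q powr (enn2real r * scale_exp p t)) *
          epow (mixed_norm p (\<lambda>x. f x * indicator Q x)) (enn2real r))
      = (\<Sum>\<^sub>\<infinity>i. ennreal (measure lebesgue (cube i) powr (enn2real r * scale_exp p t)) *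
          epow (mixed_norm p (\<lambda>x. f x * indicator (cube i) x)) (enn2real r))"
    unfolding range_cube[symmetric] by (subst infsum_reindex[OF cube_inj]) (simp add: o_def)
  also have "\<dots> = (\<Sum>\<^sub>\<infinity>i. epow (local_norm f i) (enn2real r))"
    unfolding local_norm_def weight_def epow_mult
    by (simp add: epow_ennreal powr_powr mult.commute)
  also have "\<dots> = (\<integral>\<^sup>+ i. epow (local_norm f i) (enn2real r) \<partial>count_space UNIV)"
    by (rule nn_integral_count_space_eq_infsum[symmetric])
  finally show ?thesis
    using fin_expD(2)[OF e(4)] by (simp add: bm_norm_def lp_norm_eq[OF e(4)])
qed

lemma local_norm_Holder:
  "(\<integral>\<^sup>+ i. ennreal (norm (l i)) * local_norm f i \<partial>count_space UNIV) \<le> coeff_norm l * bm_norm p t r f"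
proof (cases "r = \<infinity>")
  case True
  then have "conj_exp r = 1" by (simp add: conj_exp_def)
  then have "coeff_norm l = (\<integral>\<^sup>+ i. ennreal (norm (l i)) \<partial>count_space UNIV)"
    by (simp add: seq_norm_def lp_norm_one)
  moreover have "(\<integral>\<^sup>+ i. ennreal (norm (l i)) * local_norm f i \<partial>count_space UNIV)
      \<le> (\<integral>\<^sup>+ i. ennreal (norm (l i)) * bm_norm p t r f \<partial>count_space UNIV)"
    unfolding bm_norm_infinite[OF True] by (intro nn_integral_mono mult_left_mono SUP_upper) auto
  ultimately show ?thesis by (simp add: nn_integral_multc)
next
  case False
  then have fin: "r < \<infinity>" by (simp add: less_top)
  show ?thesis
    using lp_norm_Holder[OF r fin, of "local_norm f" "count_space UNIV" "\<lambda>i. ennreal (norm (l i))"]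
    by (simp add: seq_norm_def bm_norm_finite[OF fin] mult.commute)
qed

text \<open>
The series is integrated term by term after taking absolute values. On the cube with index \<open>i\<close>,
Hoelder's inequality for mixed norms bounds \<open>\<integral> \<bar>b\<^sub>i f\<bar>\<close> by the local norm of \<open>f\<close>.
\<close>

lemma pairing_le_rep:
  assumes [measurable]: "f \<in> borel_measurable lebesgue" and rep: "block_rep p t r g l b"
  shows "(\<integral>\<^sup>+ x. ennreal (norm (g x * f x)) \<partial>lebesgue) \<le> coeff_norm l * bm_norm p t r f"
proof -
  have [measurable]: "b i \<in> borel_measurable lebesgue" for i
    using block_repD(2)[OF rep, of i] by (auto simp: block_cube)
  have "(\<integral>\<^sup>+ x. ennreal (norm (g x * f x)) \<partial>lebesgue)
      \<le> (\<integral>\<^sup>+ x. \<integral>\<^sup>+ i. ennreal (norm (l i * b i x)) * ennreal (norm (f x)) \<partial>count_space UNIV \<partial>lebesgue)"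
  proof (rule nn_integral_mono_AE)
    show "AE x in lebesgue. ennreal (norm (g x * f x))
        \<le> (\<integral>\<^sup>+ i. ennreal (norm (l i * b i x)) * ennreal (norm (f x)) \<partial>count_space UNIV)"
      using block_repD(3)[OF rep]
    proof eventually_elim
      fix x assume "((\<lambda>i. l i * b i x) has_sum g x) UNIV"
      from mult_right_mono[OF norm_has_sum_le[OF this], of "ennreal (norm (f x))"]
      show "ennreal (norm (g x * f x)) \<le> (\<integral>\<^sup>+ i. ennreal (norm (l i * b i x)) * ennreal (norm (f x)) \<partial>count_space UNIV)"
        by (simp add: nn_integral_multc norm_mult[of "g x"] ennreal_mult)
    qed
  qed
  also have "\<dots> = (\<integral>\<^sup>+ i. \<integral>\<^sup>+ x. ennreal (norm (l i * b i x)) * ennreal (norm (f x)) \<partial>lebesgue \<partial>count_space UNIV)"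
    by (rule nn_integral_count_space_nn_integral) auto
  also have "\<dots> \<le> (\<integral>\<^sup>+ i. ennreal (norm (l i)) * local_norm f i \<partial>count_space UNIV)"
  proof (rule nn_integral_mono)
    fix i
    have off: "AE x in lebesgue. x \<notin> cube i \<longrightarrow> b i x = 0" and bw: "mixed_norm dual_exps (b i) \<le> ennreal (weight i)"
      using block_repD(2)[OF rep, of i] by (auto simp: block_cube)
    have "(\<integral>\<^sup>+ x. ennreal (norm (l i * b i x)) * ennreal (norm (f x)) \<partial>lebesgue)
        = (\<integral>\<^sup>+ x. ennreal (norm (l i)) * (ennreal (norm (f x * indicator (cube i) x)) * ennreal (norm (b i x))) \<partial>lebesgue)"
      using off
      by (intro nn_integral_cong_AE) (auto elim!: eventually_mono simp: norm_mult ennreal_mult indicator_def ac_simps)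
    also have "\<dots> = ennreal (norm (l i)) * (\<integral>\<^sup>+ x. ennreal (norm (f x * indicator (cube i) x)) * ennreal (norm (b i x)) \<partial>lebesgue)"
      by (rule nn_integral_cmult) measurable
    also have "\<dots> \<le> ennreal (norm (l i)) * (mixed_norm p (\<lambda>x. f x * indicator (cube i) x) * mixed_norm dual_exps (b i))"
      unfolding mixed_norm_eq_enorm by (intro mult_left_mono mixed_enorm_Holder p) auto
    also have "\<dots> \<le> ennreal (norm (l i)) * (mixed_norm p (\<lambda>x. f x * indicator (cube i) x) * ennreal (weight i))"
      by (intro mult_left_mono bw) auto
    finally show "(\<integral>\<^sup>+ x. ennreal (norm (l i * b i x)) * ennreal (norm (f x)) \<partial>lebesgue) \<le> ennreal (norm (l i)) * local_norm f i"
      by (simp add: local_norm_def mult.commute)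
  qed
  also have "\<dots> \<le> coeff_norm l * bm_norm p t r f"
    by (rule local_norm_Holder)
  finally show ?thesis .
qed

lemma pairing_le:
  assumes f: "f \<in> bm_space p t r" and g: "g \<in> V"
  shows "(\<integral>\<^sup>+ x. ennreal (norm (g x * f x)) \<partial>lebesgue) \<le> N g * bm_norm p t r f"
proof -
  have [measurable]: "f \<in> borel_measurable lebesgue" and fin: "bm_norm p t r f < \<infinity>"
    using f by (auto simp: bm_space_def)
  then obtain B where B: "bm_norm p t r f = ennreal B" "0 \<le> B"
    by (cases "bm_norm p t r f") auto
  obtain A where A: "N g = ennreal A" "0 \<le> A"
    using g by (cases "N g") (auto simp: block_space_iff)
  show ?thesis
  proof (rule ennreal_le_epsilon)
    fix \<epsilon> :: real assume "0 < \<epsilon>"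
    \<comment> \<open>\<open>B + 1\<close> instead of \<open>B\<close>, since the norm \<open>B\<close> of \<open>f\<close> may be zero.\<close>
    then have \<epsilon>: "0 < \<epsilon> / (B + 1)" using B by simp
    then have "N g < ennreal (A + \<epsilon> / (B + 1))"
      using A by (simp add: ennreal_less_iff)
    from block_norm_less[OF this] obtain l b where lb: "block_rep p t r g l b"
      "coeff_norm l < ennreal (A + \<epsilon> / (B + 1))" by auto
    have "(\<integral>\<^sup>+ x. ennreal (norm (g x * f x)) \<partial>lebesgue) \<le> coeff_norm l * bm_norm p t r f"
      by (rule pairing_le_rep[OF _ lb(1)]) simp
    also have "\<dots> \<le> ennreal (A + \<epsilon> / (B + 1)) * ennreal B"
      using lb(2) B by (intro mult_mono) auto
    also have "\<dots> = ennreal ((A + \<epsilon> / (B + 1)) * B)"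
      using A B \<epsilon> by (intro ennreal_mult[symmetric]) auto
    also have "\<dots> \<le> ennreal (A * B + \<epsilon>)"
      using B \<open>0 < \<epsilon>\<close> by (intro ennreal_leI) (simp add: field_simps)
    also have "\<dots> = ennreal A * ennreal B + ennreal \<epsilon>"
      using A B \<open>0 < \<epsilon>\<close> by (simp add: ennreal_mult)
    finally show "(\<integral>\<^sup>+ x. ennreal (norm (g x * f x)) \<partial>lebesgue) \<le> N g * bm_norm p t r f + ennreal \<epsilon>"
      by (simp only: A B)
  qed
qed

section \<open>The converse inequality\<close>

lemma block_zero: "block p t (cube i) (\<lambda>x. 0)"
  by (simp add: block_cube mixed_norm_eq_enorm mixed_enorm_zero p_exp)

lemma seq_norm_finite_support: "finite S \<Longrightarrow> coeff_norm (\<lambda>i. if i \<in> S then l i else 0) < \<infinity>"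
proof -
  assume S: "finite S"
  have "(\<integral>\<^sup>+ i. epow (ennreal (norm (if i \<in> S then l i else 0))) (enn2real (conj_exp r)) \<partial>count_space UNIV)
      = (\<Sum>i\<in>S. epow (ennreal (norm (if i \<in> S then l i else 0))) (enn2real (conj_exp r)))"
    by (rule nn_integral_count_space'[OF S]) auto
  also have "\<dots> < \<infinity>" using S by (simp add: epow_ennreal)
  finally show ?thesis
    unfolding seq_norm_def lp_norm_eq[OF fin_exp_conj_r] using epow_less_top by simp
qed

lemma block_rep_finite:
  assumes S: "finite S" and b: "\<And>i. i \<in> S \<Longrightarrow> block p t (cube i) (b i)"
  shows "block_rep p t r (\<lambda>x. \<Sum>i\<in>S. l i * b i x) (\<lambda>i. if i \<in> S then l i else 0) (\<lambda>i x. if i \<in> S then b i x else 0)"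
  unfolding block_rep_iff
proof (intro conjI allI AE_I2)
  show "block p t (cube i) (\<lambda>x. if i \<in> S then b i x else 0)" for i
    using b[of i] block_zero[of i] by (cases "i \<in> S") simp_all
  fix x
  have "((\<lambda>i. (if i \<in> S then l i else 0) * (if i \<in> S then b i x else 0)) has_sum (\<Sum>i\<in>S. l i * b i x)) UNIV \<longleftrightarrow>
      ((\<lambda>i. l i * b i x) has_sum (\<Sum>i\<in>S. l i * b i x)) S"
    by (rule has_sum_cong_neutral) auto
  then show "((\<lambda>i. (if i \<in> S then l i else 0) * (if i \<in> S then b i x else 0)) has_sum (\<Sum>i\<in>S. l i * b i x)) UNIV"
    using S by simp
qed (rule seq_norm_finite_support[OF S])

lemma cnj_sgn_mult: "cnj (sgn z) * z = of_real (norm z)"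
proof (cases "z = 0")
  case False
  have "cnj (sgn z) * z = (z * cnj z) / of_real (norm z)"
    by (simp add: sgn_div_norm scaleR_conv_of_real divide_inverse mult.commute)
  also have "\<dots> = of_real (norm z)"
    using False by (simp add: complex_norm_square[symmetric] power2_eq_square)
  finally show ?thesis .
qed simp

text \<open>
A block of the form \<open>w G \<cdot> cnj (sgn f)\<close>, where \<open>G\<close> is nearly dual to \<open>\<bar>f\<bar>\<close> on the cube and \<open>w\<close> is the
weight. Its pairing with \<open>f\<close> is the real number \<open>w \<integral> G \<bar>f\<bar>\<close>.
\<close>

lemma ex_test_block:
  assumes f [measurable]: "f \<in> borel_measurable lebesgue"
    and loc: "integrable lebesgue (\<lambda>x. f x * indicator (cube i) x)"
    and c: "0 \<le> c" "c = 0 \<or> ennreal c < mixed_norm p (\<lambda>x. f x * indicator (cube i) x)"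
  obtains b d where "block p t (cube i) b" "cube_bounded_fun i b"
    "weight i * c \<le> d" "(\<integral>x. b x * f x \<partial>lebesgue) = complex_of_real d"
proof (cases "c = 0")
  case True
  show ?thesis by (rule that[of "\<lambda>x. 0" 0]) (auto simp: True block_zero cube_bounded_fun_def)
next
  case False
  let ?F = "\<lambda>x. ennreal (norm (f x * indicator (cube i) x))"
  have cF: "ennreal c < mixed_enorm p ?F" using c False by (simp add: mixed_norm_eq_enorm)
  obtain G and k :: nat where G [measurable]: "G \<in> borel_measurable borel" and Gk: "\<And>x. G x \<le> of_nat k"
    and G0: "\<And>x. x \<notin> cube i \<Longrightarrow> G x = 0" and G1: "mixed_enorm dual_exps G \<le> 1"
    and cG: "ennreal c < (\<integral>\<^sup>+ x. ?F x * G x \<partial>lebesgue)"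
    by (rule mixed_enorm_duality[of p "cube i" ?F "ennreal c", OF p cube_bounded cube_borel _ _ cF]) auto
  have [measurable]: "G \<in> borel_measurable lebesgue"
    using G by (intro measurable_completion) simp
  define H where "H x = enn2real (G x)" for x
  have GH: "G x = ennreal (H x)" for x
    using Gk[of x] unfolding H_def by (simp add: le_less_trans[OF _ of_nat_less_top])
  have H0: "0 \<le> H x" for x by (simp add: H_def)
  have Hk: "H x \<le> real k" for x
    using Gk[of x] unfolding GH by (simp add: ennreal_of_nat_eq_real_of_nat)
  have Hoff: "H x = 0" if "x \<notin> cube i" for x using G0[OF that] by (simp add: H_def)
  have [measurable]: "H \<in> borel_measurable lebesgue"
    unfolding H_def by measurable
  let ?w = "weight i"
  have w: "0 < ?w" by (rule weight_pos)
  define b where "b x = of_real (?w * H x) * cnj (sgn (f x))" for x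
  define d where "d = (\<integral>x. ?w * H x * norm (f x) \<partial>lebesgue)"
  have [measurable]: "cnj \<in> borel_measurable borel"
    by (intro borel_measurable_continuous_onI continuous_intros)
  have [measurable]: "b \<in> borel_measurable lebesgue"
    unfolding b_def sgn_div_norm by measurable
  have nb: "norm (b x) \<le> ?w * H x" for x
  proof -
    have "norm (sgn (f x)) \<le> 1" by (simp add: norm_sgn)
    then show ?thesis
      using w H0[of x] by (simp add: b_def norm_mult mult_left_le)
  qed
  have boff: "b x = 0" if "x \<notin> cube i" for x using Hoff[OF that] by (simp add: b_def)
  have "mixed_norm dual_exps b \<le> mixed_enorm dual_exps (\<lambda>x. ennreal ?w * G x)"
    unfolding mixed_norm_eq_enorm
  proof (intro mixed_enorm_mono_AE p_exp AE_I2)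
    fix x show "ennreal (norm (b x)) \<le> ennreal ?w * G x"
      using nb[of x] w H0[of x] by (simp add: GH ennreal_mult[symmetric] ennreal_leI)
  qed
  also have "\<dots> = ennreal ?w * mixed_enorm dual_exps G"
    by (intro mixed_enorm_cmult p_exp) measurable
  also have "\<dots> \<le> ennreal ?w * 1" by (intro mult_left_mono G1) simp
  finally have bl: "block p t (cube i) b"
    by (simp add: block_cube boff)
  have int: "integrable lebesgue (\<lambda>x. ?w * H x * norm (f x))"
  proof (rule Bochner_Integration.integrable_bound[OF integrable_mult_right[OF integrable_norm[OF loc], of "?w * real k"]])
    show "AE x in lebesgue. norm (?w * H x * norm (f x)) \<le> norm (?w * real k * norm (f x * indicator (cube i) x))"
    proof (rule AE_I2)
      fix x show "norm (?w * H x * norm (f x)) \<le> norm (?w * real k * norm (f x * indicator (cube i) x))"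
        using w H0[of x] Hk[of x] Hoff[of x]
        by (cases "x \<in> cube i") (auto simp: abs_mult intro!: mult_right_mono)
    qed
  qed measurable
  have "(\<integral>x. b x * f x \<partial>lebesgue) = (\<integral>x. complex_of_real (?w * H x * norm (f x)) \<partial>lebesgue)"
    by (intro Bochner_Integration.integral_cong refl) (simp add: b_def mult.assoc cnj_sgn_mult)
  also have "\<dots> = of_real d" unfolding d_def by (rule integral_of_real[OF int])
  finally have bd: "(\<integral>x. b x * f x \<partial>lebesgue) = complex_of_real d" .
  have "ennreal (?w * c) \<le> ennreal ?w * (\<integral>\<^sup>+ x. ?F x * G x \<partial>lebesgue)"
    using w c cG by (subst ennreal_mult) (auto intro!: mult_left_mono)
  also have "\<dots> = (\<integral>\<^sup>+ x. ennreal ?w * (?F x * G x) \<partial>lebesgue)"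
    by (intro nn_integral_cmult[symmetric]) measurable
  also have "\<dots> = (\<integral>\<^sup>+ x. ennreal (?w * H x * norm (f x)) \<partial>lebesgue)"
  proof (rule nn_integral_cong)
    fix x show "ennreal ?w * (?F x * G x) = ennreal (?w * H x * norm (f x))"
      using w H0[of x] Hoff[of x] by (cases "x \<in> cube i") (auto simp: GH ennreal_mult ac_simps)
  qed
  also have "\<dots> = ennreal d"
    unfolding d_def using w H0 by (intro nn_integral_eq_integral int) auto
  finally have "?w * c \<le> d"
    using w H0 unfolding d_def by (subst (asm) ennreal_le_iff) (auto intro!: integral_nonneg_AE)
  have "norm (b x) \<le> ?w * real k" for x
    using nb[of x] Hk[of x] w by (meson mult_left_mono less_imp_le order_trans)
  then have "cube_bounded_fun i b"
    using boff by (auto simp: cube_bounded_fun_def)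
  then show ?thesis
    by (rule that[OF bl _ \<open>?w * c \<le> d\<close> bd])
qed

text \<open>
Testing \<open>L\<close> on \<open>\<Sum>\<^sub>i\<^sub>\<in>\<^sub>S \<mu>\<^sub>i b\<^sub>i\<close> with blocks \<open>b\<^sub>i\<close> that are nearly dual to \<open>f\<close> gives
\<open>\<Sum>\<^sub>i\<^sub>\<in>\<^sub>S \<mu>\<^sub>i a\<^sub>i \<le> K \<parallel>\<mu>\<parallel>\<close> for the local norms \<open>a\<^sub>i\<close> of \<open>f\<close>, and duality of sequence spaces does the rest. Single
blocks already show that the local norms are at most \<open>K\<close>, in particular finite.
\<close>

lemma bm_norm_le_of_bounded_functional:
  assumes L: "bounded_linear_on K L" and f [measurable]: "f \<in> borel_measurable lebesgue"
    and loc: "\<And>i. integrable lebesgue (\<lambda>x. f x * indicator (cube i) x)"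
    and rep: "\<And>i g. cube_bounded_fun i g \<Longrightarrow> L g = (\<integral>x. g x * f x \<partial>lebesgue)"
  shows "bm_norm p t r f \<le> ennreal K"
proof -
  let ?A = "\<lambda>i. mixed_norm p (\<lambda>x. f x * indicator (cube i) x)"
  let ?s = "\<lambda>S \<mu>. coeff_norm (\<lambda>i. if i \<in> S then complex_of_real (\<mu> i) else 0)"
  note K = bounded_linear_onD(1)[OF L]
  have key: "ennreal (\<Sum>i\<in>S. \<mu> i * (weight i * c i)) \<le> ennreal K * ?s S \<mu>"
    if S: "finite S" and \<mu>: "\<And>i. 0 \<le> \<mu> i" and c: "\<And>i. 0 \<le> c i" "\<And>i. i \<in> S \<Longrightarrow> c i = 0 \<or> ennreal (c i) < ?A i"
    for S and \<mu> c :: "int \<times> 'n ivec \<Rightarrow> real"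
  proof -
    have "\<exists>b d. block p t (cube i) b \<and> weight i * c i \<le> d \<and> L b = complex_of_real d" if i: "i \<in> S" for i
    proof -
      obtain b d where b: "block p t (cube i) b" "cube_bounded_fun i b"
        and d: "weight i * c i \<le> d" "(\<integral>x. b x * f x \<partial>lebesgue) = complex_of_real d"
        by (rule ex_test_block[OF f loc c(1) c(2)[OF i]]) blast
      have "L b = complex_of_real d"
        using rep[OF b(2)] d(2) by simp
      then show ?thesis using b d by blast
    qed
    then obtain b d where b: "\<And>i. i \<in> S \<Longrightarrow> block p t (cube i) (b i)"
      and d: "\<And>i. i \<in> S \<Longrightarrow> weight i * c i \<le> d i" and Lb: "\<And>i. i \<in> S \<Longrightarrow> L (b i) = complex_of_real (d i)"
      by metis
    let ?g = "\<lambda>x. \<Sum>i\<in>S. complex_of_real (\<mu> i) * b i x"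
    have mem: "(\<lambda>x. complex_of_real (\<mu> i) * b i x) \<in> V" if "i \<in> S" for i
      by (intro cmult_mem block_mem[OF b] that)
    have "L ?g = (\<Sum>i\<in>S. L (\<lambda>x. complex_of_real (\<mu> i) * b i x))"
      by (rule bounded_linear_on_sum[OF L S mem])
    also have "\<dots> = (\<Sum>i\<in>S. complex_of_real (\<mu> i * d i))"
      by (intro sum.cong refl) (simp add: bounded_linear_onD(3)[OF L block_mem[OF b]] Lb)
    finally have Lg: "L ?g = complex_of_real (\<Sum>i\<in>S. \<mu> i * d i)" by simp
    have "(\<Sum>i\<in>S. \<mu> i * (weight i * c i)) \<le> (\<Sum>i\<in>S. \<mu> i * d i)"
      by (intro sum_mono mult_left_mono d \<mu>)
    also have "\<dots> \<le> norm (L ?g)" unfolding Lg norm_of_real by simp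
    finally have "ennreal (\<Sum>i\<in>S. \<mu> i * (weight i * c i)) \<le> ennreal (norm (L ?g))" by (rule ennreal_leI)
    also have "\<dots> \<le> ennreal K * N ?g"
      by (intro bounded_linear_onD(4)[OF L] sum_mem S mem)
    also have "\<dots> \<le> ennreal K * ?s S \<mu>"
      by (intro mult_left_mono block_norm_le[OF block_rep_finite[OF S b]]) auto
    finally show ?thesis .
  qed
  have single: "?s {i} (\<lambda>_. 1) = 1" for i
  proof -
    have "?s {i} (\<lambda>_. 1) = epow (\<integral>\<^sup>+ k. (if k = i then 1 else 0) \<partial>count_space UNIV) (1 / enn2real (conj_exp r))"
      unfolding seq_norm_def lp_norm_eq[OF fin_exp_conj_r]
      by (intro arg_cong2[where f = epow] nn_integral_cong) auto
    then show ?thesis by (simp add: nn_integral_count_space_single)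
  qed
  have local_le: "local_norm f i \<le> ennreal K" for i
  proof -
    have "?A i \<le> ennreal (K / weight i)"
    proof (rule dense_le)
      fix c assume c: "c < ?A i"
      then obtain c' where c': "c = ennreal c'" "0 \<le> c'" by (cases c) auto
      have "ennreal (weight i * c') \<le> ennreal K"
        using key[of "{i}" "\<lambda>_. 1" "\<lambda>_. c'"] c c' single[of i] by simp
      then have "weight i * c' \<le> K" using K by (simp add: ennreal_le_iff)
      then show "c \<le> ennreal (K / weight i)"
        unfolding c'(1) using weight_pos[of i] by (intro ennreal_leI) (simp add: field_simps)
    qed
    then have "local_norm f i \<le> ennreal (weight i) * ennreal (K / weight i)"
      unfolding local_norm_def by (intro mult_left_mono) auto
    also have "\<dots> = ennreal K"
      using weight_pos[of i] K by (simp add: ennreal_mult[symmetric])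
    finally show ?thesis .
  qed
  show ?thesis
  proof (cases "r = \<infinity>")
    case True
    then show ?thesis unfolding bm_norm_infinite[OF True] by (intro SUP_least local_le)
  next
    case False
    then have rfin: "r < \<infinity>" by (simp add: less_top)
    define a where "a i = enn2real (local_norm f i)" for i
    have a: "local_norm f i = ennreal (a i)" "0 \<le> a i" for i
    proof -
      have "local_norm f i < top" using local_le[of i] by (rule order_le_less_trans) simp
      then show "local_norm f i = ennreal (a i)" by (simp add: a_def)
      show "0 \<le> a i" by (simp add: a_def)
    qed
    have test: "ennreal (\<Sum>i\<in>S. \<mu> i * a i) \<le> ennreal K * ?s S \<mu>"
      if S: "finite S" and \<mu>: "\<And>i. 0 \<le> \<mu> i" for S and \<mu> :: "int \<times> 'n ivec \<Rightarrow> real"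
    proof -
      obtain q where q: "?s S \<mu> = ennreal q" "0 \<le> q"
        using seq_norm_finite_support[OF S, of "\<lambda>i. complex_of_real (\<mu> i)"] by (cases "?s S \<mu>") auto
      have "(\<Sum>i\<in>S. \<mu> i * a i) \<le> K * q"
      proof (rule field_le_mult_one_interval)
        fix \<theta> :: real assume \<theta>: "0 < \<theta>" "\<theta> < 1"
        \<comment> \<open>The factor \<open>\<theta>\<close> makes the test values strictly smaller than the mixed norms.\<close>
        have "ennreal (\<Sum>i\<in>S. \<mu> i * (weight i * (\<theta> * a i / weight i))) \<le> ennreal K * ?s S \<mu>"
        proof (rule key[OF S \<mu>])
          show "0 \<le> \<theta> * a i / weight i" for i
            using \<theta> a(2)[of i] weight_pos[of i] by simp
          show "\<theta> * a i / weight i = 0 \<or> ennreal (\<theta> * a i / weight i) < ?A i" for i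
          proof (cases "a i = 0")
            case False
            then have ai: "0 < a i" using a(2)[of i] by simp
            have "?A i = ennreal (a i / weight i)"
            proof -
              have "ennreal (1 / weight i) * (ennreal (weight i) * ?A i) = ennreal (1 / weight i) * ennreal (a i)"
                using a(1)[of i] by (simp only: local_norm_def)
              then show ?thesis
                using weight_pos[of i] a(2)[of i] by (simp add: mult.assoc[symmetric] ennreal_mult[symmetric])
            qed
            moreover have "\<theta> * a i / weight i < a i / weight i"
              using \<theta> ai weight_pos[of i] by (intro divide_strict_right_mono) auto
            ultimately show ?thesis
              using ai \<theta> weight_pos[of i] by (simp add: ennreal_less_iff)
          qed simp
        qed
        moreover have "(\<Sum>i\<in>S. \<mu> i * (weight i * (\<theta> * a i / weight i))) = \<theta> * (\<Sum>i\<in>S. \<mu> i * a i)"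
        proof -
          have "\<mu> i * (weight i * (\<theta> * a i / weight i)) = \<theta> * (\<mu> i * a i)" for i
            using weight_pos[of i] by simp
          then show ?thesis by (simp only: sum_distrib_left)
        qed
        ultimately have "ennreal (\<theta> * (\<Sum>i\<in>S. \<mu> i * a i)) \<le> ennreal (K * q)"
          using q K by (simp add: ennreal_mult)
        then show "\<theta> * (\<Sum>i\<in>S. \<mu> i * a i) \<le> K * q"
          using K q by (simp add: ennreal_le_iff)
      qed
      then show ?thesis using q K by (simp add: ennreal_mult[symmetric] ennreal_leI)
    qed
    have "local_norm f = (\<lambda>i. ennreal (a i))" using a(1) by (rule ext)
    moreover have "lp_norm (count_space UNIV) r (\<lambda>i. ennreal (a i)) \<le> ennreal K"
    proof (rule lp_norm_le_by_duality[OF r rfin a(2)])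
      fix S :: "(int \<times> 'n ivec) set" and \<mu> :: "int \<times> 'n ivec \<Rightarrow> real"
      assume S: "finite S" and \<mu>: "\<And>i. 0 \<le> \<mu> i"
      have "(\<lambda>i. ennreal (norm (if i \<in> S then complex_of_real (\<mu> i) else 0))) = (\<lambda>i. ennreal (if i \<in> S then \<mu> i else 0))"
        by (auto simp: \<mu>)
      then show "ennreal (\<Sum>i\<in>S. \<mu> i * a i)
          \<le> ennreal K * lp_norm (count_space UNIV) (conj_exp r) (\<lambda>i. ennreal (if i \<in> S then \<mu> i else 0))"
        using test[of S \<mu>, OF S \<mu>] by (simp only: seq_norm_def)
    qed
    ultimately show ?thesis
      unfolding bm_norm_finite[OF rfin] by simp
  qed
qed

section \<open>Representation of bounded functionals\<close>

lemma block_norm_le_bounded: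
  assumes S: "finite S" and c: "0 \<le> c"
  obtains B where "0 \<le> B" "\<And>g. g \<in> borel_measurable lebesgue \<Longrightarrow> (\<And>x. x \<notin> (\<Union>i\<in>S. cube i) \<Longrightarrow> g x = 0) \<Longrightarrow>
    (\<And>x. norm (g x) \<le> c) \<Longrightarrow> N g \<le> ennreal B"
proof -
  define X where "X = (\<Sum>i\<in>S. ennreal (1 / weight i) * mixed_enorm dual_exps (\<lambda>x. ennreal c * indicator (cube i) x))"
  have "X < \<infinity>"
    unfolding X_def using mixed_enorm_bounded_finite[of dual_exps, OF p_exp(5) cube_bounded cube_borel c] S
    by (simp add: ennreal_mult_less_top)
  show ?thesis
  proof (rule that[of "enn2real X"])
    fix g :: "'n rvec \<Rightarrow> complex"
    assume g: "g \<in> borel_measurable lebesgue" "\<And>x. x \<notin> (\<Union>i\<in>S. cube i) \<Longrightarrow> g x = 0" "\<And>x. norm (g x) \<le> c"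
    have "N g \<le> (\<Sum>i\<in>S. ennreal (1 / weight i) * mixed_norm dual_exps (\<lambda>x. g x * indicator (cube i) x))"
      by (rule block_norm_le_sum[OF S g(1,2)])
    also have "\<dots> \<le> X"
      unfolding X_def mixed_norm_eq_enorm using g(3)
      by (intro sum_mono mult_left_mono mixed_enorm_mono_AE p_exp AE_I2)
        (auto simp: indicator_def ennreal_leI)
    also have "X = ennreal (enn2real X)" using \<open>X < \<infinity>\<close> by simp
    finally show "N g \<le> ennreal (enn2real X)" .
  qed simp
qed

lemma bounded_mem:
  assumes S: "finite S" and g: "g \<in> borel_measurable lebesgue" "\<And>x. x \<notin> (\<Union>i\<in>S. cube i) \<Longrightarrow> g x = 0" "\<And>x. norm (g x) \<le> c"
  shows "g \<in> V"
proof -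
  have "0 \<le> c" using g(3) norm_ge_zero order_trans by blast
  then obtain B where "\<And>g. g \<in> borel_measurable lebesgue \<Longrightarrow> (\<And>x. x \<notin> (\<Union>i\<in>S. cube i) \<Longrightarrow> g x = 0) \<Longrightarrow>
    (\<And>x. norm (g x) \<le> c) \<Longrightarrow> N g \<le> ennreal B"
    by (rule block_norm_le_bounded[OF S]) blast
  from this[OF g] show ?thesis
    using g(1) by (auto simp: block_space_iff intro: order_le_less_trans)
qed

lemma block_norm_dominated:
  assumes S: "finite S" and g: "\<And>k. g k \<in> borel_measurable lebesgue" "\<And>k x. x \<notin> (\<Union>i\<in>S. cube i) \<Longrightarrow> g k x = 0"
    "\<And>k x. norm (g k x) \<le> c" and lim: "\<And>x. (\<lambda>k. g k x) \<longlonglongrightarrow> 0"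
  shows "(\<lambda>k. N (g k)) \<longlonglongrightarrow> 0"
proof -
  have c: "0 \<le> c" using g(3) norm_ge_zero order_trans by blast
  note [measurable] = g(1)
  have one: "(\<lambda>k. ennreal (1 / weight i) * mixed_norm dual_exps (\<lambda>x. g k x * indicator (cube i) x)) \<longlonglongrightarrow> 0" for i
  proof -
    have "(\<lambda>k. mixed_enorm dual_exps (\<lambda>x. ennreal (norm (g k x * indicator (cube i) x)))) \<longlonglongrightarrow> 0"
    proof (rule mixed_enorm_dominated[of _ _ "\<lambda>x. ennreal c * indicator (cube i) x"])
      show "mixed_enorm dual_exps (\<lambda>x. ennreal c * indicator (cube i) x) < \<infinity>"
        by (rule mixed_enorm_bounded_finite[OF p_exp(5) cube_bounded cube_borel c])
      show "AE x in lborel. ennreal (norm (g k x * indicator (cube i) x)) \<le> ennreal c * indicator (cube i) x" for k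
        using g(3) by (intro AE_I2) (auto simp: indicator_def ennreal_leI)
      have "(\<lambda>k. g k x * indicator (cube i) x) \<longlonglongrightarrow> 0" for x
        using tendsto_mult_left_zero[OF lim[of x]] .
      then have "(\<lambda>k. ennreal (norm (g k x * indicator (cube i) x))) \<longlonglongrightarrow> ennreal 0" for x
        by (intro tendsto_ennrealI tendsto_norm_zero)
      then show "AE x in lborel. (\<lambda>k. ennreal (norm (g k x * indicator (cube i) x))) \<longlonglongrightarrow> 0"
        by simp
    qed (auto simp: p_exp)
    then have "(\<lambda>k. ennreal (1 / weight i) * mixed_norm dual_exps (\<lambda>x. g k x * indicator (cube i) x)) \<longlonglongrightarrow> ennreal (1 / weight i) * 0"
      unfolding mixed_norm_eq_enorm by (intro ennreal_tendsto_cmult) simp_all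
    then show ?thesis by simp
  qed
  have "(\<lambda>k. \<Sum>i\<in>S. ennreal (1 / weight i) * mixed_norm dual_exps (\<lambda>x. g k x * indicator (cube i) x)) \<longlonglongrightarrow> (\<Sum>i\<in>S. 0)"
    by (intro tendsto_sum one)
  then have "(\<lambda>k. \<Sum>i\<in>S. ennreal (1 / weight i) * mixed_norm dual_exps (\<lambda>x. g k x * indicator (cube i) x)) \<longlonglongrightarrow> 0"
    by simp
  then show ?thesis
    by (rule tendsto_0_le_ennreal) (rule block_norm_le_sum[OF S g(1,2)])
qed

text \<open>
The sets whose indicator functions are available as test functions.
\<close>

definition local_sets :: "'n rvec set set" where
  "local_sets = {B \<in> sets lebesgue. \<exists>S. finite S \<and> B \<subseteq> (\<Union>i\<in>S. cube i)}"

lemma local_sets_obtain: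
  assumes "B \<in> local_sets"
  obtains S where "B \<in> sets lebesgue" "finite S" "B \<subseteq> (\<Union>i\<in>S. cube i)"
  using assms by (auto simp: local_sets_def)

lemma indicator_mem: "B \<in> local_sets \<Longrightarrow> indicator B \<in> V"
proof -
  assume "B \<in> local_sets"
  then obtain S where B: "B \<in> sets lebesgue" "finite S" "B \<subseteq> (\<Union>i\<in>S. cube i)" by (rule local_sets_obtain)
  then show ?thesis
    by (intro bounded_mem[OF B(2), of _ 1]) (auto simp: indicator_def split: if_splits)
qed

lemma cube_local: "A \<in> sets lebesgue \<Longrightarrow> A \<inter> cube i \<in> local_sets"
  unfolding local_sets_def by (auto intro!: exI[of _ "{i}"])

text \<open>
Countable additivity is dominated convergence in the block norm: the indicator functions of the
remainders of a disjoint union tend to zero. The map \<open>\<phi>\<close> will be the real or the imaginary part.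
\<close>

lemma local_charge_functional:
  assumes L: "bounded_linear_on K L" and \<phi>: "bounded_linear \<phi>" and \<phi>1: "\<And>z. \<bar>\<phi> z\<bar> \<le> norm z"
  shows "local_charge lebesgue local_sets (\<lambda>B. \<phi> (L (indicator B))) (\<lambda>n. cube (0, from_nat n))"
proof (rule local_charge.intro)
  show "sigma_finite_measure (lebesgue :: 'n rvec measure)" by (rule sigma_finite_lebesgue)
  show "B \<in> sets lebesgue" if "B \<in> local_sets" for B using that by (simp add: local_sets_def)
  show "A \<in> local_sets" if "B \<in> local_sets" "A \<in> sets lebesgue" "A \<subseteq> B" for A B
    using that unfolding local_sets_def by blast
  show "A \<union> B \<in> local_sets" if AB: "A \<in> local_sets" "B \<in> local_sets" for A B
  proof -
    obtain S where S: "A \<in> sets lebesgue" "finite S" "A \<subseteq> (\<Union>i\<in>S. cube i)" using AB(1) by (rule local_sets_obtain)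
    obtain S' where S': "B \<in> sets lebesgue" "finite S'" "B \<subseteq> (\<Union>i\<in>S'. cube i)" using AB(2) by (rule local_sets_obtain)
    have "finite (S \<union> S')" "A \<union> B \<subseteq> (\<Union>i\<in>S \<union> S'. cube i)" using S S' by auto
    then show ?thesis unfolding local_sets_def using S(1) S'(1) by blast
  qed
  show "cube (0, from_nat n) \<in> local_sets" for n
    using cube_local[of UNIV "(0, from_nat n)"] by simp
  have "x \<in> (\<Union>n. cube (0, from_nat n))" for x :: "'n rvec"
  proof -
    have "x \<in> (\<Union>m. cube (0, m))" by (simp add: cubes_cover)
    then obtain m where "x \<in> cube (0, m)" by blast
    then have "x \<in> cube (0, from_nat (to_nat m))" by simp
    then show ?thesis by blast
  qed
  then show "(\<Union>n. cube (0, from_nat n)) = space (lebesgue :: 'n rvec measure)"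
    by auto
  show "\<phi> (L (indicator B)) = 0" if B: "B \<in> local_sets" "emeasure lebesgue B = 0" for B
  proof -
    have "B \<in> null_sets lebesgue" using B by (auto simp: local_sets_def null_sets_def)
    then have "AE x in lebesgue. indicator B x = (0 :: complex)"
      by (auto dest!: AE_not_in elim!: eventually_mono)
    from block_norm_cong_AE[OF this] have "N (indicator B) = 0" by (simp add: block_norm_0)
    then have "L (indicator B) = 0"
      using bounded_linear_onD(4)[OF L indicator_mem[OF B(1)]] by simp
    then show ?thesis using \<phi>1[of 0] by simp
  qed
  show "\<exists>c. \<forall>A\<in>local_sets. A \<subseteq> B \<longrightarrow> \<bar>\<phi> (L (indicator A))\<bar> \<le> c" if B: "B \<in> local_sets" for B
  proof -
    obtain S where S: "B \<in> sets lebesgue" "finite S" "B \<subseteq> (\<Union>i\<in>S. cube i)" using B by (rule local_sets_obtain)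
    obtain C where C: "0 \<le> C" "\<And>g. g \<in> borel_measurable lebesgue \<Longrightarrow> (\<And>x. x \<notin> (\<Union>i\<in>S. cube i) \<Longrightarrow> g x = 0) \<Longrightarrow>
      (\<And>x. norm (g x) \<le> 1) \<Longrightarrow> N g \<le> ennreal C"
      by (rule block_norm_le_bounded[OF S(2), of 1]) auto
    show ?thesis
    proof (intro exI[of _ "K * C"] ballI impI)
      fix A assume A: "A \<in> local_sets" "A \<subseteq> B"
      have "N (indicator A) \<le> ennreal C"
        by (rule C(2)) (use A S in \<open>auto simp: local_sets_def indicator_def split: if_splits\<close>)
      have "ennreal (norm (L (indicator A))) \<le> ennreal K * N (indicator A)"
        by (rule bounded_linear_onD(4)[OF L indicator_mem[OF A(1)]])
      also have "\<dots> \<le> ennreal K * ennreal C"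
        by (intro mult_left_mono) (fact, simp)
      also have "\<dots> = ennreal (K * C)"
        using bounded_linear_onD(1)[OF L] C(1) by (simp add: ennreal_mult)
      finally have "norm (L (indicator A)) \<le> K * C"
        using bounded_linear_onD(1)[OF L] C(1) by (simp add: ennreal_le_iff)
      then show "\<bar>\<phi> (L (indicator A))\<bar> \<le> K * C" using \<phi>1 order_trans by blast
    qed
  qed
  show "(\<lambda>n. \<phi> (L (indicator (D n)))) sums \<phi> (L (indicator (\<Union>n. D n)))"
    if D: "range D \<subseteq> local_sets" "disjoint_family D" "(\<Union>n. D n) \<in> local_sets" for D
  proof -
    let ?U = "\<Union>n. D n"
    obtain S where S: "?U \<in> sets lebesgue" "finite S" "?U \<subseteq> (\<Union>i\<in>S. cube i)" using D(3) by (rule local_sets_obtain)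
    have DV: "indicator (D n) \<in> V" for n using D(1) by (intro indicator_mem) auto
    have [measurable]: "D n \<in> sets lebesgue" for n using D(1) by (auto simp: local_sets_def)
    \<comment> \<open>The indicator function of the part of the union that the first \<open>n\<close> sets leave uncovered.\<close>
    define R where "R n x = (indicator ?U x - (\<Sum>k<n. indicator (D k) x) :: complex)" for n and x :: "'n rvec"
    have R_eq: "R n x = indicator ?U x - (indicator (\<Union>k<n. D k) x :: complex)" for n x
      unfolding R_def using D(2)
      by (subst indicator_UN_disjoint) (auto simp: disjoint_family_on_def)
    have RV: "R n \<in> V" for n
      unfolding R_def by (intro diff_mem sum_mem indicator_mem D(3) DV) auto
    have "(\<lambda>n. N (R n)) \<longlonglongrightarrow> 0"
    proof (rule block_norm_dominated[OF S(2), of _ 1])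
      show "R n \<in> borel_measurable lebesgue" for n using RV by (simp add: block_space_iff)
      show "R n x = 0" if "x \<notin> (\<Union>i\<in>S. cube i)" for n x
        using that S(3) by (auto simp: R_eq indicator_def)
      show "norm (R n x) \<le> 1" for n x by (auto simp: R_eq indicator_def)
      show "(\<lambda>n. R n x) \<longlonglongrightarrow> 0" for x
      proof (cases "x \<in> ?U")
        case True
        then obtain k where "x \<in> D k" by auto
        then have "R n x = 0" if "Suc k \<le> n" for n
          using that by (auto simp: R_eq indicator_def)
        then show ?thesis by (intro tendsto_eventually eventually_sequentiallyI[of "Suc k"])
      qed (simp add: R_eq indicator_def)
    qed
    from bounded_linear_on_LIMSEQ_0[OF L RV this]
    have "(\<lambda>n. L (indicator ?U) - L (R n)) \<longlonglongrightarrow> L (indicator ?U) - 0"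
      by (intro tendsto_diff tendsto_const)
    moreover have "L (indicator ?U) - L (R n) = (\<Sum>k<n. L (indicator (D k)))" for n
    proof -
      have "L (R n) = L (indicator ?U) - L (\<lambda>x. \<Sum>k<n. indicator (D k) x)"
        unfolding R_def by (intro bounded_linear_on_diff[OF L] sum_mem indicator_mem D(3) DV) auto
      also have "L (\<lambda>x. \<Sum>k<n. indicator (D k) x) = (\<Sum>k<n. L (indicator (D k)))"
        by (intro bounded_linear_on_sum[OF L] DV) auto
      finally show ?thesis by simp
    qed
    ultimately have "(\<lambda>n. \<Sum>k<n. L (indicator (D k))) \<longlonglongrightarrow> L (indicator ?U)" by simp
    from bounded_linear.tendsto[OF \<phi> this] show ?thesis
      unfolding sums_def by (simp add: linear_sum[OF bounded_linear.linear[OF \<phi>]])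
  qed
qed

lemma ex_functional_density:
  assumes L: "bounded_linear_on K L"
  obtains f :: "'n rvec \<Rightarrow> complex" where "f \<in> borel_measurable lebesgue"
    "\<And>A. A \<in> local_sets \<Longrightarrow> integrable lebesgue (\<lambda>x. f x * indicator A x)"
    "\<And>A. A \<in> local_sets \<Longrightarrow> (\<integral>x. f x * indicator A x \<partial>lebesgue) = L (indicator A)"
proof -
  obtain f1 where f1 [measurable]: "f1 \<in> borel_measurable lebesgue"
    and int1: "\<And>A. A \<in> local_sets \<Longrightarrow> integrable lebesgue (\<lambda>x. f1 x * indicator A x)"
    and eq1: "\<And>A. A \<in> local_sets \<Longrightarrow> (\<integral>x. f1 x * indicator A x \<partial>lebesgue) = Re (L (indicator A))"
    by (rule local_charge.ex_density[OF local_charge_functional[OF L bounded_linear_Re abs_Re_le_cmod]]) blast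
  obtain f2 where f2 [measurable]: "f2 \<in> borel_measurable lebesgue"
    and int2: "\<And>A. A \<in> local_sets \<Longrightarrow> integrable lebesgue (\<lambda>x. f2 x * indicator A x)"
    and eq2: "\<And>A. A \<in> local_sets \<Longrightarrow> (\<integral>x. f2 x * indicator A x \<partial>lebesgue) = Im (L (indicator A))"
    by (rule local_charge.ex_density[OF local_charge_functional[OF L bounded_linear_Im abs_Im_le_cmod]]) blast
  define f where "f x = complex_of_real (f1 x) + \<i> * complex_of_real (f2 x)" for x
  have f_eq: "f x * indicator A x = complex_of_real (f1 x * indicator A x) + \<i> * complex_of_real (f2 x * indicator A x)" for A x
    by (auto simp: f_def indicator_def)
  show ?thesis
  proof (rule that[of f])
    show "f \<in> borel_measurable lebesgue" unfolding f_def by measurable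
    fix A assume A: "A \<in> local_sets"
    note i1 = integrable_of_real[OF int1[OF A], where ?'a = complex]
    note i2 = integrable_of_real[OF int2[OF A], where ?'a = complex]
    show "integrable lebesgue (\<lambda>x. f x * indicator A x)"
      unfolding f_eq by (intro Bochner_Integration.integrable_add i1 integrable_mult_right i2)
    have "(\<integral>x. f x * indicator A x \<partial>lebesgue) =
        complex_of_real (\<integral>x. f1 x * indicator A x \<partial>lebesgue) + \<i> * complex_of_real (\<integral>x. f2 x * indicator A x \<partial>lebesgue)"
      unfolding f_eq Bochner_Integration.integral_add[OF i1 integrable_mult_right[OF i2]]
        integral_mult_right_zero integral_of_real[OF int1[OF A]] integral_of_real[OF int2[OF A]] ..
    also have "\<dots> = L (indicator A)" by (simp add: eq1 eq2 A complex_eq_iff)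
    finally show "(\<integral>x. f x * indicator A x \<partial>lebesgue) = L (indicator A)" .
  qed
qed

lemma cube_bounded_fun_mem: "cube_bounded_fun i g \<Longrightarrow> g \<in> V"
  unfolding cube_bounded_fun_def by (auto intro: bounded_mem[of "{i}"])

text \<open>
From indicator functions to bounded functions on one cube: both sides are linear, and by dominated
convergence they are continuous along the approximation of \<open>g\<close> by simple functions.
\<close>

lemma density_extend:
  assumes L: "bounded_linear_on K L" and f [measurable]: "f \<in> borel_measurable lebesgue"
    and int: "\<And>A. A \<in> local_sets \<Longrightarrow> integrable lebesgue (\<lambda>x. f x * indicator A x)"
    and eq: "\<And>A. A \<in> local_sets \<Longrightarrow> (\<integral>x. f x * indicator A x \<partial>lebesgue) = L (indicator A)"
    and g: "cube_bounded_fun i g"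
  shows "L g = (\<integral>x. g x * f x \<partial>lebesgue)"
proof -
  let ?I = "\<lambda>g. \<integral>x. g x * f x \<partial>lebesgue"
  have intQ: "integrable lebesgue (\<lambda>x. f x * indicator (cube i) x)"
    using int[OF cube_local[of UNIV i]] by simp
  obtain c where g': "g \<in> borel_measurable lebesgue" "\<And>x. x \<notin> cube i \<Longrightarrow> g x = 0" "\<And>x. norm (g x) \<le> c"
    using g by (auto simp: cube_bounded_fun_def)
  obtain s where s: "\<And>k. simple_function lebesgue (s k)" "\<And>x. (\<lambda>k. s k x) \<longlonglongrightarrow> g x"
    and s_le: "\<And>k x. norm (s k x) \<le> 2 * norm (g x)"
    using borel_measurable_implies_sequence_metric[OF g'(1), of 0] by auto
  have s_off: "s k x = 0" if "x \<notin> cube i" for k x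
    using s_le[of k x] g'(2)[OF that] by simp
  have s_c: "norm (s k x) \<le> 2 * c" for k x
    using s_le[of k x] g'(3)[of x] by simp
  have [measurable]: "s k \<in> borel_measurable lebesgue" for k
    by (rule borel_measurable_simple_function[OF s(1)])
  have sb: "cube_bounded_fun i (s k)" for k
    using s_off s_c[of k] by (auto simp: cube_bounded_fun_def)
  have simple: "L (s k) = ?I (s k)" for k
  proof -
    \<comment> \<open>The value zero is left out: only the level sets of the other values lie in the cube.\<close>
    let ?R = "range (s k) - {0}" and ?A = "\<lambda>y. s k -` {y}"
    have fin: "finite ?R" using simple_functionD(1)[OF s(1)[of k]] by simp
    have A: "?A y \<in> local_sets" if "y \<in> ?R" for y
    proof -
      have "?A y \<in> sets lebesgue" using simple_functionD(2)[OF s(1)[of k], of "{y}"] by simp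
      moreover have "?A y \<inter> cube i = ?A y" using s_off that by blast
      ultimately show ?thesis using cube_local[of "?A y" i] by simp
    qed
    have s_eq: "s k = (\<lambda>x. \<Sum>y\<in>?R. y * indicator (?A y) x)"
    proof
      fix x
      have "(\<Sum>y\<in>?R. y * indicator (?A y) x) = (\<Sum>y\<in>?R. if y = s k x then y else 0)"
        by (intro sum.cong refl) (simp add: indicator_def)
      also have "\<dots> = s k x" using fin by (simp add: sum.delta)
      finally show "s k x = (\<Sum>y\<in>?R. y * indicator (?A y) x)" by simp
    qed
    have "L (s k) = L (\<lambda>x. \<Sum>y\<in>?R. y * indicator (?A y) x)" by (rule arg_cong[OF s_eq])
    also have "\<dots> = (\<Sum>y\<in>?R. L (\<lambda>x. y * indicator (?A y) x))"
      by (intro bounded_linear_on_sum[OF L] fin cmult_mem indicator_mem A)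
    also have "\<dots> = (\<Sum>y\<in>?R. \<integral>x. y * (f x * indicator (?A y) x) \<partial>lebesgue)"
      by (intro sum.cong refl) (simp add: bounded_linear_onD(3)[OF L indicator_mem] A eq)
    also have "\<dots> = (\<integral>x. (\<Sum>y\<in>?R. y * (f x * indicator (?A y) x)) \<partial>lebesgue)"
      by (intro Bochner_Integration.integral_sum[symmetric] integrable_mult_right int A)
    also have "\<dots> = (\<integral>x. (\<Sum>y\<in>?R. y * indicator (?A y) x) * f x \<partial>lebesgue)"
      unfolding sum_distrib_right by (simp only: mult.assoc mult.commute mult.left_commute)
    also have "\<dots> = ?I (s k)"
      by (rule arg_cong[OF s_eq[symmetric], of ?I])
    finally show ?thesis .
  qed
  have dV: "(\<lambda>x. g x - s k x) \<in> V" for k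
    by (intro diff_mem cube_bounded_fun_mem[OF g] cube_bounded_fun_mem[OF sb])
  have "(\<lambda>k. N (\<lambda>x. g x - s k x)) \<longlonglongrightarrow> 0"
  proof (rule block_norm_dominated[of "{i}" _ "3 * c"])
    show "(\<lambda>x. g x - s k x) \<in> borel_measurable lebesgue" for k
      using dV by (simp add: block_space_iff)
    show "g x - s k x = 0" if "x \<notin> (\<Union>i\<in>{i}. cube i)" for k x
      using that g'(2) s_off by simp
    show "norm (g x - s k x) \<le> 3 * c" for k x
      using norm_triangle_ineq4[of "g x" "s k x"] g'(3)[of x] s_c[of k x] by simp
    show "(\<lambda>k. g x - s k x) \<longlonglongrightarrow> 0" for x
      using tendsto_diff[OF tendsto_const[of "g x"] s(2)[of x]] by simp
  qed simp
  from bounded_linear_on_LIMSEQ_0[OF L dV this]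
  have "(\<lambda>k. L g - L (\<lambda>x. g x - s k x)) \<longlonglongrightarrow> L g - 0"
    by (intro tendsto_diff tendsto_const)
  moreover have "L g - L (\<lambda>x. g x - s k x) = ?I (s k)" for k
    using bounded_linear_on_diff[OF L cube_bounded_fun_mem[OF g] cube_bounded_fun_mem[OF sb[of k]]] simple[of k]
    by simp
  ultimately have 1: "(\<lambda>k. ?I (s k)) \<longlonglongrightarrow> L g" by simp
  have 2: "(\<lambda>k. ?I (s k)) \<longlonglongrightarrow> ?I g"
  proof (rule integral_dominated_convergence[of _ _ _ "\<lambda>x. 2 * c * norm (f x * indicator (cube i) x)"])
    show "integrable lebesgue (\<lambda>x. 2 * c * norm (f x * indicator (cube i) x))"
      by (intro integrable_mult_right integrable_norm intQ)
    show "AE x in lebesgue. (\<lambda>k. s k x * f x) \<longlonglongrightarrow> g x * f x"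
      by (intro AE_I2 tendsto_mult_right s)
    show "AE x in lebesgue. norm (s k x * f x) \<le> 2 * c * norm (f x * indicator (cube i) x)" for k
    proof (rule AE_I2)
      fix x show "norm (s k x * f x) \<le> 2 * c * norm (f x * indicator (cube i) x)"
        using s_off[of x k] mult_right_mono[OF s_c[of k x], of "norm (f x)"]
        by (cases "x \<in> cube i") (simp_all add: norm_mult)
    qed
  qed (use g'(1) in measurable)
  show ?thesis by (rule LIMSEQ_unique[OF 1 2])
qed

lemma pairing_integrable:
  assumes f: "f \<in> bm_space p t r" and g: "g \<in> V"
  shows "integrable lebesgue (\<lambda>x. g x * f x)"
    and "ennreal (norm (pairing f g)) \<le> N g * bm_norm p t r f"
proof -
  have [measurable]: "f \<in> borel_measurable lebesgue" "g \<in> borel_measurable lebesgue"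
    using f g by (auto simp: bm_space_def block_space_iff)
  have le: "(\<integral>\<^sup>+ x. ennreal (norm (g x * f x)) \<partial>lebesgue) \<le> N g * bm_norm p t r f"
    by (rule pairing_le[OF f g])
  also have "\<dots> < \<infinity>" using f g by (simp add: bm_space_def block_space_iff ennreal_mult_less_top)
  finally show *: "integrable lebesgue (\<lambda>x. g x * f x)" by (intro integrableI_bounded) auto
  have "ennreal (norm (pairing f g)) \<le> (\<integral>\<^sup>+ x. ennreal (norm (g x * f x)) \<partial>lebesgue)"
    unfolding pairing_def by (rule integral_norm_bound_ennreal[OF *])
  then show "ennreal (norm (pairing f g)) \<le> N g * bm_norm p t r f" using le by (rule order_trans)
qed

lemma bounded_linear_on_pairing:
  assumes f: "f \<in> bm_space p t r"
  shows "bounded_linear_on (enn2real (bm_norm p t r f)) (pairing f)"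
proof -
  have "bm_norm p t r f = ennreal (enn2real (bm_norm p t r f))"
    using f by (simp add: bm_space_def)
  then have "ennreal (norm (pairing f g)) \<le> ennreal (enn2real (bm_norm p t r f)) * N g" if "g \<in> V" for g
    using pairing_integrable(2)[OF f that] by (simp add: mult.commute)
  then show ?thesis
    unfolding bounded_linear_on_def
    by (auto simp: pairing_def distrib_right mult.assoc pairing_integrable[OF f])
qed

lemma bm_space_locally_integrable:
  assumes "f \<in> bm_space p t r"
  shows "integrable lebesgue (\<lambda>x. f x * indicator (cube i) x)"
  using pairing_integrable(1)[OF assms indicator_mem[OF cube_local[of UNIV i]]] by (simp add: mult.commute)

text \<open>
The difference \<open>L - pairing f\<close> is itself a bounded functional once \<open>f\<close> is known to belong to the
Bourgain-Morrey space, and it vanishes on bounded functions living on single cubes.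
\<close>

lemma representation:
  assumes L: "bounded_linear_on K L"
  obtains f where "f \<in> bm_space p t r" "bm_norm p t r f \<le> ennreal K" "\<And>g. g \<in> V \<Longrightarrow> L g = pairing f g"
proof -
  obtain f where f: "f \<in> borel_measurable lebesgue"
    "\<And>A. A \<in> local_sets \<Longrightarrow> integrable lebesgue (\<lambda>x. f x * indicator A x)"
    "\<And>A. A \<in> local_sets \<Longrightarrow> (\<integral>x. f x * indicator A x \<partial>lebesgue) = L (indicator A)"
    by (rule ex_functional_density[OF L]) blast
  have ext: "L g = (\<integral>x. g x * f x \<partial>lebesgue)" if "cube_bounded_fun i g" for i g
    by (rule density_extend[OF L f that])
  have le: "bm_norm p t r f \<le> ennreal K"
  proof (rule bm_norm_le_of_bounded_functional[OF L f(1)])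
    show "integrable lebesgue (\<lambda>x. f x * indicator (cube i) x)" for i
      using f(2)[OF cube_local[of UNIV i]] by simp
  qed (rule ext)
  then have fbm: "f \<in> bm_space p t r"
    using f(1) by (auto simp: bm_space_def intro: order_le_less_trans)
  define B where "B = enn2real (bm_norm p t r f)"
  have P: "bounded_linear_on B (pairing f)"
    unfolding B_def by (rule bounded_linear_on_pairing[OF fbm])
  have T: "bounded_linear_on (K + B) (\<lambda>g. L g - pairing f g)"
    unfolding bounded_linear_on_def
  proof (intro conjI ballI allI)
    show "0 \<le> K + B" using bounded_linear_onD(1)[OF L] bounded_linear_onD(1)[OF P] by simp
    show "L (\<lambda>x. g x + h x) - pairing f (\<lambda>x. g x + h x) = L g - pairing f g + (L h - pairing f h)"
      if "g \<in> V" "h \<in> V" for g h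
      using bounded_linear_onD(2)[OF L that] bounded_linear_onD(2)[OF P that] by simp
    show "L (\<lambda>x. c * g x) - pairing f (\<lambda>x. c * g x) = c * (L g - pairing f g)" if "g \<in> V" for c g
      using bounded_linear_onD(3)[OF L that] bounded_linear_onD(3)[OF P that] by (simp add: right_diff_distrib)
    show "ennreal (norm (L g - pairing f g)) \<le> ennreal (K + B) * N g" if g: "g \<in> V" for g
    proof -
      have "ennreal (norm (L g - pairing f g)) \<le> ennreal (norm (L g) + norm (pairing f g))"
        by (intro ennreal_leI norm_triangle_ineq4)
      also have "\<dots> = ennreal (norm (L g)) + ennreal (norm (pairing f g))" by simp
      also have "\<dots> \<le> ennreal K * N g + ennreal B * N g"
        by (intro add_mono bounded_linear_onD(4)[OF L g] bounded_linear_onD(4)[OF P g])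
      also have "\<dots> = ennreal (K + B) * N g"
        using bounded_linear_onD(1)[OF L] bounded_linear_onD(1)[OF P] by (simp add: distrib_right)
      finally show ?thesis .
    qed
  qed
  have "L g - pairing f g = 0" if "g \<in> V" for g
  proof (rule bounded_linear_on_eq_0[OF T _ that])
    fix i g assume "cube_bounded_fun i g"
    from ext[OF this] show "L g - pairing f g = 0" by (simp add: pairing_def)
  qed
  then show ?thesis using fbm le by (intro that[of f]) auto
qed

section \<open>The dual norm, uniqueness and attainment\<close>

lemma dual_norm_le: "bounded_linear_on K L \<Longrightarrow> dual_norm p t r L \<le> ennreal K"
  unfolding dual_norm_def
proof (rule SUP_least)
  fix g assume L: "bounded_linear_on K L" and "g \<in> {g \<in> V. N g \<le> 1}"
  then have g: "g \<in> V" "N g \<le> 1" by auto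
  have "ennreal (norm (L g)) \<le> ennreal K * N g" by (rule bounded_linear_onD(4)[OF L g(1)])
  also have "\<dots> \<le> ennreal K * 1" by (intro mult_left_mono g) simp
  finally show "ennreal (norm (L g)) \<le> ennreal K" by simp
qed

text \<open>
Where the block norm vanishes, scaling to norm one is impossible, but there the given bound already
forces \<open>L g = 0\<close>.
\<close>

lemma bounded_linear_on_dual_norm:
  assumes L: "bounded_linear_on K L"
  shows "bounded_linear_on (enn2real (dual_norm p t r L)) L"
proof -
  have "dual_norm p t r L < \<infinity>"
    using dual_norm_le[OF L] by (auto intro: order_le_less_trans)
  then have D: "ennreal (enn2real (dual_norm p t r L)) = dual_norm p t r L" by simp
  have "ennreal (norm (L g)) \<le> dual_norm p t r L * N g" if g: "g \<in> V" for g
  proof -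
    obtain a where a: "N g = ennreal a" "0 \<le> a"
      using g by (cases "N g") (auto simp: block_space_iff)
    show ?thesis
    proof (cases "a = 0")
      case True
      then show ?thesis using bounded_linear_onD(4)[OF L g] a by simp
    next
      case False
      then have a0: "0 < a" using a by simp
      let ?h = "\<lambda>x. complex_of_real (1 / a) * g x"
      have "N ?h = ennreal (norm (complex_of_real (1 / a))) * N g"
        by (rule block_norm_cmult) (use a0 in simp)
      also have "\<dots> = 1"
        using a a0 by (simp add: ennreal_mult[symmetric] norm_divide)
      finally have "N ?h \<le> 1" by simp
      then have "?h \<in> {g \<in> V. N g \<le> 1}" by (intro CollectI conjI cmult_mem g)
      then have "ennreal (norm (L ?h)) \<le> dual_norm p t r L"
        unfolding dual_norm_def by (rule SUP_upper)
      moreover have "norm (L ?h) = norm (L g) / a"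
        using bounded_linear_onD(3)[OF L g, of "complex_of_real (1 / a)"] a0 by (simp add: norm_mult norm_divide)
      ultimately have "ennreal (norm (L g) / a) * ennreal a \<le> dual_norm p t r L * ennreal a"
        by (intro mult_right_mono) auto
      then show ?thesis using a a0 by (simp add: ennreal_mult[symmetric])
    qed
  qed
  then show ?thesis
    using L unfolding bounded_linear_on_def D by simp
qed

text \<open>
The pairing with \<open>f\<close> is bounded with constant \<open>dual_norm\<close>, so the converse inequality applies with \<open>f\<close>
itself as representing function.
\<close>

lemma bm_norm_eq_dual_norm:
  assumes f: "f \<in> bm_space p t r"
  shows "bm_norm p t r f = dual_norm p t r (pairing f)"
proof (rule antisym)
  note P = bounded_linear_on_pairing[OF f]
  have D: "ennreal (enn2real (dual_norm p t r (pairing f))) = dual_norm p t r (pairing f)"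
    using order_le_less_trans[OF dual_norm_le[OF P]] by simp
  have "bm_norm p t r f \<le> ennreal (enn2real (dual_norm p t r (pairing f)))"
  proof (rule bm_norm_le_of_bounded_functional[OF bounded_linear_on_dual_norm[OF P]])
    show "f \<in> borel_measurable lebesgue" using f by (simp add: bm_space_def)
  qed (simp_all add: bm_space_locally_integrable[OF f] pairing_def)
  then show "bm_norm p t r f \<le> dual_norm p t r (pairing f)" by (simp only: D)
  have "dual_norm p t r (pairing f) \<le> ennreal (enn2real (bm_norm p t r f))" by (rule dual_norm_le[OF P])
  also have "\<dots> = bm_norm p t r f" using f by (simp add: bm_space_def)
  finally show "dual_norm p t r (pairing f) \<le> bm_norm p t r f" .
qed

text \<open>
Testing the difference \<open>f' - f\<close> with \<open>cnj (sgn (f' - f))\<close> on a cube gives the integral of \<open>\<bar>f' - f\<bar>\<close> over it.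
\<close>

lemma representation_unique:
  assumes f: "f \<in> bm_space p t r" "f' \<in> bm_space p t r"
    and eq: "\<And>g. g \<in> V \<Longrightarrow> pairing f' g = pairing f g"
  shows "AE x in lebesgue. f' x = f x"
proof -
  let ?h = "\<lambda>x. f' x - f x"
  have [measurable]: "f \<in> borel_measurable lebesgue" "f' \<in> borel_measurable lebesgue"
    using f by (auto simp: bm_space_def)
  have "cnj \<in> borel_measurable borel"
    by (intro borel_measurable_continuous_onI continuous_intros)
  note [measurable] = this
  have "AE x in lebesgue. x \<in> cube i \<longrightarrow> ?h x = 0" for i
  proof -
    let ?g = "\<lambda>x. cnj (sgn (?h x)) * indicator (cube i) x"
    have g: "?g \<in> V"
    proof (rule bounded_mem[of "{i}" _ 1])
      show "?g \<in> borel_measurable lebesgue" unfolding sgn_div_norm by measurable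
      show "norm (?g x) \<le> 1" for x by (simp add: indicator_def norm_sgn)
    qed auto
    have gh: "?g x * f' x - ?g x * f x = complex_of_real (norm (?h x) * indicator (cube i) x)" for x
      using cnj_sgn_mult[of "?h x"] by (simp add: indicator_def right_diff_distrib)
    have int: "integrable lebesgue (\<lambda>x. norm (?h x) * indicator (cube i) x)"
      using integrable_norm[OF Bochner_Integration.integrable_diff[OF bm_space_locally_integrable[OF f(2), of i] bm_space_locally_integrable[OF f(1), of i]]]
      by (rule Bochner_Integration.integrable_bound) (auto simp: indicator_def)
    have "0 = pairing f' ?g - pairing f ?g" using eq[OF g] by simp
    also have "\<dots> = (\<integral>x. ?g x * f' x - ?g x * f x \<partial>lebesgue)"
      unfolding pairing_def
      by (rule Bochner_Integration.integral_diff[symmetric]) (rule pairing_integrable(1)[OF f(2) g], rule pairing_integrable(1)[OF f(1) g])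
    also have "\<dots> = complex_of_real (\<integral>x. norm (?h x) * indicator (cube i) x \<partial>lebesgue)"
      unfolding gh by (rule integral_of_real[OF int])
    finally have "(\<integral>x. norm (?h x) * indicator (cube i) x \<partial>lebesgue) = 0" by simp
    then have "AE x in lebesgue. norm (?h x) * indicator (cube i) x = 0"
      by (subst (asm) integral_nonneg_eq_0_iff_AE[OF int]) auto
    then show ?thesis by eventually_elim (auto simp: indicator_def split: if_splits)
  qed
  then have "AE x in lebesgue. \<forall>m. x \<in> cube (0, m) \<longrightarrow> ?h x = 0"
    by (intro AE_all_countable[THEN iffD2] allI)
  then show ?thesis
  proof eventually_elim
    fix x assume *: "\<forall>m. x \<in> cube (0, m) \<longrightarrow> ?h x = 0"
    have "x \<in> (\<Union>m. cube (0, m))" by (simp add: cubes_cover)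
    then show "f' x = f x" using * by auto
  qed
qed

lemma bounded_linear_on_of_continuous:
  assumes lin: "linear_functional p t r L" and cont: "continuous_functional p t r L"
  obtains K where "bounded_linear_on K L"
proof -
  have add: "L (\<lambda>x. g x + h x) = L g + L h" if "g \<in> V" "h \<in> V" for g h
    using lin[unfolded linear_functional_def, THEN conjunct1, rule_format, OF that] .
  have cmult: "L (\<lambda>x. c * g x) = c * L g" if "g \<in> V" for c g
    using lin[unfolded linear_functional_def, THEN conjunct2, THEN conjunct1, rule_format, OF that] .
  have L0: "L (\<lambda>x. 0) = 0" using cmult[OF zero_mem, of 0] by simp
  obtain \<delta> where \<delta>: "0 < \<delta>" "\<And>h. h \<in> V \<Longrightarrow> N h < ennreal \<delta> \<Longrightarrow> norm (L h) < 1"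
    using cont[unfolded continuous_functional_def, rule_format, OF zero_mem, of 1] L0 by auto
  have "ennreal (norm (L g)) \<le> ennreal (2 / \<delta>) * N g" if g: "g \<in> V" for g
  proof -
    obtain a where a: "N g = ennreal a" "0 \<le> a"
      using g by (cases "N g") (auto simp: block_space_iff)
    have scale: "c * norm (L g) < 1" if c: "0 < c" "c * a < \<delta>" for c :: real
    proof -
      have "N (\<lambda>x. complex_of_real c * g x) = ennreal (c * a)"
        using block_norm_cmult[of "complex_of_real c" g] c a by (simp add: ennreal_mult)
      then have "N (\<lambda>x. complex_of_real c * g x) < ennreal \<delta>"
        using c a by (simp add: ennreal_less_iff)
      from \<delta>(2)[OF cmult_mem[OF g] this] show ?thesis
        using cmult[OF g, of "complex_of_real c"] c by (simp add: norm_mult)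
    qed
    have "norm (L g) \<le> 2 / \<delta> * a"
    proof (cases "a = 0")
      case True
      have "norm (L g) = 0"
      proof (rule ccontr)
        assume "norm (L g) \<noteq> 0"
        then have "0 < norm (L g)" by simp
        then show False using scale[of "1 / norm (L g)"] True \<delta>(1) by simp
      qed
      then show ?thesis using True by simp
    next
      case False
      then have a0: "0 < a" using a by simp
      \<comment> \<open>Half of \<open>\<delta>\<close>, because the condition on the norm is a strict inequality.\<close>
      have "\<delta> / (2 * a) * norm (L g) < 1"
        by (rule scale) (use a0 \<delta>(1) in \<open>auto simp: field_simps\<close>)
      then show ?thesis using a0 \<delta>(1) by (simp add: field_simps)
    qed
    then show ?thesis using a \<delta>(1) by (simp add: ennreal_mult[symmetric] ennreal_leI)
  qed
  then show ?thesis
    using add cmult \<delta>(1) by (intro that[of "2 / \<delta>"]) (simp add: bounded_linear_on_def)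
qed

text \<open>
A Hahn-Banach functional for the block norm that norms \<open>g\<close> is represented by a function of norm at
most one.
\<close>

lemma block_norm_attained:
  assumes g: "g \<in> V"
  obtains f where "f \<in> bm_space p t r" "bm_norm p t r f \<le> 1" "ennreal (norm (pairing f g)) = N g"
proof -
  have fin: "N h = ennreal (enn2real (N h))" if "h \<in> V" for h
    using that by (simp add: block_space_iff)
  obtain L :: "('n rvec \<Rightarrow> complex) \<Rightarrow> complex" where L:
    "\<And>f h. f \<in> V \<Longrightarrow> h \<in> V \<Longrightarrow> L (\<lambda>x. f x + h x) = L f + L h"
    "\<And>c f. f \<in> V \<Longrightarrow> L (\<lambda>x. c * f x) = c * L f"
    "\<And>f. f \<in> V \<Longrightarrow> norm (L f) \<le> enn2real (N f)" "L g = of_real (enn2real (N g))"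
  proof (rule Hahn_Banach_complex[OF block_space_subspace g, of "\<lambda>h. enn2real (N h)"])
    fix f h assume f: "f \<in> V" and h: "h \<in> V"
    have "enn2real (N (\<lambda>x. f x + h x)) \<le> enn2real (N f + N h)"
      using f h by (intro enn2real_mono block_norm_triangle) (auto simp: block_space_iff)
    also have "\<dots> = enn2real (N f) + enn2real (N h)"
      using f h by (intro enn2real_plus) (auto simp: block_space_iff)
    finally show "enn2real (N (\<lambda>x. f x + h x)) \<le> enn2real (N f) + enn2real (N h)" .
  next
    fix c f assume "f \<in> V"
    show "enn2real (N (\<lambda>x. c * f x)) = norm c * enn2real (N f)"
      by (cases "c = 0") (simp_all add: block_norm_0 block_norm_cmult enn2real_mult)
  qed blast
  have "ennreal (norm (L h)) \<le> ennreal 1 * N h" if "h \<in> V" for h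
    using ennreal_leI[OF L(3)[OF that]] fin[OF that] by simp
  then have "bounded_linear_on 1 L"
    using L(1,2) by (simp add: bounded_linear_on_def)
  then obtain f where f: "f \<in> bm_space p t r" "bm_norm p t r f \<le> ennreal 1" "\<And>g. g \<in> V \<Longrightarrow> L g = pairing f g"
    by (rule representation) blast
  show ?thesis
  proof (rule that[OF f(1)])
    show "bm_norm p t r f \<le> 1" using f(2) by simp
    have "norm (pairing f g) = enn2real (N g)"
      unfolding f(3)[OF g, symmetric] L(4) by simp
    then show "ennreal (norm (pairing f g)) = N g"
      using fin[OF g, symmetric] by (simp only:)
  qed
qed

end

section \<open>The duality theorem\<close>

theorem theorem4p11:
  fixes p :: "'n::{finite,linorder} \<Rightarrow> ennreal" and t r :: ennreal
  assumes p: "\<forall>i. 1 < p i \<and> p i < \<infinity>"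
    and tr: "(1 < of_nat CARD('n) / (\<Sum>i\<in>UNIV. 1 / p i) \<and>
              of_nat CARD('n) / (\<Sum>i\<in>UNIV. 1 / p i) < t \<and> t < r \<and> r < \<infinity>) \<or>
             (1 < of_nat CARD('n) / (\<Sum>i\<in>UNIV. 1 / p i) \<and>
              of_nat CARD('n) / (\<Sum>i\<in>UNIV. 1 / p i) \<le> t \<and> t < r \<and> r = \<infinity>)"
  shows "(\<forall>f\<in>bm_space p t r.
            (\<forall>g\<in>block_space p t r. integrable lebesgue (\<lambda>x. g x * f x)) \<and>
            linear_functional p t r (pairing f) \<and>
            bounded_functional p t r (pairing f)) \<and>
         (\<forall>L. linear_functional p t r L \<and> continuous_functional p t r L \<longrightarrow>
            (\<exists>f\<in>bm_space p t r.
               (\<forall>g\<in>block_space p t r. L g = pairing f g) \<and>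
               (\<forall>f'\<in>bm_space p t r. (\<forall>g\<in>block_space p t r. L g = pairing f' g) \<longrightarrow>
                  (AE x in lebesgue. f' x = f x)))) \<and>
         (\<forall>f\<in>bm_space p t r. bm_norm p t r f = dual_norm p t r (pairing f)) \<and>
         (\<forall>g\<in>block_space p t r.
            block_norm p t r g
              \<in> {ennreal (norm (pairing f g)) | f. f \<in> bm_space p t r \<and> bm_norm p t r f \<le> 1} \<and>
            (\<forall>f\<in>bm_space p t r. bm_norm p t r f \<le> 1 \<longrightarrow>
               ennreal (norm (pairing f g)) \<le> block_norm p t r g))"
proof -
  have r: "1 < r"
    using tr by (auto intro: less_trans less_le_trans)
  interpret block_setting p t r
    using p r by unfold_locales auto
  show ?thesis
  proof (intro conjI ballI allI impI)
    fix f g assume "f \<in> bm_space p t r" "g \<in> block_space p t r"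
    then show "integrable lebesgue (\<lambda>x. g x * f x)" by (rule pairing_integrable)
  next
    fix f assume f: "f \<in> bm_space p t r"
    note P = bounded_linear_on_pairing[OF f]
    show "linear_functional p t r (pairing f)"
      unfolding linear_functional_def
    proof (intro conjI ballI allI impI)
      fix g h assume "g \<in> V" "h \<in> V" and eq: "AE x in lebesgue. g x = h x"
      then show "pairing f g = pairing f h"
        unfolding pairing_def using f
        by (intro integral_cong_AE) (auto simp: block_space_iff bm_space_def elim: eventually_mono)
    qed (rule bounded_linear_onD[OF P]; assumption)+
    show "bounded_functional p t r (pairing f)"
      unfolding bounded_functional_def using bounded_linear_onD(1,4)[OF P] by blast
    show "bm_norm p t r f = dual_norm p t r (pairing f)"
      by (rule bm_norm_eq_dual_norm[OF f])
  next
    fix L assume "linear_functional p t r L \<and> continuous_functional p t r L"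
    then obtain K where L: "bounded_linear_on K L"
      using bounded_linear_on_of_continuous by blast
    obtain f where f: "f \<in> bm_space p t r" "\<And>g. g \<in> V \<Longrightarrow> L g = pairing f g"
      by (rule representation[OF L]) blast
    show "\<exists>f\<in>bm_space p t r. (\<forall>g\<in>V. L g = pairing f g) \<and>
        (\<forall>f'\<in>bm_space p t r. (\<forall>g\<in>V. L g = pairing f' g) \<longrightarrow> (AE x in lebesgue. f' x = f x))"
    proof (intro bexI[OF _ f(1)] conjI ballI impI f(2))
      fix f' assume "f' \<in> bm_space p t r" "\<forall>g\<in>V. L g = pairing f' g"
      then show "AE x in lebesgue. f' x = f x"
        using f by (intro representation_unique) auto
    qed
  next
    fix g assume g: "g \<in> block_space p t r"
    show "block_norm p t r g \<in> {ennreal (norm (pairing f g)) | f. f \<in> bm_space p t r \<and> bm_norm p t r f \<le> 1}"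
      using block_norm_attained[OF g] by (smt (verit) mem_Collect_eq)
    fix f assume f: "f \<in> bm_space p t r" "bm_norm p t r f \<le> 1"
    have "ennreal (norm (pairing f g)) \<le> N g * bm_norm p t r f" by (rule pairing_integrable(2)[OF f(1) g])
    also have "\<dots> \<le> N g * 1" by (intro mult_left_mono f) simp
    finally show "ennreal (norm (pairing f g)) \<le> block_norm p t r g" by simp
  qed
qed

end
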